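(* Let $(K,v_0)$ be a valued field and $x$ transcendental over $K$. For a pure extension $(K(x)|K,v)$ of $(K,v_0)$ there are the following three mutually exclusive cases: immediate, value-transcendental, residue-transcendental; and the following assertions hold: 1) The extension is immediate if and only if $\mathrm{appr}_v(x,K)$ is immediate. In this case, the extension $v$ of $v_0$ to $K(x)$ is uniquely determined by $\mathrm{appr}_v(x,K)$. 2) The extension is value-transcendental if and only if $x-b$ is value-transcendental for some $b\in K$, and this holds if and only if $\mathrm{appr}_v(x,K)$ is value-extending. If in addition $v_0K$ is divisible, then the pure extension $v$ of $v_0$ to $K(x)$ is uniquely determined by $\mathrm{appr}_v(x,K)$. 3) The extension is residue-transcendental if and only if $d(x-b)$ is residue-transcendental for some $b,d\in K$, and this holds if and only if $\mathrm{appr}_v(x,K)$ is residue-extending. In this case, the pure extension $v$ of $v_0$ to $K(x)$ is uniquely determined by $\mathrm{appr}_v(x,K)$. 4) Let $\mathcal V_p$ be the set of all pure extensions of $v_0$ to $K(x)$ and $\mathcal A_p$ the set of all pure approximation types over $(K,v_0)$. If $v_0K$ is divisible, then the function $\mathcal V_p\to\mathcal A_p$, $v\mapsto\mathrm{appr}_v(x,K)$, is a bijection. (In 1)–3), "uniquely determined by $\mathrm{appr}_v(x,K)$" means: in 1), any extension $v'$ of $v_0$ to $K(x)$, and in 2) and 3), any pure extension $v'$ of $v_0$ to $K(x)$, with $\mathrm{appr}_{v'}(x,K)=\mathrm{appr}_v(x,K)$ equals $v$.)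
   Context: Valuations are Krull valuations written additively; $vK$ is the value group, $Kv$ the residue field, $tv$ the residue of $t$, and $\infty$ is larger than all values. Extensions of $v_0$ are identified when they are equivalent over $v_0$ (differ by an order preserving isomorphism of value groups that is the identity on $v_0K$). Balls: for $c\in K$, the closed ball of radius $\gamma\in vK\cup\{\infty\}$ is $B_\gamma(c,K)=\{a\in K\mid v(a-c)\ge\gamma\}$, and the open ball of radius $\gamma\in vK$ is $B^\circ_\gamma(c,K)=\{a\in K\mid v(a-c)>\gamma\}$. Balls are recorded together with their radius and their kind (open/closed). An approximation type $\mathbf A$ over $(K,v)$ is a (possibly empty) collection of closed and open balls in $(K,v)$, any two of which are comparable by inclusion, such that whenever $\mathbf A$ contains a (closed or open) ball with center $c$ and radius $\gamma$, it contains $B_\beta(c,K)$ and $B_\beta^\circ(c,K)$ for all $\beta\in vK$ with $\beta<\gamma$, and whenever it contains $B^\circ_\gamma(c,K)$ it contains $B_\gamma(c,K)$. Its support $\mathrm{supp}\,\mathbf A$ is the set of all $\gamma\in vK\cup\{\infty\}$ such that $\mathbf A$ contains a closed ball of radius $\gamma$; this ball is then unique and denoted $\mathbf A_\gamma$. If $\mathbf A$ contains an open ball of radius $\gamma$, it is unique and denoted $\mathbf A_\gamma^\circ$. Put $\mathbf A_\gamma=\emptyset$, resp. $\mathbf A_\gamma^\circ=\emptyset$, if there is no such ball. $\bigcap\mathbf A$ is the intersection of all balls in $\mathbf A$ (and $\bigcap\emptyset=K$). $\mathbf A$ is trivial if $\infty\in\mathrm{supp}\,\mathbf A$. For an extension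 $(L|K,v)$ of valued fields and $x\in L$, $\mathrm{appr}_v(x,K)$ is the approximation type over $(K,v)$ consisting of all nonempty sets $\{c\in K\mid v(x-c)\ge\gamma\}$, $\gamma\in vK\cup\{\infty\}$ (as closed balls of radius $\gamma$), and all nonempty sets $\{c\in K\mid v(x-c)>\gamma\}$, $\gamma\in vK$ (as open balls of radius $\gamma$). A non-trivial $\mathbf A$ is: immediate if $\mathbf A\neq\emptyset$ and $\bigcap\mathbf A=\emptyset$; value-extending if $\mathbf A_\gamma^\circ\ne\emptyset$ for every $\gamma\in\mathrm{supp}\,\mathbf A$ and $\bigcap\mathbf A\neq\emptyset$ (so the empty type is value-extending); residue-extending if for every $c\in K$ there is $\gamma\in\mathrm{supp}\,\mathbf A$ with $c\in\mathbf A_\gamma\setminus\mathbf A_\gamma^\circ$, and $\bigcap\mathbf A\ne\emptyset$. An immediate $\mathbf A$ is transcendental if for every $f\in K[X]$ there is $\delta\in\mathrm{supp}\,\mathbf A$ such that $vf(c)$ is constant for $c\in\mathbf A_\delta$, and algebraic otherwise. $\mathbf A$ is a pure approximation type if it is transcendental immediate, value-extending or residue-extending. An extension $(K(x)|K,v)$ is immediate if $vK(x)=v_0K$ and $K(x)v=Kv_0$ (canonically); value-transcendental if $vK(x)/v_0K$ has rational rank 1; residue-transcendental if $K(x)v|Kv_0$ has transcendence degree 1. An element $t\in K(x)$ is value-transcendental if $vt$ is not a torsion element modulo $v_0K$; residue-transcendental if $vt=0$ and $tv$ is transcendental over $Kv_0$; valuation-transcendental if it is one of the two. The extension $(K(x)|K,v)$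 (or $v$) is pure (in $x$) if either $d(x-b)$ is valuation-transcendental for some $b,d\in K$, or $\mathrm{appr}_v(x,K)$ is a transcendental immediate approximation type. *)

theory Defs
  imports
    "HOL-Algebra.Finite_Extensions"
    "HOL-Algebra.Generated_Fields"
    "HOL-Algebra.QuotRing"
    "HOL-Computational_Algebra.Polynomial"
begin

section \<open>Ordered abelian groups\<close>

text \<open>
  Value groups are carrier-based, so that a valuation and its extensions can have different value
  groups. They extend the \<^typ>\<open>'g monoid\<close> record in order to reuse its quotients and
  homomorphisms; hence the additively written group operation, its zero and its multiples appear
  as \<open>\<otimes>\<close>, \<open>\<one>\<close> and \<open>[^]\<close>.
\<close>

record 'g ogroup = "'g monoid" +
  ole :: "'g \<Rightarrow> 'g \<Rightarrow> bool" (infix "\<preceq>\<index>" 50)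

locale ordered_abelian_group = comm_group G for G :: "('g, 'm) ogroup_scheme" (structure) +
  assumes ole_refl: "a \<in> carrier G \<Longrightarrow> a \<preceq> a"
    and ole_antisym: "\<lbrakk>a \<in> carrier G; b \<in> carrier G; a \<preceq> b; b \<preceq> a\<rbrakk> \<Longrightarrow> a = b"
    and ole_trans:
      "\<lbrakk>a \<in> carrier G; b \<in> carrier G; c \<in> carrier G; a \<preceq> b; b \<preceq> c\<rbrakk> \<Longrightarrow> a \<preceq> c"
    and ole_total: "\<lbrakk>a \<in> carrier G; b \<in> carrier G\<rbrakk> \<Longrightarrow> a \<preceq> b \<or> b \<preceq> a"
    and ole_mult_mono:
      "\<lbrakk>a \<in> carrier G; b \<in> carrier G; c \<in> carrier G; a \<preceq> b\<rbrakk> \<Longrightarrow> a \<otimes> c \<preceq> b \<otimes> c"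

definition order_embedding :: "'g ogroup \<Rightarrow> 'h ogroup \<Rightarrow> ('g \<Rightarrow> 'h) set" where
  "order_embedding G H =
    {f \<in> hom G H. \<forall>a\<in>carrier G. \<forall>b\<in>carrier G. a \<preceq>\<^bsub>G\<^esub> b \<longleftrightarrow> f a \<preceq>\<^bsub>H\<^esub> f b}"

definition order_iso :: "'g ogroup \<Rightarrow> 'h ogroup \<Rightarrow> ('g \<Rightarrow> 'h) set" where
  "order_iso G H = iso G H \<inter> order_embedding G H"

definition divisible_group :: "('g, 'm) monoid_scheme \<Rightarrow> bool" where
  "divisible_group G \<longleftrightarrow>
    (\<forall>\<gamma>\<in>carrier G. \<forall>n::nat. n > 0 \<longrightarrow> (\<exists>\<delta>\<in>carrier G. \<delta> [^]\<^bsub>G\<^esub> n = \<gamma>))"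

definition rationally_independent :: "('g, 'm) monoid_scheme \<Rightarrow> 'g set \<Rightarrow> bool" where
  "rationally_independent G S \<longleftrightarrow> S \<subseteq> carrier G \<and>
    (\<forall>F n. finite F \<and> F \<subseteq> S \<and> finprod G (\<lambda>s. s [^]\<^bsub>G\<^esub> (n s :: int)) F = \<one>\<^bsub>G\<^esub>
      \<longrightarrow> (\<forall>s\<in>F. n s = 0))"

definition has_rational_rank :: "('g, 'm) monoid_scheme \<Rightarrow> nat \<Rightarrow> bool" where
  "has_rational_rank G r \<longleftrightarrow>
    (\<exists>S. rationally_independent G S \<and> finite S \<and> card S = r) \<and>
    (\<forall>S. rationally_independent G S \<longrightarrow> finite S \<and> card S \<le> r)"

section \<open>Transcendence degree\<close>

definition algebraically_independent :: "('r, 'm) ring_scheme \<Rightarrow> 'r set \<Rightarrow> 'r set \<Rightarrow> bool" where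
  "algebraically_independent R k S \<longleftrightarrow> S \<subseteq> carrier R \<and>
    (\<forall>s\<in>S. ring.transcendental R (generate_field R (k \<union> (S - {s}))) s)"

definition transcendence_basis :: "('r, 'm) ring_scheme \<Rightarrow> 'r set \<Rightarrow> 'r set \<Rightarrow> bool" where
  "transcendence_basis R k S \<longleftrightarrow> algebraically_independent R k S \<and>
    (\<forall>y\<in>carrier R. ring.algebraic R (generate_field R (k \<union> S)) y)"

definition has_transcendence_degree :: "('r, 'm) ring_scheme \<Rightarrow> 'r set \<Rightarrow> nat \<Rightarrow> bool" where
  "has_transcendence_degree R k n \<longleftrightarrow>
    (\<exists>S. transcendence_basis R k S \<and> finite S \<and> card S = n)"

section \<open>Valued fields\<close>

datatype (ext_set: 'g) extval = Val 'g | Infty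
  for map: ext_map

fun vle :: "'g ogroup \<Rightarrow> 'g extval \<Rightarrow> 'g extval \<Rightarrow> bool" where
  "vle G \<alpha> Infty \<longleftrightarrow> True"
| "vle G Infty (Val b) \<longleftrightarrow> False"
| "vle G (Val a) (Val b) \<longleftrightarrow> a \<preceq>\<^bsub>G\<^esub> b"

definition vless :: "'g ogroup \<Rightarrow> 'g extval \<Rightarrow> 'g extval \<Rightarrow> bool" where
  "vless G \<alpha> \<beta> \<longleftrightarrow> vle G \<alpha> \<beta> \<and> \<alpha> \<noteq> \<beta>"

definition vmin :: "'g ogroup \<Rightarrow> 'g extval \<Rightarrow> 'g extval \<Rightarrow> 'g extval" where
  "vmin G \<alpha> \<beta> = (if vle G \<alpha> \<beta> then \<alpha> else \<beta>)"

fun vadd :: "'g ogroup \<Rightarrow> 'g extval \<Rightarrow> 'g extval \<Rightarrow> 'g extval" where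
  "vadd G (Val a) (Val b) = Val (a \<otimes>\<^bsub>G\<^esub> b)"
| "vadd G \<alpha> \<beta> = Infty"

record ('k, 'g) krull =
  vgroup :: "'g ogroup"
  val :: "'k \<Rightarrow> 'g extval"

text \<open>The first component is the value group itself, so the valuation maps onto it.\<close>

definition valuation :: "('k::field, 'g) krull \<Rightarrow> bool" where
  "valuation v \<longleftrightarrow>
    ordered_abelian_group (vgroup v) \<and>
    carrier (vgroup v) = {\<gamma>. \<exists>a. val v a = Val \<gamma>} \<and>
    (\<forall>a. val v a = Infty \<longleftrightarrow> a = 0) \<and>
    (\<forall>a b. val v (a * b) = vadd (vgroup v) (val v a) (val v b)) \<and>
    (\<forall>a b. vle (vgroup v) (vmin (vgroup v) (val v a) (val v b)) (val v (a + b)))"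

definition valuation_ring :: "('k::field, 'g) krull \<Rightarrow> 'k ring" where
  "valuation_ring v =
    \<lparr>carrier = {a. vle (vgroup v) (Val \<one>\<^bsub>vgroup v\<^esub>) (val v a)}, mult = (*), one = 1,
     zero = 0, add = (+)\<rparr>"

definition valuation_ideal :: "('k::field, 'g) krull \<Rightarrow> 'k set" where
  "valuation_ideal v = {a. vless (vgroup v) (Val \<one>\<^bsub>vgroup v\<^esub>) (val v a)}"

definition residue_field :: "('k::field, 'g) krull \<Rightarrow> 'k set ring" where
  "residue_field v = valuation_ring v Quot valuation_ideal v"

definition residue :: "('k::field, 'g) krull \<Rightarrow> 'k \<Rightarrow> 'k set" where
  "residue v t = valuation_ideal v +>\<^bsub>valuation_ring v\<^esub> t"

section \<open>Extensions of valuations\<close>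

text \<open>
  A field extension \<open>L|K\<close> is an embedding of the field \<open>K\<close> (the type \<open>'a\<close>) into the field \<open>L\<close>
  (the type \<open>'b\<close>).
\<close>

definition field_embedding :: "('a::field \<Rightarrow> 'b::field) \<Rightarrow> bool" where
  "field_embedding emb \<longleftrightarrow> emb 1 = 1 \<and>
    (\<forall>a b. emb (a + b) = emb a + emb b) \<and> (\<forall>a b. emb (a * b) = emb a * emb b)"

definition eval_at :: "('a::field \<Rightarrow> 'b::field) \<Rightarrow> 'b \<Rightarrow> 'a poly \<Rightarrow> 'b" where
  "eval_at emb x p = poly (map_poly emb p) x"

text \<open>\<open>L = K(x)\<close>, and \<open>x\<close> is transcendental over \<open>K\<close>.\<close>

definition simple_transcendental :: "('a::field \<Rightarrow> 'b::field) \<Rightarrow> 'b \<Rightarrow> bool" where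
  "simple_transcendental emb x \<longleftrightarrow> field_embedding emb \<and>
    (\<forall>p. eval_at emb x p = 0 \<longrightarrow> p = 0) \<and>
    (\<forall>y. \<exists>p q. q \<noteq> 0 \<and> y = eval_at emb x p / eval_at emb x q)"

definition extends ::
  "('a::field \<Rightarrow> 'b::field) \<Rightarrow> ('a, 'g) krull \<Rightarrow> ('b, 'h) krull \<Rightarrow> bool" where
  "extends emb v0 v \<longleftrightarrow> valuation v \<and>
    (\<exists>\<iota> \<in> order_embedding (vgroup v0) (vgroup v). \<forall>c. val v (emb c) = ext_map \<iota> (val v0 c))"

text \<open>
  The embedding of \<open>v\<^sub>0K\<close> into \<open>vL\<close>; it is determined by \<open>v\<^sub>0\<close> and \<open>v\<close> since \<open>v\<^sub>0\<close> is onto \<open>v\<^sub>0K\<close>.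
\<close>

definition value_incl ::
  "('a::field \<Rightarrow> 'b::field) \<Rightarrow> ('a, 'g) krull \<Rightarrow> ('b, 'h) krull \<Rightarrow> 'g \<Rightarrow> 'h" where
  "value_incl emb v0 v \<gamma> = (THE \<delta>. \<exists>c. val v0 c = Val \<gamma> \<and> val v (emb c) = Val \<delta>)"

lemma value_incl_eq:
  assumes v0: "valuation v0"
    and \<iota>: "\<iota> \<in> order_embedding (vgroup v0) (vgroup v)"
    and eq: "\<forall>c. val v (emb c) = ext_map \<iota> (val v0 c)"
    and \<gamma>: "\<gamma> \<in> carrier (vgroup v0)"
  shows "value_incl emb v0 v \<gamma> = \<iota> \<gamma>"
proof -
  obtain c where c: "val v0 c = Val \<gamma>"
    using v0 \<gamma> unfolding valuation_def by auto
  show ?thesis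
    unfolding value_incl_def
    by (rule the_equality) (use c eq in auto)
qed

definition base_values ::
  "('a::field \<Rightarrow> 'b::field) \<Rightarrow> ('a, 'g) krull \<Rightarrow> ('b, 'h) krull \<Rightarrow> 'h set" where
  "base_values emb v0 v = value_incl emb v0 v ` carrier (vgroup v0)"

text \<open>The canonical image of \<open>Kv\<^sub>0\<close> in \<open>Lv\<close>.\<close>

definition base_residues ::
  "('a::field \<Rightarrow> 'b::field) \<Rightarrow> ('a, 'g) krull \<Rightarrow> ('b, 'h) krull \<Rightarrow> 'b set set" where
  "base_residues emb v0 v = (\<lambda>c. residue v (emb c)) ` carrier (valuation_ring v0)"

definition equivalent_over ::
  "('a::field \<Rightarrow> 'b::field) \<Rightarrow> ('a, 'g) krull \<Rightarrow> ('b, 'h) krull \<Rightarrow> ('b, 'i) krull \<Rightarrow> bool" where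
  "equivalent_over emb v0 v v' \<longleftrightarrow>
    (\<exists>\<phi> \<in> order_iso (vgroup v) (vgroup v').
      (\<forall>y. val v' y = ext_map \<phi> (val v y)) \<and>
      (\<forall>\<gamma>\<in>carrier (vgroup v0). \<phi> (value_incl emb v0 v \<gamma>) = value_incl emb v0 v' \<gamma>))"

definition immediate_extension ::
  "('a::field \<Rightarrow> 'b::field) \<Rightarrow> ('a, 'g) krull \<Rightarrow> ('b, 'h) krull \<Rightarrow> bool" where
  "immediate_extension emb v0 v \<longleftrightarrow>
    carrier (vgroup v) = base_values emb v0 v \<and>
    carrier (residue_field v) = base_residues emb v0 v"

definition value_transcendental_extension ::
  "('a::field \<Rightarrow> 'b::field) \<Rightarrow> ('a, 'g) krull \<Rightarrow> ('b, 'h) krull \<Rightarrow> bool" where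
  "value_transcendental_extension emb v0 v \<longleftrightarrow>
    has_rational_rank (vgroup v Mod base_values emb v0 v) 1"

definition residue_transcendental_extension ::
  "('a::field \<Rightarrow> 'b::field) \<Rightarrow> ('a, 'g) krull \<Rightarrow> ('b, 'h) krull \<Rightarrow> bool" where
  "residue_transcendental_extension emb v0 v \<longleftrightarrow>
    has_transcendence_degree (residue_field v) (base_residues emb v0 v) 1"

definition value_transcendental ::
  "('a::field \<Rightarrow> 'b::field) \<Rightarrow> ('a, 'g) krull \<Rightarrow> ('b, 'h) krull \<Rightarrow> 'b \<Rightarrow> bool" where
  "value_transcendental emb v0 v t \<longleftrightarrow>
    (\<exists>\<gamma>. val v t = Val \<gamma> \<and> \<not> (\<exists>n::nat. n > 0 \<and> \<gamma> [^]\<^bsub>vgroup v\<^esub> n \<in> base_values emb v0 v))"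

definition residue_transcendental ::
  "('a::field \<Rightarrow> 'b::field) \<Rightarrow> ('a, 'g) krull \<Rightarrow> ('b, 'h) krull \<Rightarrow> 'b \<Rightarrow> bool" where
  "residue_transcendental emb v0 v t \<longleftrightarrow>
    val v t = Val \<one>\<^bsub>vgroup v\<^esub> \<and>
    ring.transcendental (residue_field v) (base_residues emb v0 v) (residue v t)"

definition valuation_transcendental ::
  "('a::field \<Rightarrow> 'b::field) \<Rightarrow> ('a, 'g) krull \<Rightarrow> ('b, 'h) krull \<Rightarrow> 'b \<Rightarrow> bool" where
  "valuation_transcendental emb v0 v t \<longleftrightarrow>
    value_transcendental emb v0 v t \<or> residue_transcendental emb v0 v t"

section \<open>Approximation types\<close>

datatype ('a, 'g) ball =
    ClosedBall "'g extval" (points: "'a set")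
  | OpenBall 'g (points: "'a set")

definition radii :: "('a, 'g) krull \<Rightarrow> 'g extval set" where
  "radii v = insert Infty (Val ` carrier (vgroup v))"

definition closed_ball :: "('a::field, 'g) krull \<Rightarrow> 'g extval \<Rightarrow> 'a \<Rightarrow> ('a, 'g) ball" where
  "closed_ball v \<gamma> c = ClosedBall \<gamma> {a. vle (vgroup v) \<gamma> (val v (a - c))}"

definition open_ball :: "('a::field, 'g) krull \<Rightarrow> 'g \<Rightarrow> 'a \<Rightarrow> ('a, 'g) ball" where
  "open_ball v \<gamma> c = OpenBall \<gamma> {a. vless (vgroup v) (Val \<gamma>) (val v (a - c))}"

definition balls :: "('a::field, 'g) krull \<Rightarrow> ('a, 'g) ball set" where
  "balls v = {closed_ball v \<gamma> c | \<gamma> c. \<gamma> \<in> radii v} \<union>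
    {open_ball v \<gamma> c | \<gamma> c. \<gamma> \<in> carrier (vgroup v)}"

definition larger_balls ::
  "('a::field, 'g) krull \<Rightarrow> 'g extval \<Rightarrow> 'a \<Rightarrow> ('a, 'g) ball set" where
  "larger_balls v \<gamma> c =
    (\<Union>\<beta>\<in>{\<beta> \<in> carrier (vgroup v). vless (vgroup v) (Val \<beta>) \<gamma>}.
      {closed_ball v (Val \<beta>) c, open_ball v \<beta> c})"

definition approximation_type :: "('a::field, 'g) krull \<Rightarrow> ('a, 'g) ball set \<Rightarrow> bool" where
  "approximation_type v A \<longleftrightarrow>
    A \<subseteq> balls v \<and>
    (\<forall>B\<in>A. \<forall>B'\<in>A. points B \<subseteq> points B' \<or> points B' \<subseteq> points B) \<and>
    (\<forall>c. \<forall>\<gamma>\<in>radii v. closed_ball v \<gamma> c \<in> A \<longrightarrow> larger_balls v \<gamma> c \<subseteq> A) \<and>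
    (\<forall>c. \<forall>\<gamma>\<in>carrier (vgroup v). open_ball v \<gamma> c \<in> A \<longrightarrow>
      larger_balls v (Val \<gamma>) c \<subseteq> A \<and> closed_ball v (Val \<gamma>) c \<in> A)"

definition supp :: "('a, 'g) ball set \<Rightarrow> 'g extval set" where
  "supp A = {\<gamma>. \<exists>S. ClosedBall \<gamma> S \<in> A}"

text \<open>
  \<open>A\<^sub>\<gamma>\<close> and \<open>A\<^sub>\<gamma>\<^sup>\<circ>\<close>: an approximation type has at most one ball of a given kind and radius, so
  the unions have at most one member.
\<close>

definition closed_at :: "('a, 'g) ball set \<Rightarrow> 'g extval \<Rightarrow> 'a set" where
  "closed_at A \<gamma> = \<Union>{S. ClosedBall \<gamma> S \<in> A}"

definition open_at :: "('a, 'g) ball set \<Rightarrow> 'g extval \<Rightarrow> 'a set" where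
  "open_at A \<gamma> = \<Union>{S. \<exists>g. \<gamma> = Val g \<and> OpenBall g S \<in> A}"

definition meet :: "('a, 'g) ball set \<Rightarrow> 'a set" where
  "meet A = \<Inter>(points ` A)"

definition trivial :: "('a, 'g) ball set \<Rightarrow> bool" where
  "trivial A \<longleftrightarrow> Infty \<in> supp A"

definition immediate :: "('a, 'g) ball set \<Rightarrow> bool" where
  "immediate A \<longleftrightarrow> \<not> trivial A \<and> A \<noteq> {} \<and> meet A = {}"

definition value_extending :: "('a, 'g) ball set \<Rightarrow> bool" where
  "value_extending A \<longleftrightarrow> \<not> trivial A \<and> (\<forall>\<gamma>\<in>supp A. open_at A \<gamma> \<noteq> {}) \<and> meet A \<noteq> {}"

definition residue_extending :: "('a, 'g) ball set \<Rightarrow> bool" where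
  "residue_extending A \<longleftrightarrow> \<not> trivial A \<and>
    (\<forall>c. \<exists>\<gamma>\<in>supp A. c \<in> closed_at A \<gamma> - open_at A \<gamma>) \<and> meet A \<noteq> {}"

definition transcendental_immediate ::
  "('a::field, 'g) krull \<Rightarrow> ('a, 'g) ball set \<Rightarrow> bool" where
  "transcendental_immediate v A \<longleftrightarrow> immediate A \<and>
    (\<forall>f. \<exists>\<delta>\<in>supp A. \<exists>\<alpha>. \<forall>c\<in>closed_at A \<delta>. val v (poly f c) = \<alpha>)"

definition pure_approximation_type ::
  "('a::field, 'g) krull \<Rightarrow> ('a, 'g) ball set \<Rightarrow> bool" where
  "pure_approximation_type v A \<longleftrightarrow> approximation_type v A \<and>
    (transcendental_immediate v A \<or> value_extending A \<or> residue_extending A)"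

definition appr ::
  "('a::field \<Rightarrow> 'b::field) \<Rightarrow> ('a, 'g) krull \<Rightarrow> ('b, 'h) krull \<Rightarrow> 'b \<Rightarrow> ('a, 'g) ball set" where
  "appr emb v0 v x =
    {ClosedBall \<gamma> S | \<gamma> S. \<gamma> \<in> radii v0 \<and> S \<noteq> {} \<and>
      S = {c. vle (vgroup v) (ext_map (value_incl emb v0 v) \<gamma>) (val v (x - emb c))}} \<union>
    {OpenBall \<gamma> S | \<gamma> S. \<gamma> \<in> carrier (vgroup v0) \<and> S \<noteq> {} \<and>
      S = {c. vless (vgroup v) (Val (value_incl emb v0 v \<gamma>)) (val v (x - emb c))}}"

section \<open>Pure extensions\<close>

definition pure_extension ::
  "('a::field \<Rightarrow> 'b::field) \<Rightarrow> 'b \<Rightarrow> ('a, 'g) krull \<Rightarrow> ('b, 'h) krull \<Rightarrow> bool" where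
  "pure_extension emb x v0 v \<longleftrightarrow> extends emb v0 v \<and>
    ((\<exists>b d. valuation_transcendental emb v0 v (emb d * (x - emb b))) \<or>
     transcendental_immediate v0 (appr emb v0 v x))"

text \<open>
  The set of all pure extensions, identified when equivalent over \<open>v\<^sub>0\<close>. A set has to be formed
  over one type of value group elements. The type \<open>'b set\<close> is large enough: the lemma
  \<open>representative_extension\<close> below shows that it contains an equivalent copy of every extension
  of \<open>v\<^sub>0\<close>, whatever the type of its value group elements.
\<close>

definition pure_equivalence ::
  "('a::field \<Rightarrow> 'b::field) \<Rightarrow> 'b \<Rightarrow> ('a, 'g) krull \<Rightarrow>
    (('b, 'b set) krull \<times> ('b, 'b set) krull) set" where
  "pure_equivalence emb x v0 =
    {(v, v'). pure_extension emb x v0 v \<and> pure_extension emb x v0 v' \<and>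
      equivalent_over emb v0 v v'}"

definition pure_extensions ::
  "('a::field \<Rightarrow> 'b::field) \<Rightarrow> 'b \<Rightarrow> ('a, 'g) krull \<Rightarrow> ('b, 'b set) krull set set" where
  "pure_extensions emb x v0 = {v. pure_extension emb x v0 v} // pure_equivalence emb x v0"

definition pure_approximation_types ::
  "('a::field, 'g) krull \<Rightarrow> ('a, 'g) ball set set" where
  "pure_approximation_types v0 = {A. pure_approximation_type v0 A}"

lemma representative_extension:
  fixes emb :: "'a::field \<Rightarrow> 'b::field"
    and v0 :: "('a, 'g) krull" and v :: "('b, 'h) krull"
  assumes v0: "valuation v0" and ext: "extends emb v0 v"
  shows "\<exists>w :: ('b, 'b set) krull. extends emb v0 w \<and> equivalent_over emb v0 v w"
proof -
  define G where "G = vgroup v"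
  have vv: "valuation v"
    using ext unfolding extends_def by blast
  interpret G: ordered_abelian_group G
    using vv unfolding valuation_def G_def by blast
  have carG: "carrier G = {\<gamma>. \<exists>a. val v a = Val \<gamma>}"
    using vv unfolding valuation_def G_def by blast
  define \<phi> where "\<phi> \<gamma> = {y. val v y = Val \<gamma>}" for \<gamma>
  define \<psi> where "\<psi> = inv_into (carrier G) \<phi>"
  have inj: "inj_on \<phi> (carrier G)"
  proof (rule inj_onI)
    fix \<gamma> \<delta> assume "\<gamma> \<in> carrier G" "\<delta> \<in> carrier G" and eq: "\<phi> \<gamma> = \<phi> \<delta>"
    then obtain a where a: "val v a = Val \<gamma>" using carG by auto
    then have "a \<in> \<phi> \<delta>" unfolding eq[symmetric] by (simp add: \<phi>_def)
    then show "\<gamma> = \<delta>" using a unfolding \<phi>_def by auto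
  qed
  have \<psi>\<phi>: "\<psi> (\<phi> \<gamma>) = \<gamma>" if "\<gamma> \<in> carrier G" for \<gamma>
    using inj that unfolding \<psi>_def by simp
  define H :: "'b set ogroup" where
    "H = \<lparr>carrier = \<phi> ` carrier G, mult = \<lambda>A B. \<phi> (\<psi> A \<otimes>\<^bsub>G\<^esub> \<psi> B), one = \<phi> \<one>\<^bsub>G\<^esub>,
      ole = \<lambda>A B. \<psi> A \<preceq>\<^bsub>G\<^esub> \<psi> B\<rparr>"
  have H_simps: "carrier H = \<phi> ` carrier G" "\<one>\<^bsub>H\<^esub> = \<phi> \<one>\<^bsub>G\<^esub>"
    "\<And>A B. A \<otimes>\<^bsub>H\<^esub> B = \<phi> (\<psi> A \<otimes>\<^bsub>G\<^esub> \<psi> B)" "\<And>A B. A \<preceq>\<^bsub>H\<^esub> B \<longleftrightarrow> \<psi> A \<preceq>\<^bsub>G\<^esub> \<psi> B"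
    unfolding H_def by auto
  have "comm_group H"
  proof (rule comm_groupI)
    fix A assume "A \<in> carrier H"
    then obtain \<gamma> where \<gamma>: "\<gamma> \<in> carrier G" "A = \<phi> \<gamma>" by (auto simp: H_simps)
    then show "\<exists>B\<in>carrier H. B \<otimes>\<^bsub>H\<^esub> A = \<one>\<^bsub>H\<^esub>"
      by (intro bexI[of _ "\<phi> (inv\<^bsub>G\<^esub> \<gamma>)"]) (auto simp: H_simps \<psi>\<phi>)
  qed (auto simp: H_simps \<psi>\<phi> G.m_ac)
  then have H: "ordered_abelian_group H"
  proof (rule ordered_abelian_group.intro, unfold_locales)
    fix A B C assume "A \<in> carrier H" "B \<in> carrier H" "C \<in> carrier H" "A \<preceq>\<^bsub>H\<^esub> B"
    then show "A \<otimes>\<^bsub>H\<^esub> C \<preceq>\<^bsub>H\<^esub> B \<otimes>\<^bsub>H\<^esub> C"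
      by (auto simp: H_simps \<psi>\<phi> intro: G.ole_mult_mono)
  next
    fix A B C assume "A \<in> carrier H" "B \<in> carrier H" "C \<in> carrier H" "A \<preceq>\<^bsub>H\<^esub> B" "B \<preceq>\<^bsub>H\<^esub> C"
    then show "A \<preceq>\<^bsub>H\<^esub> C"
      by (auto simp: H_simps \<psi>\<phi> intro: G.ole_trans)
  next
    fix A B assume "A \<in> carrier H" "B \<in> carrier H" "A \<preceq>\<^bsub>H\<^esub> B" "B \<preceq>\<^bsub>H\<^esub> A"
    then show "A = B"
      by (auto simp: H_simps \<psi>\<phi> dest: G.ole_antisym)
  next
    fix A B assume "A \<in> carrier H" "B \<in> carrier H"
    then show "A \<preceq>\<^bsub>H\<^esub> B \<or> B \<preceq>\<^bsub>H\<^esub> A"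
      by (auto simp: H_simps \<psi>\<phi>) (use G.ole_total in blast)
  next
    fix A assume "A \<in> carrier H"
    then show "A \<preceq>\<^bsub>H\<^esub> A"
      using G.ole_refl by (auto simp: H_simps \<psi>\<phi>)
  qed
  define w :: "('b, 'b set) krull" where
    "w = \<lparr>vgroup = H, val = \<lambda>y. ext_map \<phi> (val v y)\<rparr>"
  have w_simps: "vgroup w = H" "\<And>y. val w y = ext_map \<phi> (val v y)"
    unfolding w_def by auto
  have val_cases: "val v y = Infty \<or> (\<exists>\<gamma>\<in>carrier G. val v y = Val \<gamma>)" for y
    using carG by (cases "val v y") auto
  have le: "vle H (ext_map \<phi> \<alpha>) (ext_map \<phi> \<beta>) \<longleftrightarrow> vle G \<alpha> \<beta>"
    if "\<alpha> = Infty \<or> (\<exists>\<gamma>\<in>carrier G. \<alpha> = Val \<gamma>)" "\<beta> = Infty \<or> (\<exists>\<gamma>\<in>carrier G. \<beta> = Val \<gamma>)" for \<alpha> \<beta>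
    using that by (auto simp: H_simps \<psi>\<phi>)
  have w: "valuation w"
    unfolding valuation_def w_simps
  proof (intro conjI allI)
    show "ordered_abelian_group H" by (rule H)
    show "carrier H = {\<gamma>. \<exists>a. ext_map \<phi> (val v a) = Val \<gamma>}"
    proof (intro equalityI subsetI)
      fix A assume "A \<in> carrier H"
      then obtain \<gamma> where "\<gamma> \<in> carrier G" "A = \<phi> \<gamma>" by (auto simp: H_simps)
      moreover from this obtain a where "val v a = Val \<gamma>" using carG by blast
      ultimately have "ext_map \<phi> (val v a) = Val A" by simp
      then show "A \<in> {\<gamma>. \<exists>a. ext_map \<phi> (val v a) = Val \<gamma>}" by blast
    next
      fix A assume "A \<in> {\<gamma>. \<exists>a. ext_map \<phi> (val v a) = Val \<gamma>}"
      then obtain a where a: "ext_map \<phi> (val v a) = Val A" by blast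
      show "A \<in> carrier H"
        using a val_cases[of a] by (auto simp: H_simps)
    qed
  next
    fix a
    have "val v a = Infty \<longleftrightarrow> a = 0" using vv unfolding valuation_def by blast
    then show "ext_map \<phi> (val v a) = Infty \<longleftrightarrow> a = 0"
      by (cases "val v a") auto
  next
    fix a b
    have "val v (a * b) = vadd G (val v a) (val v b)"
      using vv unfolding valuation_def G_def by blast
    then show "ext_map \<phi> (val v (a * b)) = vadd H (ext_map \<phi> (val v a)) (ext_map \<phi> (val v b))"
      using val_cases[of a] val_cases[of b] by (auto simp: H_simps \<psi>\<phi>)
  next
    fix a b
    have "vle G (vmin G (val v a) (val v b)) (val v (a + b))"
      using vv unfolding valuation_def G_def by blast
    then show "vle H (vmin H (ext_map \<phi> (val v a)) (ext_map \<phi> (val v b))) (ext_map \<phi> (val v (a + b)))"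
      using val_cases[of a] val_cases[of b] val_cases[of "a + b"]
      by (simp add: vmin_def le split: if_splits)
  qed
  have hom: "\<phi> \<in> order_embedding G H"
    unfolding order_embedding_def hom_def by (auto simp: H_simps \<psi>\<phi>)
  have iso: "\<phi> \<in> order_iso G H"
    using hom inj unfolding order_iso_def iso_def order_embedding_def bij_betw_def
    by (auto simp: H_simps)
  obtain \<iota> where \<iota>: "\<iota> \<in> order_embedding (vgroup v0) G"
    and \<iota>_eq: "\<forall>c. val v (emb c) = ext_map \<iota> (val v0 c)"
    using ext unfolding extends_def G_def by blast
  have \<iota>': "\<phi> \<circ> \<iota> \<in> order_embedding (vgroup v0) (vgroup w)"
    using \<iota> hom unfolding order_embedding_def hom_def w_simps by (auto simp: Pi_iff)
  have \<iota>'_eq: "\<forall>c. val w (emb c) = ext_map (\<phi> \<circ> \<iota>) (val v0 c)"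
    using \<iota>_eq by (simp add: w_simps extval.map_comp)
  have "extends emb v0 w"
    unfolding extends_def using w \<iota>' \<iota>'_eq by blast
  moreover have "equivalent_over emb v0 v w"
    unfolding equivalent_over_def
  proof (intro bexI[of _ \<phi>] conjI allI ballI)
    fix \<gamma> assume "\<gamma> \<in> carrier (vgroup v0)"
    then show "\<phi> (value_incl emb v0 v \<gamma>) = value_incl emb v0 w \<gamma>"
      using value_incl_eq[OF v0 \<iota>[unfolded G_def] \<iota>_eq] value_incl_eq[OF v0 \<iota>' \<iota>'_eq] by simp
  qed (use iso in \<open>simp_all add: w_simps G_def\<close>)
  ultimately show ?thesis by blast
qed

end

theory Submission
  imports Defs
begin

text \<open>
  The proof works with the relation \<open>v y \<le> v z\<close> between elements of the field. It determines the
  valuation up to equivalence, and extensions, residues, transcendence of values and residues, and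
  approximation types can all be read off from it without computing in value groups. Conversely
  every such relation comes from a valuation, whose values are the classes of elements of equal
  value.

  Call \<open>b \<in> K\<close> nearest to \<open>x\<close> if \<open>v (x - b)\<close> is the greatest of all \<open>v (x - c)\<close> with \<open>c \<in> K\<close>. The nearest
  elements form the intersection of the approximation type of \<open>x\<close>. That type is immediate if
  there are none; otherwise it is value-extending or residue-extending, according as \<open>v (x - b)\<close>
  lies outside or inside \<open>v\<^sub>0K\<close> for nearest \<open>b\<close>. Next to this trichotomy stands the one of pure
  extensions.

  \<^item> If \<open>t = x - b\<close> is value-transcendental, then the monomials \<open>c t\<^sup>i\<close> have pairwise distinct
    values, so each polynomial in \<open>t\<close> has the leading term of one of its monomials. Hence
    \<open>vK(x) = v\<^sub>0K \<oplus> \<int> v(t)\<close>, and the residue field does not grow.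

  \<^item> If \<open>u = d (x - b)\<close> is residue-transcendental, then a polynomial in \<open>u\<close> with integral coefficients,
    one of them a unit, has a residue other than zero. Hence \<open>v\<close> is the Gauss valuation, the value
    group does not grow, and the residue field is generated by the residue of \<open>u\<close>.

  \<^item> If the approximation type is transcendental immediate, then Taylor expansion at \<open>c\<close> shows
    that the value of \<open>f(x) - f(c)\<close> finally avoids every given value other than infinity as \<open>c\<close>
    approaches \<open>x\<close>. Since \<open>v f(c)\<close> becomes constant, \<open>f(x)\<close> and \<open>f(c)\<close> finally have the same leading
    term (lemma \<open>eventually_close\<close>), and the extension is immediate.

  In each case value group and residue field show which kind of extension it is, and nearest
  elements show which kind of approximation type. Moreover \<open>v f(x)\<close> is the final value of \<open>v f(c)\<close> or
  the least value of a monomial, and both are given by the approximation type. For value-transcendental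
  \<open>t\<close> this requires the comparison of \<open>k v(t)\<close> with values in \<open>v\<^sub>0K\<close>, where divisibility
  allows \<open>k = 1\<close>.

  To realize a transcendental immediate type, compare \<open>f(x)\<close> and \<open>g(x)\<close> as \<open>f(c)\<close> and \<open>g(c)\<close> for all
  \<open>c\<close> in a sufficiently small ball. To realize a type with a center \<open>b\<close>, prescribe the sign of
  \<open>v\<^sub>0(c) + n v(x - b)\<close> for \<open>c \<in> K\<close> and \<open>n \<in> \<int>\<close>, and compare polynomials in \<open>x - b\<close> by their least
  monomials; Gauss's lemma (lemma \<open>minimal_mult\<close>) makes this multiplicative.
\<close>

text \<open>The bare names otherwise denote operations on list polynomials over a ring and on record
  polynomials.\<close>

abbreviation coeff :: "'a::zero poly \<Rightarrow> nat \<Rightarrow> 'a" where "coeff \<equiv> Polynomial.coeff"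
abbreviation degree :: "'a::zero poly \<Rightarrow> nat" where "degree \<equiv> Polynomial.degree"
abbreviation monom :: "'a::zero \<Rightarrow> nat \<Rightarrow> 'a poly" where "monom \<equiv> Polynomial.monom"

section \<open>Valuations as divisibility preorders\<close>

text \<open>Here \<open>y \<lesssim> z\<close> stands for \<open>v y \<le> v z\<close>. The last assumption makes zero the only element of value
  infinity.\<close>

locale valuation_preorder =
  fixes le :: "'b::field \<Rightarrow> 'b \<Rightarrow> bool" (infix "\<lesssim>" 50)
  assumes total: "y \<lesssim> z \<or> z \<lesssim> y"
    and trans: "w \<lesssim> y \<Longrightarrow> y \<lesssim> z \<Longrightarrow> w \<lesssim> z"
    and mult_left: "y \<lesssim> z \<Longrightarrow> w * y \<lesssim> w * z"
    and add: "w \<lesssim> y \<Longrightarrow> w \<lesssim> z \<Longrightarrow> w \<lesssim> y + z"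
    and zero_not_le_one: "\<not> 0 \<lesssim> 1"
begin

abbreviation less :: "'b \<Rightarrow> 'b \<Rightarrow> bool" (infix "\<lless>" 50) where
  "y \<lless> z \<equiv> \<not> z \<lesssim> y"

definition same :: "'b \<Rightarrow> 'b \<Rightarrow> bool" (infix "\<doteq>" 50) where
  "y \<doteq> z \<longleftrightarrow> y \<lesssim> z \<and> z \<lesssim> y"

lemma refl [simp]: "y \<lesssim> y"
  using total by blast

lemma less_imp_le: "y \<lless> z \<Longrightarrow> y \<lesssim> z"
  using total by blast

lemma less_le_trans: "w \<lless> y \<Longrightarrow> y \<lesssim> z \<Longrightarrow> w \<lless> z"
  using trans by blast

lemma same_refl [simp]: "y \<doteq> y"
  by (simp add: same_def)

lemma same_sym: "y \<doteq> z \<longleftrightarrow> z \<doteq> y"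
  by (auto simp: same_def)

lemma same_trans: "w \<doteq> y \<Longrightarrow> y \<doteq> z \<Longrightarrow> w \<doteq> z"
  unfolding same_def using trans by blast

lemma same_le_left: "y \<doteq> z \<Longrightarrow> y \<lesssim> w \<longleftrightarrow> z \<lesssim> w"
  unfolding same_def using trans by blast

lemma same_le_right: "y \<doteq> z \<Longrightarrow> w \<lesssim> y \<longleftrightarrow> w \<lesssim> z"
  unfolding same_def using trans by blast

lemma mult_right: "y \<lesssim> z \<Longrightarrow> y * w \<lesssim> z * w"
  using mult_left[of y z w] by (simp add: mult.commute)

lemma mult_le_cancel_left: "w \<noteq> 0 \<Longrightarrow> w * y \<lesssim> w * z \<longleftrightarrow> y \<lesssim> z"
  using mult_left[of "w * y" "w * z" "inverse w"] mult_left[of y z w]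
  by (auto simp flip: mult.assoc)

lemma mult_le_cancel_right: "w \<noteq> 0 \<Longrightarrow> y * w \<lesssim> z * w \<longleftrightarrow> y \<lesssim> z"
  using mult_le_cancel_left[of w y z] by (simp add: mult.commute)

lemma zero_le_iff: "0 \<lesssim> y \<longleftrightarrow> y = 0"
  using mult_left[of 0 y "inverse y"] zero_not_le_one by (cases "y = 0") auto

lemma le_zero [simp]: "y \<lesssim> 0"
  using total[of y 0] zero_le_iff[of y] by auto

lemma mult_mono: "y \<lesssim> y' \<Longrightarrow> z \<lesssim> z' \<Longrightarrow> y * z \<lesssim> y' * z'"
  using mult_left[of z z' y] mult_right[of y y' z'] trans by blast

lemma mult_less_mono: "y \<lless> y' \<Longrightarrow> z \<lesssim> z' \<Longrightarrow> z \<noteq> 0 \<Longrightarrow> y * z \<lless> y' * z'"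
  using trans[OF mult_left[of z z' y']] mult_le_cancel_right[of z y' y] by blast

lemma mult_same: "y \<doteq> y' \<Longrightarrow> z \<doteq> z' \<Longrightarrow> y * z \<doteq> y' * z'"
  unfolding same_def using mult_mono by blast

lemma le_uminus: "w \<lesssim> - y \<longleftrightarrow> w \<lesssim> y" and uminus_le: "- y \<lesssim> w \<longleftrightarrow> y \<lesssim> w"
proof -
  have "1 \<lesssim> - 1" using total[of 1 "- 1"] mult_left[of "- 1" 1 "- 1"] by auto
  then have "1 * y \<lesssim> - 1 * y" "- 1 * (- 1 * y) \<lesssim> - 1 * y" for y
    using mult_right[of 1 "- 1" y] mult_right[of 1 "- 1" "- 1 * y"] mult_left[of 1 "- 1" "-1"] by auto
  then have "y \<lesssim> - y" "- y \<lesssim> y" for y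
    using mult_left[of y "- y" "- 1"] by force+
  then show "w \<lesssim> - y \<longleftrightarrow> w \<lesssim> y" "- y \<lesssim> w \<longleftrightarrow> y \<lesssim> w"
    using trans by blast+
qed

lemma diff: "w \<lesssim> y \<Longrightarrow> w \<lesssim> z \<Longrightarrow> w \<lesssim> y - z"
  using add[of w y "- z"] by (simp add: le_uminus)

lemma le_minus_commute: "w \<lesssim> y - z \<longleftrightarrow> w \<lesssim> z - y"
  using le_uminus[of w "y - z"] by simp

lemma minus_le_commute: "y - z \<lesssim> w \<longleftrightarrow> z - y \<lesssim> w"
  using uminus_le[of "y - z" w] by simp

lemma add_less: "w \<lless> y \<Longrightarrow> w \<lless> z \<Longrightarrow> w \<lless> y + z"
  using total[of y z] add[of y y z] add[of z y z] trans by (metis refl)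

lemma diff_less: "w \<lless> y \<Longrightarrow> w \<lless> z \<Longrightarrow> w \<lless> y - z"
  using add_less[of y w "- z"] by (simp add: uminus_le)

text \<open>The ultrametric inequality is an equality when the two values differ.\<close>

lemma add_dominated: "y \<lless> z \<Longrightarrow> y + z \<doteq> y"
proof -
  assume "y \<lless> z"
  moreover have "y + z \<lless> z \<Longrightarrow> y + z \<lesssim> y"
    using diff[of "y + z" "y + z" z] total[of "y + z" z] by simp
  moreover have "z \<lesssim> y + z \<Longrightarrow> y + z \<lesssim> y"
    using diff[of z "y + z" z] \<open>y \<lless> z\<close> by simp
  ultimately show ?thesis
    unfolding same_def using add[of y y z] less_imp_le[of z y] by auto
qed

lemma sum: "(\<And>i. i \<in> I \<Longrightarrow> w \<lesssim> f i) \<Longrightarrow> w \<lesssim> sum f I"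
  by (induction I rule: infinite_finite_induct) (auto intro: add)

lemma sum_less: "w \<noteq> 0 \<Longrightarrow> (\<And>i. i \<in> I \<Longrightarrow> w \<lless> f i) \<Longrightarrow> w \<lless> sum f I"
  by (induction I rule: infinite_finite_induct) (simp_all add: zero_le_iff add_less)

lemma power_mono: "y \<lesssim> z \<Longrightarrow> y ^ n \<lesssim> z ^ n"
  by (induction n) (auto intro: mult_mono)

lemma power_less_mono:
  assumes "y \<lless> z" "n > 0"
  shows "y ^ n \<lless> z ^ n"
  using assms(2)
proof (induction n rule: nat_induct_non_zero)
  case (Suc n)
  have "y \<noteq> 0" using assms(1) by auto
  then show ?case
    using mult_less_mono[OF assms(1) less_imp_le[OF Suc.IH]] by simp
qed (use assms(1) in auto)

lemma power_le_iff: "n > 0 \<Longrightarrow> y ^ n \<lesssim> z ^ n \<longleftrightarrow> y \<lesssim> z"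
  using power_mono[of y z n] power_less_mono[of y z n] by blast

lemma power_same: "y \<doteq> z \<Longrightarrow> y ^ n \<doteq> z ^ n"
  unfolding same_def using power_mono by blast

lemma divide_le_iff: "w \<noteq> 0 \<Longrightarrow> y / w \<lesssim> z \<longleftrightarrow> y \<lesssim> z * w"
  using mult_le_cancel_right[of w "y / w" z] by simp

lemma le_divide_iff: "w \<noteq> 0 \<Longrightarrow> y \<lesssim> z / w \<longleftrightarrow> y * w \<lesssim> z"
  using mult_le_cancel_right[of w y "z / w"] by simp

lemma divide_same: "y \<doteq> y' \<Longrightarrow> z \<doteq> z' \<Longrightarrow> y / z \<doteq> y' / z'"
proof -
  assume *: "y \<doteq> y'" "z \<doteq> z'"
  have "z = 0 \<longleftrightarrow> z' = 0" using * zero_le_iff by (metis same_def)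
  moreover have "z' * y \<doteq> y' * z" if "z \<noteq> 0" "z' \<noteq> 0"
    using mult_same[OF *(1) *(2)] mult_same[OF *(1) *(2)[unfolded same_sym[of z]]]
    by (simp add: mult.commute)
  ultimately show ?thesis
    by (cases "z = 0") (auto simp: same_def divide_le_iff le_divide_iff mult.commute)
qed

lemma same_zero_iff: "y \<doteq> 0 \<longleftrightarrow> y = 0"
  by (auto simp: same_def zero_le_iff)

lemma same_imp_zero_iff: "y \<doteq> z \<Longrightarrow> y = 0 \<longleftrightarrow> z = 0"
  by (metis same_def zero_le_iff)

text \<open>Equality of leading terms: \<open>y / u\<close> is a unit with residue one. Unlike equality of values, it
  records residues as well, and it passes to products and quotients.\<close>

definition close :: "'b \<Rightarrow> 'b \<Rightarrow> bool" (infix "\<approx>" 50) where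
  "y \<approx> u \<longleftrightarrow> u \<lless> y - u"

lemma close_nonzero: "y \<approx> u \<Longrightarrow> u \<noteq> 0"
  unfolding close_def by auto

lemma close_same: "y \<approx> u \<Longrightarrow> y \<doteq> u"
  using add_dominated[of "y - u" u] unfolding close_def by simp

lemma close_mult:
  assumes "y \<approx> u" "z \<approx> w"
  shows "y * z \<approx> u * w"
proof -
  have "u * w \<lless> y * (z - w)"
    using mult_less_mono[of "z - w" w u y] close_same[OF assms(1)] assms close_nonzero
    unfolding close_def same_def by (simp add: mult.commute)
  moreover have "u * w \<lless> (y - u) * w"
    using mult_less_mono[of "y - u" u w w] assms close_nonzero unfolding close_def by simp
  ultimately have "u * w \<lless> y * (z - w) + (y - u) * w" by (rule add_less)
  then show ?thesis
    unfolding close_def by (simp add: algebra_simps)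
qed

lemma close_inverse:
  assumes "y \<approx> u"
  shows "inverse y \<approx> inverse u"
proof -
  have u: "u \<noteq> 0" and y: "y \<noteq> 0"
    using close_nonzero[OF assms] same_imp_zero_iff[OF close_same[OF assms]] by auto
  have "u - y \<lesssim> y \<Longrightarrow> y - u \<lesssim> u"
    using close_same[OF assms] trans minus_le_commute[of y u] unfolding same_def by blast
  then have "y \<lless> u - y" using assms unfolding close_def by blast
  moreover have "inverse y - inverse u = (u - y) * (inverse y * inverse u)"
    "inverse u = y * (inverse y * inverse u)"
    using u y by (simp_all add: field_simps)
  ultimately show ?thesis
    unfolding close_def
    using mult_le_cancel_right[of "inverse y * inverse u" "u - y" y] u y by (metis nonzero_imp_inverse_nonzero no_zero_divisors)
qed

lemma close_divide: "y \<approx> u \<Longrightarrow> z \<approx> w \<Longrightarrow> y / z \<approx> u / w"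
  by (simp add: divide_inverse close_mult close_inverse)

lemma exists_least:
  assumes "finite I" "I \<noteq> {}"
  obtains h where "h \<in> I" "\<And>i. i \<in> I \<Longrightarrow> f h \<lesssim> f i"
proof -
  have "\<exists>h\<in>I. \<forall>i\<in>I. f h \<lesssim> f i"
    using assms
  proof (induction rule: finite_ne_induct)
    case (insert i I)
    then obtain h where "h \<in> I" "\<forall>j\<in>I. f h \<lesssim> f j" by blast
    then show ?case
      using total[of "f h" "f i"] trans by (metis insert_iff refl)
  qed simp
  then show thesis using that by blast
qed

lemma least_term:
  assumes "p \<noteq> 0" and zero: "\<And>i. coeff p i = 0 \<Longrightarrow> f i = 0"
  obtains h where "coeff p h \<noteq> 0" "\<And>i. f h \<lesssim> f i"
proof -
  define I where "I = {i. i \<le> degree p \<and> coeff p i \<noteq> 0}"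
  have "finite I" "degree p \<in> I" using assms(1) by (auto simp: I_def)
  then obtain h where h: "h \<in> I" "\<And>i. i \<in> I \<Longrightarrow> f h \<lesssim> f i"
    using exists_least[of I f] by blast
  have least: "f h \<lesssim> f i" for i
  proof (cases "coeff p i = 0")
    case False
    then show ?thesis using h(2)[of i] le_degree[of p i] by (simp add: I_def)
  qed (simp add: zero)
  show thesis by (rule that[OF _ least]) (use h(1) in \<open>simp add: I_def\<close>)
qed

text \<open>The remaining terms together have greater value than the least one.\<close>

lemma close_sum:
  assumes "finite I" "h \<in> I" "f h \<noteq> 0" "\<And>i. i \<in> I \<Longrightarrow> i \<noteq> h \<Longrightarrow> f h \<lless> f i"
  shows "sum f I \<approx> f h"
proof -
  have "sum f I - f h = sum f (I - {h})"
    using assms by (simp add: sum_diff1)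
  then show ?thesis
    unfolding close_def using sum_less[of "f h" "I - {h}" f] assms by auto
qed

end

subsection \<open>From Krull valuations to preorders and back\<close>

definition val_le :: "('k::field, 'g) krull \<Rightarrow> 'k \<Rightarrow> 'k \<Rightarrow> bool" where
  "val_le v y z \<longleftrightarrow> vle (vgroup v) (val v y) (val v z)"

locale krull_valuation =
  fixes v :: "('k::field, 'g) krull"
  assumes valuation: "valuation v"
begin

sublocale G: ordered_abelian_group "vgroup v"
  using valuation by (simp add: valuation_def)

lemma carrier_iff: "\<gamma> \<in> carrier (vgroup v) \<longleftrightarrow> (\<exists>a. val v a = Val \<gamma>)"
  using valuation by (simp add: valuation_def)

lemma val_eq_Infty_iff [simp]: "val v a = Infty \<longleftrightarrow> a = 0"
  using valuation by (simp add: valuation_def)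

lemma val_zero [simp]: "val v 0 = Infty"
  by simp

lemma val_mult: "val v (a * b) = vadd (vgroup v) (val v a) (val v b)"
  using valuation by (simp add: valuation_def)

lemma val_cases:
  obtains "a = 0" "val v a = Infty"
  | \<gamma> where "a \<noteq> 0" "val v a = Val \<gamma>" "\<gamma> \<in> carrier (vgroup v)"
  using val_eq_Infty_iff carrier_iff by (metis extval.exhaust)

lemma val_one: "val v 1 = Val \<one>\<^bsub>vgroup v\<^esub>"
proof (cases rule: val_cases[of 1])
  case (2 \<gamma>)
  then have "\<gamma> \<otimes>\<^bsub>vgroup v\<^esub> \<gamma> = \<gamma>"
    using val_mult[of 1 1] by simp
  then show ?thesis
    using 2 by simp
qed simp

sublocale valuation_preorder "val_le v"
proof
  show "val_le v y z \<or> val_le v z y" for y z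
    unfolding val_le_def
    by (cases rule: val_cases[of y]; cases rule: val_cases[of z]) (auto dest: G.ole_total)
  show "val_le v w z" if "val_le v w y" "val_le v y z" for w y z
    using that unfolding val_le_def
    by (cases rule: val_cases[of w]; cases rule: val_cases[of y]; cases rule: val_cases[of z])
      (auto intro: G.ole_trans)
  show "val_le v (w * y) (w * z)" if "val_le v y z" for w y z
    using that unfolding mult.commute[of w] val_le_def val_mult
    by (cases rule: val_cases[of w]; cases rule: val_cases[of y]; cases rule: val_cases[of z])
      (auto intro: G.ole_mult_mono)
  show "val_le v w (y + z)" if le: "val_le v w y" "val_le v w z" for w y z
  proof -
    have "vle (vgroup v) (vmin (vgroup v) (val v y) (val v z)) (val v (y + z))"
      using valuation by (simp add: valuation_def)
    then have "val_le v y (y + z) \<or> val_le v z (y + z)"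
      unfolding vmin_def val_le_def by (auto split: if_splits)
    then show ?thesis
      using le \<open>\<And>z y w. val_le v w y \<Longrightarrow> val_le v y z \<Longrightarrow> val_le v w z\<close> by blast
  qed
  show "\<not> val_le v 0 1"
    by (simp add: val_le_def val_one)
qed

lemma val_eq_iff: "val v y = val v z \<longleftrightarrow> same y z"
  unfolding same_def val_le_def
  by (cases rule: val_cases[of y]; cases rule: val_cases[of z])
    (auto intro: G.ole_antisym G.ole_refl)

lemma vless_iff: "vless (vgroup v) (val v y) (val v z) \<longleftrightarrow> less y z"
  unfolding vless_def val_eq_iff same_def val_le_def[symmetric] using total by blast

lemma val_power: "val v y = Val \<gamma> \<Longrightarrow> val v (y ^ n) = Val (\<gamma> [^]\<^bsub>vgroup v\<^esub> n)"
  by (induction n) (auto simp: val_one val_mult power_Suc2 simp del: power_Suc)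

lemma val_inverse:
  assumes "val v y = Val \<gamma>"
  shows "val v (inverse y) = Val (inv\<^bsub>vgroup v\<^esub> \<gamma>)"
proof -
  have "y \<noteq> 0" using assms by auto
  then have "val v (inverse y * y) = Val \<one>\<^bsub>vgroup v\<^esub>" by (simp add: val_one)
  moreover obtain \<delta> where \<delta>: "val v (inverse y) = Val \<delta>" "\<delta> \<in> carrier (vgroup v)"
    using val_cases[of "inverse y"] \<open>y \<noteq> 0\<close> by auto
  moreover have "\<gamma> \<in> carrier (vgroup v)" using assms carrier_iff by blast
  ultimately have "\<delta> = inv\<^bsub>vgroup v\<^esub> \<gamma>"
    using assms by (intro G.inv_equality[symmetric]) (auto simp: val_mult)
  then show ?thesis using \<delta> by simp
qed

end

text \<open>The value group is the multiplicative group of the field modulo the elements of value zero.\<close>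

lemma krull_of_valuation_preorder:
  fixes le :: "'b::field \<Rightarrow> 'b \<Rightarrow> bool"
  assumes "valuation_preorder le"
  obtains v :: "('b, 'b set) krull" where "valuation v" "val_le v = le"
proof -
  interpret valuation_preorder le by fact
  define cls where "cls y = {z. same z y}" for y
  define rep where "rep A = (SOME y. y \<in> A)" for A :: "'b set"
  have rep_cls: "same (rep (cls y)) y" for y
    unfolding rep_def cls_def using someI[of "\<lambda>z. same z y" y] by simp
  have cls_eq: "cls y = cls z \<longleftrightarrow> same y z" for y z
    unfolding cls_def using same_refl same_trans same_sym by blast
  have rep0: "rep (cls y) = 0 \<longleftrightarrow> y = 0" for y
    using same_imp_zero_iff[OF rep_cls] .
  have cls_mult: "cls (rep (cls y) * rep (cls z)) = cls (y * z)" for y z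
    unfolding cls_eq by (intro mult_same rep_cls)
  define H :: "'b set ogroup" where
    "H = \<lparr>carrier = cls ` (- {0}), mult = \<lambda>A B. cls (rep A * rep B), one = cls 1,
      ole = \<lambda>A B. le (rep A) (rep B)\<rparr>"
  have H_simps: "carrier H = cls ` (- {0})" "\<one>\<^bsub>H\<^esub> = cls 1"
    "\<And>A B. A \<otimes>\<^bsub>H\<^esub> B = cls (rep A * rep B)" "\<And>A B. A \<preceq>\<^bsub>H\<^esub> B \<longleftrightarrow> le (rep A) (rep B)"
    unfolding H_def by auto
  have ole_cls: "cls y \<preceq>\<^bsub>H\<^esub> cls z \<longleftrightarrow> le y z" for y z
    unfolding H_simps same_le_left[OF rep_cls] same_le_right[OF rep_cls] ..
  have mult_cls: "cls y \<otimes>\<^bsub>H\<^esub> cls z = cls (y * z)" for y z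
    by (simp add: H_simps cls_mult)
  have "comm_group H"
  proof (rule comm_groupI)
    fix A assume "A \<in> carrier H"
    then obtain y where y: "y \<noteq> 0" "A = cls y" by (auto simp: H_simps)
    then show "\<exists>B\<in>carrier H. B \<otimes>\<^bsub>H\<^esub> A = \<one>\<^bsub>H\<^esub>"
      by (intro bexI[of _ "cls (inverse y)"]) (auto simp: mult_cls H_simps(1,2))
  qed (auto simp: mult_cls H_simps(1,2) mult_ac)
  then have H: "ordered_abelian_group H"
  proof (rule ordered_abelian_group.intro, unfold_locales)
    fix A B C assume "A \<in> carrier H" "B \<in> carrier H" "C \<in> carrier H" "A \<preceq>\<^bsub>H\<^esub> B"
    then show "A \<otimes>\<^bsub>H\<^esub> C \<preceq>\<^bsub>H\<^esub> B \<otimes>\<^bsub>H\<^esub> C"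
      by (auto simp: mult_cls ole_cls H_simps(1) intro: mult_right)
  next
    fix A B C assume "A \<in> carrier H" "B \<in> carrier H" "C \<in> carrier H" "A \<preceq>\<^bsub>H\<^esub> B" "B \<preceq>\<^bsub>H\<^esub> C"
    then show "A \<preceq>\<^bsub>H\<^esub> C"
      by (auto simp: ole_cls H_simps(1) intro: trans)
  next
    fix A B assume "A \<in> carrier H" "B \<in> carrier H" "A \<preceq>\<^bsub>H\<^esub> B" "B \<preceq>\<^bsub>H\<^esub> A"
    then show "A = B"
      unfolding H_simps(1) using ole_cls cls_eq same_def by (metis imageE)
  next
    fix A B assume "A \<in> carrier H" "B \<in> carrier H"
    then show "A \<preceq>\<^bsub>H\<^esub> B \<or> B \<preceq>\<^bsub>H\<^esub> A"
      by (auto simp: ole_cls H_simps(1)) (use total in blast)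
  next
    fix A assume "A \<in> carrier H"
    then show "A \<preceq>\<^bsub>H\<^esub> A"
      by (auto simp: ole_cls H_simps(1))
  qed
  define v :: "('b, 'b set) krull" where
    "v = \<lparr>vgroup = H, val = \<lambda>y. if y = 0 then Infty else Val (cls y)\<rparr>"
  have v_simps: "vgroup v = H" "\<And>y. val v y = (if y = 0 then Infty else Val (cls y))"
    unfolding v_def by auto
  have v_le: "val_le v y z \<longleftrightarrow> le y z" for y z
    by (simp add: val_le_def v_simps ole_cls zero_le_iff)
  have "valuation v"
    unfolding valuation_def
  proof (intro conjI allI)
    show "vle (vgroup v) (vmin (vgroup v) (val v a) (val v b)) (val v (a + b))" for a b
    proof (cases "le a b")
      case True
      then have "val_le v a (a + b)" using add[of a a b] by (simp add: v_le)
      then show ?thesis using True by (simp add: vmin_def val_le_def[symmetric] v_le)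
    next
      case False
      then have "val_le v b (a + b)" using add[of b a b] total[of a b] by (simp add: v_le)
      then show ?thesis using False by (simp add: vmin_def val_le_def[symmetric] v_le)
    qed
  qed (use H in \<open>auto simp: v_simps H_simps(1) mult_cls\<close>)
  moreover have "val_le v = le"
    using v_le by blast
  ultimately show thesis by (rule that)
qed

subsection \<open>Extensions and equivalence\<close>

definition le_embedding ::
  "('a::field \<Rightarrow> 'b::field) \<Rightarrow> ('a, 'g) krull \<Rightarrow> ('b, 'h) krull \<Rightarrow> bool" where
  "le_embedding emb v0 v \<longleftrightarrow> (\<forall>a b. val_le v (emb a) (emb b) \<longleftrightarrow> val_le v0 a b)"

text \<open>An element of \<open>v\<^sub>0K\<close> can only be sent to the value of the image of an element of \<open>K\<close> that has this
  value, and this is well defined since the embedding of fields respects equality of values.\<close>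

lemma value_incl_order_embedding:
  fixes v0 :: "('a::field, 'g) krull" and v :: "('b::field, 'h) krull"
  assumes v0: "valuation v0" and v: "valuation v" and emb: "field_embedding emb"
    and le: "le_embedding emb v0 v"
  shows "value_incl emb v0 v \<in> order_embedding (vgroup v0) (vgroup v)"
    and "\<forall>c. val v (emb c) = ext_map (value_incl emb v0 v) (val v0 c)"
proof -
  interpret v0: krull_valuation v0 using v0 by unfold_locales
  interpret v: krull_valuation v using v by unfold_locales
  have le': "val_le v (emb a) (emb b) \<longleftrightarrow> val_le v0 a b" for a b
    using le by (simp add: le_embedding_def)
  have emb_mult: "emb (a * b) = emb a * emb b" for a b
    using emb by (simp add: field_embedding_def)
  have emb0: "emb 0 = 0"
    using emb unfolding field_embedding_def by (metis add_cancel_right_right)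
  have same: "v.same (emb a) (emb b) \<longleftrightarrow> v0.same a b" for a b
    by (simp add: v.same_def v0.same_def le')
  have *: "val v (emb c) = Val (value_incl emb v0 v \<gamma>)" if c: "val v0 c = Val \<gamma>" for c \<gamma>
  proof -
    have "c \<noteq> 0" using c by auto
    then have "\<not> v.same (emb c) 0"
      using same[of c 0] by (simp add: emb0 v0.same_zero_iff)
    then obtain \<delta> where \<delta>: "val v (emb c) = Val \<delta>"
      using v.val_cases[of "emb c"] by (metis v.same_refl)
    have "value_incl emb v0 v \<gamma> = \<delta>"
      unfolding value_incl_def
    proof (rule the_equality)
      fix \<delta>' assume "\<exists>c. val v0 c = Val \<gamma> \<and> val v (emb c) = Val \<delta>'"
      then obtain c' where c': "val v0 c' = Val \<gamma>" "val v (emb c') = Val \<delta>'" by blast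
      then have "v.same (emb c) (emb c')" using c same v0.val_eq_iff by metis
      then show "\<delta>' = \<delta>" using c' \<delta> v.val_eq_iff by (metis extval.inject)
    qed (use c \<delta> in blast)
    then show ?thesis using \<delta> by simp
  qed
  show "\<forall>c. val v (emb c) = ext_map (value_incl emb v0 v) (val v0 c)"
  proof
    fix c
    show "val v (emb c) = ext_map (value_incl emb v0 v) (val v0 c)"
      by (cases rule: v0.val_cases[of c]) (auto simp: * emb0)
  qed
  show "value_incl emb v0 v \<in> order_embedding (vgroup v0) (vgroup v)"
    unfolding order_embedding_def hom_def mem_Collect_eq
  proof (intro conjI ballI Pi_I)
    fix \<gamma> assume "\<gamma> \<in> carrier (vgroup v0)"
    then obtain c where c: "val v0 c = Val \<gamma>" using v0.carrier_iff by blast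
    show "value_incl emb v0 v \<gamma> \<in> carrier (vgroup v)"
      using *[OF c] v.carrier_iff by blast
    fix \<delta> assume "\<delta> \<in> carrier (vgroup v0)"
    then obtain d where d: "val v0 d = Val \<delta>" using v0.carrier_iff by blast
    have "val v0 (c * d) = Val (\<gamma> \<otimes>\<^bsub>vgroup v0\<^esub> \<delta>)"
      by (simp add: v0.val_mult c d)
    from *[OF this] show "value_incl emb v0 v (\<gamma> \<otimes>\<^bsub>vgroup v0\<^esub> \<delta>) =
        value_incl emb v0 v \<gamma> \<otimes>\<^bsub>vgroup v\<^esub> value_incl emb v0 v \<delta>"
      by (simp add: emb_mult v.val_mult *[OF c] *[OF d])
    show "\<gamma> \<preceq>\<^bsub>vgroup v0\<^esub> \<delta> \<longleftrightarrow>
        value_incl emb v0 v \<gamma> \<preceq>\<^bsub>vgroup v\<^esub> value_incl emb v0 v \<delta>"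
      using le'[of c d] by (simp add: val_le_def c d *)
  qed
qed

lemma extends_iff:
  assumes v0: "valuation v0" and emb: "field_embedding emb"
  shows "extends emb v0 v \<longleftrightarrow> valuation v \<and> le_embedding emb v0 v"
proof
  assume "extends emb v0 v"
  then obtain \<iota> where \<iota>: "\<iota> \<in> order_embedding (vgroup v0) (vgroup v)"
    and eq: "\<forall>c. val v (emb c) = ext_map \<iota> (val v0 c)" and v: "valuation v"
    unfolding extends_def by blast
  interpret v0: krull_valuation v0 using v0 by unfold_locales
  have "val_le v (emb a) (emb b) \<longleftrightarrow> val_le v0 a b" for a b
    using \<iota> unfolding val_le_def eq[rule_format] order_embedding_def
    by (cases rule: v0.val_cases[of a]; cases rule: v0.val_cases[of b]) auto
  then show "valuation v \<and> le_embedding emb v0 v"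
    using v by (simp add: le_embedding_def)
next
  assume "valuation v \<and> le_embedding emb v0 v"
  then show "extends emb v0 v"
    using value_incl_order_embedding[of v0 v emb] v0 emb unfolding extends_def by blast
qed

lemma value_incl_val:
  assumes v0: "valuation v0" and emb: "field_embedding emb" and ext: "extends emb v0 v"
  shows "val v (emb c) = ext_map (value_incl emb v0 v) (val v0 c)"
  using value_incl_order_embedding[of v0 v emb] assms extends_iff[of v0 emb v] by blast

lemma base_values_eq:
  assumes v0: "valuation v0" and emb: "field_embedding emb" and ext: "extends emb v0 v"
  shows "base_values emb v0 v = {\<delta>. \<exists>c. val v (emb c) = Val \<delta>}"
proof -
  interpret v0: krull_valuation v0 using v0 by unfold_locales
  show ?thesis
    unfolding base_values_def value_incl_val[OF assms] using v0.carrier_iff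
    by (auto simp: image_iff) (metis extval.exhaust extval.inject extval.map extval.distinct(2))+
qed

text \<open>An equivalence is an extension along the identity, so that the previous description of
  extensions applies to it; it is the identity on \<open>v\<^sub>0K\<close> because it commutes with the valuations.\<close>

lemma equivalent_over_iff:
  assumes v0: "valuation v0" and emb: "field_embedding emb"
    and ext: "extends emb v0 v" "extends emb v0 v'"
  shows "equivalent_over emb v0 v v' \<longleftrightarrow> val_le v = val_le v'"
proof
  have v: "valuation v" and v': "valuation v'"
    using ext unfolding extends_def by auto
  interpret v0: krull_valuation v0 using v0 by unfold_locales
  interpret v: krull_valuation v using v by unfold_locales
  interpret v': krull_valuation v' using v' by unfold_locales
  {
    assume "equivalent_over emb v0 v v'"
    then obtain \<phi> where \<phi>: "\<phi> \<in> order_embedding (vgroup v) (vgroup v')"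
      and eq: "\<forall>y. val v' y = ext_map \<phi> (val v y)"
      unfolding equivalent_over_def order_iso_def by blast
    have "extends id v v'"
      unfolding extends_def using \<phi> eq v' by auto
    then show "val_le v = val_le v'"
      using extends_iff[OF v, of id v'] by (auto simp: field_embedding_def le_embedding_def)
  next
    assume le: "val_le v = val_le v'"
    have id: "field_embedding id" by (simp add: field_embedding_def)
    have ext': "le_embedding id v v'"
      using le by (simp add: le_embedding_def)
    define \<phi> where "\<phi> = value_incl id v v'"
    have \<phi>: "\<phi> \<in> order_embedding (vgroup v) (vgroup v')" and eq: "val v' y = ext_map \<phi> (val v y)" for y
      using value_incl_order_embedding[OF v v' id ext'] unfolding \<phi>_def by auto
    have "bij_betw \<phi> (carrier (vgroup v)) (carrier (vgroup v'))"
      unfolding bij_betw_def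
    proof
      show "inj_on \<phi> (carrier (vgroup v))"
      proof (rule inj_onI)
        fix \<gamma> \<delta> assume *: "\<gamma> \<in> carrier (vgroup v)" "\<delta> \<in> carrier (vgroup v)" "\<phi> \<gamma> = \<phi> \<delta>"
        then obtain y z where yz: "val v y = Val \<gamma>" "val v z = Val \<delta>"
          using v.carrier_iff by metis
        then have "val v' y = val v' z" using * eq by simp
        then have "val v y = val v z"
          unfolding v.val_eq_iff v'.val_eq_iff v.same_def v'.same_def le .
        then show "\<gamma> = \<delta>" using yz by simp
      qed
      have "\<exists>\<gamma>. val v y = Val \<gamma> \<and> \<gamma> \<in> carrier (vgroup v) \<and> \<delta> = \<phi> \<gamma>" if "val v' y = Val \<delta>" for y \<delta>
        using that eq[of y] by (cases rule: v.val_cases[of y]) auto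
      then show "\<phi> ` carrier (vgroup v) = carrier (vgroup v')"
        using \<phi> v'.carrier_iff by (fastforce simp: order_embedding_def hom_def)
    qed
    then have iso: "\<phi> \<in> order_iso (vgroup v) (vgroup v')"
      using \<phi> by (simp add: order_iso_def iso_def order_embedding_def)
    have "\<phi> (value_incl emb v0 v \<gamma>) = value_incl emb v0 v' \<gamma>"
      if \<gamma>: "\<gamma> \<in> carrier (vgroup v0)" for \<gamma>
    proof -
      obtain c where "val v0 c = Val \<gamma>" using \<gamma> v0.carrier_iff by blast
      then show ?thesis
        using eq[of "emb c"] value_incl_val[OF v0 emb ext(1), of c]
          value_incl_val[OF v0 emb ext(2), of c] by simp
    qed
    then show "equivalent_over emb v0 v v'"
      unfolding equivalent_over_def using iso eq by blast
  }
qed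

subsection \<open>The residue field\<close>

context krull_valuation
begin

lemma carrier_valuation_ring: "a \<in> carrier (valuation_ring v) \<longleftrightarrow> val_le v 1 a"
  by (simp add: valuation_ring_def val_le_def val_one)

lemma mem_valuation_ideal: "a \<in> valuation_ideal v \<longleftrightarrow> less 1 a"
  using vless_iff[of 1 a] by (simp add: valuation_ideal_def val_one)

lemma valuation_ring_simps [simp]:
  "mult (valuation_ring v) = (*)" "one (valuation_ring v) = 1"
  "zero (valuation_ring v) = 0" "add (valuation_ring v) = (+)"
  by (simp_all add: valuation_ring_def)

lemma valuation_ring_cring: "cring (valuation_ring v)"
proof (rule cringI)
  show "abelian_group (valuation_ring v)"
  proof (rule abelian_groupI)
    fix a assume "a \<in> carrier (valuation_ring v)"
    then show "\<exists>b\<in>carrier (valuation_ring v). b \<oplus>\<^bsub>valuation_ring v\<^esub> a = \<zero>\<^bsub>valuation_ring v\<^esub>"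
      by (intro bexI[of _ "- a"]) (auto simp: carrier_valuation_ring le_uminus)
  qed (auto simp: carrier_valuation_ring intro: add)
  show "comm_monoid (valuation_ring v)"
    by unfold_locales (use mult_mono[of 1 _ 1] in \<open>auto simp: carrier_valuation_ring\<close>)
qed (auto simp: distrib_right)

lemma valuation_ideal_maximal: "maximalideal (valuation_ideal v) (valuation_ring v)"
proof (rule maximalidealI)
  interpret R: cring "valuation_ring v" by (rule valuation_ring_cring)
  have minus: "\<ominus>\<^bsub>valuation_ring v\<^esub> a = - a" if "a \<in> carrier (valuation_ring v)" for a
    using that by (intro R.minus_equality) (auto simp: carrier_valuation_ring le_uminus)
  show "ideal (valuation_ideal v) (valuation_ring v)"
  proof (rule idealI)
    have "subgroup (valuation_ideal v) (add_monoid (valuation_ring v))"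
    proof (rule R.add.subgroupI)
      show "valuation_ideal v \<subseteq> carrier (valuation_ring v)"
        using less_imp_le by (auto simp: mem_valuation_ideal carrier_valuation_ring)
      have "0 \<in> valuation_ideal v" by (simp add: mem_valuation_ideal zero_le_iff)
      then show "valuation_ideal v \<noteq> {}" by blast
      show "\<ominus>\<^bsub>valuation_ring v\<^esub> a \<in> valuation_ideal v" if "a \<in> valuation_ideal v" for a
        using that less_imp_le
        by (subst minus) (auto simp: mem_valuation_ideal carrier_valuation_ring uminus_le)
      show "a \<oplus>\<^bsub>valuation_ring v\<^esub> b \<in> valuation_ideal v"
        if "a \<in> valuation_ideal v" "b \<in> valuation_ideal v" for a b
        using that add_less by (simp add: mem_valuation_ideal)
    qed
    then show "subgroup (valuation_ideal v) (add_monoid (valuation_ring v))" .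
    show "b \<otimes>\<^bsub>valuation_ring v\<^esub> a \<in> valuation_ideal v"
      "a \<otimes>\<^bsub>valuation_ring v\<^esub> b \<in> valuation_ideal v"
      if "a \<in> valuation_ideal v" "b \<in> carrier (valuation_ring v)" for a b
      using that mult_less_mono[of a 1 1 b]
      by (auto simp: mem_valuation_ideal carrier_valuation_ring mult.commute)
  qed (rule R.ring_axioms)
  show "carrier (valuation_ring v) \<noteq> valuation_ideal v"
    using carrier_valuation_ring[of 1] mem_valuation_ideal[of 1] by auto
  show "J = valuation_ideal v \<or> J = carrier (valuation_ring v)"
    if J: "ideal J (valuation_ring v)" "valuation_ideal v \<subseteq> J" "J \<subseteq> carrier (valuation_ring v)" for J
  proof (rule disjCI)
    assume "J \<noteq> carrier (valuation_ring v)"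
    interpret J: ideal J "valuation_ring v" by fact
    have "a \<in> valuation_ideal v" if a: "a \<in> J" for a
    proof (rule ccontr)
      assume *: "a \<notin> valuation_ideal v"
      then have le: "val_le v a 1" by (simp add: mem_valuation_ideal)
      then have "a \<noteq> 0" using zero_le_iff[of 1] by auto
      then have "inverse a \<in> carrier (valuation_ring v)"
        using le divide_le_iff[of a a 1] le_divide_iff[of a 1 1]
        by (simp add: carrier_valuation_ring inverse_eq_divide)
      then have "1 \<in> J" using J.I_l_closed[OF a, of "inverse a"] \<open>a \<noteq> 0\<close> by simp
      then have "b \<in> J" if "b \<in> carrier (valuation_ring v)" for b
        using J.I_l_closed[OF _ that, of 1] by simp
      then show False using J \<open>J \<noteq> carrier (valuation_ring v)\<close> by blast
    qed
    then show "J = valuation_ideal v" using J by blast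
  qed
qed

lemma residue_field_field: "field (residue_field v)"
  unfolding residue_field_def
  by (rule maximalideal.quotient_is_field[OF valuation_ideal_maximal valuation_ring_cring])

sublocale Res: field "residue_field v"
  by (rule residue_field_field)

lemma residue_hom: "residue v \<in> ring_hom (valuation_ring v) (residue_field v)"
proof -
  interpret maximalideal "valuation_ideal v" "valuation_ring v" by (rule valuation_ideal_maximal)
  show ?thesis
    unfolding residue_field_def residue_def[abs_def] by (rule rcos_ring_hom)
qed

lemma carrier_residue_field: "carrier (residue_field v) = residue v ` carrier (valuation_ring v)"
  by (auto simp: residue_field_def residue_def[abs_def] FactRing_def A_RCOSETS_def' simp del: valuation_ring_simps)

lemma residue_closed: "val_le v 1 y \<Longrightarrow> residue v y \<in> carrier (residue_field v)"
  by (simp add: carrier_residue_field carrier_valuation_ring)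

lemma residue_eq_iff: "residue v y = residue v z \<longleftrightarrow> less 1 (y - z)"
proof -
  have residue: "residue v y = {u. less 1 (u - y)}" for y
  proof -
    have "residue v y = (\<lambda>i. i + y) ` valuation_ideal v"
      by (auto simp: residue_def a_r_coset_def r_coset_def)
    also have "\<dots> = {u. less 1 (u - y)}"
    proof (intro equalityI subsetI)
      fix u assume "u \<in> {u. less 1 (u - y)}"
      then show "u \<in> (\<lambda>i. i + y) ` valuation_ideal v"
        by (intro image_eqI[of _ _ "u - y"]) (simp_all add: mem_valuation_ideal)
    qed (auto simp: mem_valuation_ideal)
    finally show ?thesis .
  qed
  have "less 1 (u - y) \<longleftrightarrow> less 1 (u - z)" if "less 1 (y - z)" for u
    using add_less[OF _ that, of "u - y"] diff_less[OF _ that, of "u - z"] by auto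
  moreover have "less 1 (y - y)" by (simp add: zero_le_iff)
  ultimately show ?thesis
    unfolding residue by blast
qed

lemma residue_zero: "residue v 0 = \<zero>\<^bsub>residue_field v\<^esub>"
proof -
  interpret ring_hom_ring "valuation_ring v" "residue_field v" "residue v"
    by (rule ring_hom_ringI2)
      (use valuation_ring_cring Res.ring_axioms residue_hom in \<open>auto simp: cring_def\<close>)
  show ?thesis using hom_zero by simp
qed

lemma residue_eq_zero_iff: "residue v y = \<zero>\<^bsub>residue_field v\<^esub> \<longleftrightarrow> less 1 y"
  using residue_eq_iff[of y 0] by (simp add: residue_zero)

lemma residue_one: "residue v 1 = \<one>\<^bsub>residue_field v\<^esub>"
  using ring_hom_one[OF residue_hom] by simp

lemma residue_mult:
  "val_le v 1 y \<Longrightarrow> val_le v 1 z \<Longrightarrow>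
    residue v (y * z) = residue v y \<otimes>\<^bsub>residue_field v\<^esub> residue v z"
  using ring_hom_mult[OF residue_hom, of y z] by (simp add: carrier_valuation_ring)

lemma residue_add:
  "val_le v 1 y \<Longrightarrow> val_le v 1 z \<Longrightarrow>
    residue v (y + z) = residue v y \<oplus>\<^bsub>residue_field v\<^esub> residue v z"
  using ring_hom_add[OF residue_hom, of y z] by (simp add: carrier_valuation_ring)

lemma residue_uminus:
  assumes "val_le v 1 y"
  shows "residue v (- y) = \<ominus>\<^bsub>residue_field v\<^esub> residue v y"
proof (rule Res.minus_equality[symmetric])
  show "residue v (- y) \<oplus>\<^bsub>residue_field v\<^esub> residue v y = \<zero>\<^bsub>residue_field v\<^esub>"
    using residue_add[of "- y" y] assms by (simp add: le_uminus residue_zero)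
qed (use assms in \<open>auto intro: residue_closed simp: le_uminus\<close>)

lemma integral_power: "val_le v 1 y \<Longrightarrow> val_le v 1 (y ^ n)"
  using power_mono[of 1 y n] by simp

lemma residue_power:
  "val_le v 1 y \<Longrightarrow> residue v (y ^ n) = residue v y [^]\<^bsub>residue_field v\<^esub> n"
  by (induction n) (auto simp: residue_one residue_mult integral_power power_Suc2 simp del: power_Suc)

lemma residue_inverse:
  assumes "same 1 y"
  shows "residue v (inverse y) = inv\<^bsub>residue_field v\<^esub> residue v y"
proof (rule Res.inv_char[symmetric, OF _ _ ])
  have y: "y \<noteq> 0" using same_imp_zero_iff[OF assms] by simp
  have int: "val_le v 1 y" "val_le v 1 (inverse y)"
    using assms le_divide_iff[OF y, of 1 1] by (auto simp: same_def inverse_eq_divide)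
  then show "residue v y \<in> carrier (residue_field v)" "residue v (inverse y) \<in> carrier (residue_field v)"
    by (auto intro: residue_closed)
  show "residue v y \<otimes>\<^bsub>residue_field v\<^esub> residue v (inverse y) = \<one>\<^bsub>residue_field v\<^esub>"
    "residue v (inverse y) \<otimes>\<^bsub>residue_field v\<^esub> residue v y = \<one>\<^bsub>residue_field v\<^esub>"
    using int y by (auto simp flip: residue_mult residue_one)
qed

end

section \<open>Extensions of a valued field\<close>

locale field_emb =
  fixes emb :: "'a::field \<Rightarrow> 'b::field"
  assumes field_embedding: "field_embedding emb"
begin

lemma emb_one [simp]: "emb 1 = 1" and emb_add: "emb (a + b) = emb a + emb b"
  and emb_mult: "emb (a * b) = emb a * emb b"
  using field_embedding by (auto simp: field_embedding_def)

lemma emb_zero [simp]: "emb 0 = 0"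
  using emb_add[of 0 0] by (simp only: add_0_left add_cancel_right_left)

lemma emb_eq_zero_iff [simp]: "emb a = 0 \<longleftrightarrow> a = 0"
  proof
  assume "emb a = 0"
  then show "a = 0" using emb_mult[of a "inverse a"] by (cases "a = 0") auto
qed simp

lemma emb_uminus: "emb (- a) = - emb a"
  using emb_add[of a "- a"] by (simp add: eq_neg_iff_add_eq_0 add.commute)

lemma emb_diff: "emb (a - b) = emb a - emb b"
  using emb_add[of a "- b"] by (simp add: emb_uminus)

lemma emb_inverse: "emb (inverse a) = inverse (emb a)"
  using emb_mult[of a "inverse a"] by (cases "a = 0") (auto simp: field_simps)

lemma emb_divide: "emb (a / b) = emb a / emb b"
  by (simp add: divide_inverse emb_mult emb_inverse)

lemma emb_power: "emb (a ^ n) = emb a ^ n"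
  by (induction n) (auto simp: emb_mult)

lemma eval_at_pCons [simp]: "eval_at emb t (pCons a p) = emb a + t * eval_at emb t p"
  by (simp add: eval_at_def map_poly_pCons)

lemma eval_at_zero [simp]: "eval_at emb t 0 = 0"
  by (simp add: eval_at_def)

lemma eval_at_add: "eval_at emb t (p + q) = eval_at emb t p + eval_at emb t q"
proof -
  have "map_poly emb (p + q) = map_poly emb p + map_poly emb q"
    by (intro poly_eqI) (simp add: coeff_map_poly emb_add)
  then show ?thesis by (simp add: eval_at_def)
qed

lemma eval_at_smult: "eval_at emb t (smult a p) = emb a * eval_at emb t p"
  by (simp add: eval_at_def map_poly_smult emb_mult)

lemma eval_at_mult: "eval_at emb t (p * q) = eval_at emb t p * eval_at emb t q"
  by (induction p) (auto simp: mult_pCons_left eval_at_add eval_at_smult algebra_simps)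

lemma eval_at_one [simp]: "eval_at emb t 1 = 1"
  by (simp add: eval_at_def)

lemma eval_at_pcompose: "eval_at emb t (pcompose p q) = eval_at emb (eval_at emb t q) p"
  by (induction p) (auto simp: pcompose_pCons eval_at_add eval_at_mult)

lemma eval_at_sum:
  "eval_at emb t p = (\<Sum>i\<le>degree p. emb (coeff p i) * t ^ i)"
proof -
  have "degree (map_poly emb p) = degree p"
    by (rule degree_map_poly) simp
  then show ?thesis
    by (simp add: eval_at_def poly_altdef coeff_map_poly)
qed

lemma eval_at_monom: "eval_at emb t (monom a n) = emb a * t ^ n"
  by (simp add: eval_at_def map_poly_monom poly_monom)

end

locale valued_extension = field_emb emb for emb :: "'a::field \<Rightarrow> 'b::field" +
  fixes v0 :: "('a, 'g) krull" and v :: "('b, 'h) krull"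
  assumes v0_valuation: "valuation v0"
    and ext: "extends emb v0 v"
begin

sublocale K: krull_valuation v0
  using v0_valuation by unfold_locales

sublocale L: krull_valuation v
  using ext by unfold_locales (simp add: extends_def)

abbreviation le0 (infix "\<lesssim>\<^sub>0" 50) where "a \<lesssim>\<^sub>0 b \<equiv> val_le v0 a b"
abbreviation less0 (infix "\<lless>\<^sub>0" 50) where "a \<lless>\<^sub>0 b \<equiv> \<not> val_le v0 b a"
abbreviation le (infix "\<lesssim>" 50) where "y \<lesssim> z \<equiv> val_le v y z"
abbreviation less (infix "\<lless>" 50) where "y \<lless> z \<equiv> \<not> val_le v z y"
abbreviation same (infix "\<doteq>" 50) where "y \<doteq> z \<equiv> L.same y z"
abbreviation close (infix "\<approx>" 50) where "y \<approx> z \<equiv> L.close y z"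

lemma emb_le_iff [simp]: "emb a \<lesssim> emb b \<longleftrightarrow> a \<lesssim>\<^sub>0 b"
  using ext extends_iff[OF v0_valuation field_embedding] by (auto simp: le_embedding_def)

lemma one_le_emb_iff [simp]: "1 \<lesssim> emb a \<longleftrightarrow> 1 \<lesssim>\<^sub>0 a" and emb_le_one_iff [simp]: "emb a \<lesssim> 1 \<longleftrightarrow> a \<lesssim>\<^sub>0 1"
  using emb_le_iff[of 1 a] emb_le_iff[of a 1] by simp_all

lemma emb_same_iff: "emb a \<doteq> emb b \<longleftrightarrow> K.same a b"
  by (simp add: L.same_def K.same_def)

lemma val_emb: "val v (emb c) = ext_map (value_incl emb v0 v) (val v0 c)"
  using value_incl_val[OF v0_valuation field_embedding ext] .

lemma base_values: "base_values emb v0 v = {\<delta>. \<exists>c. val v (emb c) = Val \<delta>}"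
  using base_values_eq[OF v0_valuation field_embedding ext] .

lemma base_residues: "base_residues emb v0 v = (\<lambda>c. residue v (emb c)) ` {c. 1 \<lesssim>\<^sub>0 c}"
  by (simp add: base_residues_def K.carrier_valuation_ring[symmetric])

lemma value_transcendental_iff:
  "value_transcendental emb v0 v t \<longleftrightarrow> t \<noteq> 0 \<and> (\<forall>n>0. \<forall>c. \<not> t ^ n \<doteq> emb c)"
proof (cases rule: L.val_cases[of t])
  case (2 \<gamma>)
  have *: "\<gamma> [^]\<^bsub>vgroup v\<^esub> n \<in> base_values emb v0 v \<longleftrightarrow> (\<exists>c. t ^ n \<doteq> emb c)" for n :: nat
    unfolding base_values L.val_eq_iff[symmetric] using L.val_power[OF 2(2), of n] by (auto intro: sym)
  then show ?thesis
    unfolding value_transcendental_def using 2 by (simp add: *) (metis neq0_conv)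
qed (simp add: value_transcendental_def)

lemma base_values_eq_carrier_iff:
  "carrier (vgroup v) = base_values emb v0 v \<longleftrightarrow> (\<forall>y. \<exists>c. y \<doteq> emb c)" (is "?A \<longleftrightarrow> ?B")
proof
  assume A: ?A
  show ?B
  proof
    fix y
    show "\<exists>c. y \<doteq> emb c"
    proof (cases rule: L.val_cases[of y])
      case 1
      then show ?thesis using L.same_refl emb_zero by metis
    next
      case (2 \<gamma>)
      then show ?thesis using A unfolding base_values L.val_eq_iff[symmetric] by (auto intro: sym)
    qed
  qed
next
  assume B: ?B
  show ?A
    unfolding base_values
  proof (intro equalityI subsetI)
    fix \<gamma> assume "\<gamma> \<in> carrier (vgroup v)"
    then obtain y where y: "val v y = Val \<gamma>" using L.carrier_iff by blast
    then show "\<gamma> \<in> {\<delta>. \<exists>c. val v (emb c) = Val \<delta>}"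
      using B[rule_format, of y] by (auto simp: L.val_eq_iff[symmetric] intro: sym)
  qed (use L.carrier_iff in blast)
qed

lemma base_residues_eq_carrier_iff:
  "carrier (residue_field v) = base_residues emb v0 v \<longleftrightarrow>
    (\<forall>y. 1 \<lesssim> y \<longrightarrow> (\<exists>c. 1 \<lesssim>\<^sub>0 c \<and> 1 \<lless> y - emb c))"
proof -
  have "base_residues emb v0 v \<subseteq> carrier (residue_field v)"
    unfolding base_residues by (auto intro: L.residue_closed)
  then have "carrier (residue_field v) = base_residues emb v0 v \<longleftrightarrow>
      (\<forall>Y\<in>carrier (residue_field v). Y \<in> base_residues emb v0 v)"
    by blast
  also have "\<dots> \<longleftrightarrow> (\<forall>y. 1 \<lesssim> y \<longrightarrow> residue v y \<in> base_residues emb v0 v)"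
    unfolding L.carrier_residue_field by (auto simp: L.carrier_valuation_ring[symmetric])
  finally show ?thesis
    unfolding base_residues image_iff L.residue_eq_iff by simp
qed

text \<open>Only units matter, and a unit has the residue of any element with the same leading term.\<close>

lemma base_residues_eq_carrierI:
  assumes "\<And>y. 1 \<doteq> y \<Longrightarrow> \<exists>c. y \<approx> emb c"
  shows "carrier (residue_field v) = base_residues emb v0 v"
  unfolding base_residues_eq_carrier_iff
proof (intro allI impI)
  fix y assume y: "1 \<lesssim> y"
  show "\<exists>c. 1 \<lesssim>\<^sub>0 c \<and> 1 \<lless> y - emb c"
  proof (cases "1 \<lless> y")
    case True
    then show ?thesis by (intro exI[of _ 0]) simp
  next
    case False
    then have one: "1 \<doteq> y" using y by (simp add: L.same_def)
    then obtain c where c: "y \<approx> emb c" using assms by blast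
    have "1 \<doteq> emb c" using L.same_trans[OF one L.close_same[OF c]] .
    then have "1 \<lesssim>\<^sub>0 c" "1 \<lless> y - emb c"
      using c L.same_le_right[of 1 "emb c" "y - emb c"] by (auto simp: L.same_def L.close_def)
    then show ?thesis by blast
  qed
qed

end

text \<open>A shift of the variable replaces each coefficient by a combination of coefficients, so it
  preserves conditions such as integrality.\<close>

lemma coeff_pcompose_closed:
  fixes p :: "'c::comm_ring_1 poly"
  assumes "P 0" "\<And>a b. P a \<Longrightarrow> P b \<Longrightarrow> P (a + b)" "\<And>a. P a \<Longrightarrow> P (e * a)"
    and "\<And>i. P (coeff p i)"
  shows "P (coeff (pcompose p [:e, 1:]) i)"
  using assms(4)
proof (induction p arbitrary: i)
  case (pCons a p)
  have P: "P a" "P (coeff p i)" for i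
    using pCons.prems[of 0] pCons.prems[of "Suc i"] by simp_all
  have "P (coeff (pcompose p [:e, 1:]) i)" for i
    using pCons.IH P by blast
  then show ?case
    using P assms by (auto simp: pcompose_pCons coeff_pCons split: nat.splits)
qed (use assms in simp)

lemma pcompose_shift_cancel: "pcompose (pcompose p [:e, 1:]) [:- e, 1:] = (p :: 'c::comm_ring_1 poly)"
  by (simp add: pcompose_assoc[symmetric] pcompose_pCons)

context valued_extension
begin

subsection \<open>Residue-transcendental elements\<close>

abbreviation res where "res c \<equiv> residue v (emb c)"

lemma eval_at_integral:
  assumes "1 \<lesssim> t" "\<And>i. 1 \<lesssim>\<^sub>0 coeff p i"
  shows "1 \<lesssim> eval_at emb t p"
  unfolding eval_at_sum
  using assms L.mult_mono[of 1 _ 1] L.integral_power by (intro L.sum) simp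

text \<open>List polynomials start with the leading coefficient; hence the reversal.\<close>

lemma eval_residue:
  assumes "1 \<lesssim> t" "\<And>c. c \<in> set cs \<Longrightarrow> 1 \<lesssim>\<^sub>0 c"
  shows "L.Res.eval (map res cs) (residue v t) = residue v (eval_at emb t (Poly (rev cs)))"
  using assms(2)
proof (induction cs)
  case (Cons c cs)
  have c: "1 \<lesssim>\<^sub>0 c" using Cons.prems by simp
  have "1 \<lesssim>\<^sub>0 coeff (Poly (rev cs)) i" for i
  proof (cases "i < length (rev cs)")
    case True
    then have "coeff (Poly (rev cs)) i \<in> set cs"
      by (metis coeff_Poly_eq nth_default_nth nth_mem set_rev)
    then show ?thesis using Cons.prems by simp
  qed (simp add: nth_default_beyond)
  then have int: "1 \<lesssim> eval_at emb t (Poly (rev cs))"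
    by (rule eval_at_integral[OF assms(1)])
  have tn: "1 \<lesssim> t ^ length cs"
    using assms(1) by (rule L.integral_power)
  have ctn: "1 \<lesssim> emb c * t ^ length cs"
    using L.mult_mono[of 1 "emb c" 1 "t ^ length cs"] c tn by simp
  have "L.Res.eval (map res (c # cs)) (residue v t) =
      res c \<otimes>\<^bsub>residue_field v\<^esub> residue v (t ^ length cs) \<oplus>\<^bsub>residue_field v\<^esub>
        residue v (eval_at emb t (Poly (rev cs)))"
    using Cons.IH Cons.prems assms(1) by (simp add: L.residue_power)
  also have "\<dots> = residue v (emb c * t ^ length cs + eval_at emb t (Poly (rev cs)))"
    using c tn ctn int by (simp add: L.residue_mult L.residue_add)
  also have "emb c * t ^ length cs + eval_at emb t (Poly (rev cs)) =
      eval_at emb t (Poly (rev (c # cs)))"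
    by (simp add: Poly_snoc eval_at_add eval_at_monom)
  finally show ?case .
qed (simp add: L.residue_zero)

text \<open>The residues of \<open>K\<close> already form a field.\<close>

lemma generate_field_base_residues:
  "generate_field (residue_field v) (base_residues emb v0 v) = base_residues emb v0 v"
proof (intro equalityI subsetI)
  fix h assume "h \<in> generate_field (residue_field v) (base_residues emb v0 v)"
  then show "h \<in> base_residues emb v0 v"
  proof induction
    case one
    then show ?case unfolding base_residues by (intro image_eqI[of _ _ 1]) (simp_all add: L.residue_one)
  next
    case (a_inv h)
    then obtain c where "1 \<lesssim>\<^sub>0 c" "h = res c" unfolding base_residues by auto
    then show ?case
      unfolding base_residues
      by (intro image_eqI[of _ _ "- c"]) (simp_all add: emb_uminus L.residue_uminus K.le_uminus)
  next
    case (m_inv h)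
    then obtain c where c: "1 \<lesssim>\<^sub>0 c" "h = res c" unfolding base_residues by auto
    with m_inv have same: "1 \<doteq> emb c"
      by (simp add: L.residue_eq_zero_iff L.same_def)
    then have "K.same 1 c" using emb_same_iff[of 1 c] by simp
    then have "1 \<lesssim>\<^sub>0 inverse c"
      using K.divide_same[of 1 1 1 c] by (simp add: K.same_def inverse_eq_divide)
    then show ?case
      unfolding base_residues c using same
      by (intro image_eqI[of _ _ "inverse c"]) (simp_all add: emb_inverse L.residue_inverse)
  next
    case (eng_add h1 h2)
    then obtain c d where "1 \<lesssim>\<^sub>0 c" "h1 = res c" "1 \<lesssim>\<^sub>0 d" "h2 = res d"
      unfolding base_residues by auto
    then show ?case
      unfolding base_residues
      by (intro image_eqI[of _ _ "c + d"]) (simp_all add: emb_add L.residue_add K.add)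
  next
    case (eng_mult h1 h2)
    then obtain c d where "1 \<lesssim>\<^sub>0 c" "h1 = res c" "1 \<lesssim>\<^sub>0 d" "h2 = res d"
      unfolding base_residues by auto
    then show ?case
      unfolding base_residues using K.mult_mono[of 1 c 1 d]
      by (intro image_eqI[of _ _ "c * d"]) (simp_all add: emb_mult L.residue_mult)
  qed auto
qed (auto intro: generate_field.incl)

lemma base_residues_carrier: "base_residues emb v0 v \<subseteq> carrier (residue_field v)"
  unfolding base_residues by (auto intro: L.residue_closed)

lemma base_residues_subring: "subring (base_residues emb v0 v) (residue_field v)"
  using L.Res.generate_field_is_subfield[OF base_residues_carrier]
  by (simp add: generate_field_base_residues subfieldE(1))

text \<open>A polynomial over \<open>Kv\<^sub>0\<close> is the reduction of a polynomial \<open>p\<close> with integral coefficients, and it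
  vanishes at the residue of \<open>t\<close> if and only if \<open>p(t)\<close> has positive value.\<close>

lemma residue_transcendental_iff:
  "residue_transcendental emb v0 v t \<longleftrightarrow> 1 \<doteq> t \<and>
    (\<forall>p. (\<forall>i. 1 \<lesssim>\<^sub>0 coeff p i) \<and> 1 \<lless> eval_at emb t p
      \<longrightarrow> (\<forall>i. 1 \<lless>\<^sub>0 coeff p i))" (is "_ \<longleftrightarrow> _ \<and> ?R")
proof -
  let ?k = "base_residues emb v0 v"
  have unit: "val v t = Val \<one>\<^bsub>vgroup v\<^esub> \<longleftrightarrow> 1 \<doteq> t"
    unfolding L.val_one[symmetric] L.val_eq_iff by (rule L.same_sym)
  have "ring.transcendental (residue_field v) ?k (residue v t) \<longleftrightarrow> ?R" if "1 \<doteq> t"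
  proof
    have t: "1 \<lesssim> t" "residue v t \<in> carrier (residue_field v)"
      using that by (auto simp: L.same_def intro: L.residue_closed)
    assume tr: "ring.transcendental (residue_field v) ?k (residue v t)"
    show ?R
    proof (intro allI impI, elim conjE)
      fix p i assume int: "\<forall>i. 1 \<lesssim>\<^sub>0 coeff p i" and small: "1 \<lless> eval_at emb t p"
      define P where "P = map res (rev (coeffs p))"
      have coeffs: "1 \<lesssim>\<^sub>0 c" if "c \<in> set (coeffs p)" for c
        using that int by (auto simp: coeffs_def split: if_splits)
      then have P: "set P \<subseteq> ?k" unfolding P_def base_residues by auto
      then have P': "set P \<subseteq> carrier (residue_field v)" using base_residues_carrier by blast
      have "L.Res.eval (L.Res.normalize P) (residue v t) = L.Res.eval P (residue v t)"
        by (rule L.Res.eval_normalize[OF P' t(2)])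
      also have "\<dots> = residue v (eval_at emb t p)"
        using eval_residue[OF t(1), of "rev (coeffs p)"] coeffs by (simp add: P_def)
      also have "\<dots> = \<zero>\<^bsub>residue_field v\<^esub>"
        using small by (simp add: L.residue_eq_zero_iff)
      finally have "L.Res.normalize P = []"
        using L.Res.eval_transcendental[of ?k "residue v t" "L.Res.normalize P"] tr
          L.Res.normalize_gives_polynomial[OF P] by (simp add: over_def univ_poly_carrier)
      then have "h = \<zero>\<^bsub>residue_field v\<^esub>" if "h \<in> set P" for h
        using that by (induction P) (auto split: if_splits)
      then have "1 \<lless>\<^sub>0 c" if "c \<in> set (coeffs p)" for c
        using that L.residue_eq_zero_iff[of "emb c"] unfolding P_def by simp
      moreover have "coeff p i \<in> set (coeffs p)" if "coeff p i \<noteq> 0"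
        using that le_degree[OF that] nth_mem[of i "coeffs p"] coeffs_nth[of p i]
        by (cases "p = 0") (auto simp: length_coeffs_degree)
      ultimately show "1 \<lless>\<^sub>0 coeff p i"
        by (cases "coeff p i = 0") (auto simp: K.zero_le_iff)
    qed
  next
    have t: "1 \<lesssim> t" "residue v t \<in> carrier (residue_field v)"
      using that by (auto simp: L.same_def intro: L.residue_closed)
    assume R: ?R
    have "P = []" if P: "P \<in> carrier (?k [X]\<^bsub>residue_field v\<^esub>)"
      and zero: "L.Res.eval P (residue v t) = \<zero>\<^bsub>residue_field v\<^esub>" for P
    proof (rule ccontr)
      assume "P \<noteq> []"
      then have "set P \<subseteq> res ` {c. 1 \<lesssim>\<^sub>0 c}" and hd: "hd P \<noteq> \<zero>\<^bsub>residue_field v\<^esub>"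
        using P unfolding univ_poly_carrier[symmetric] polynomial_def base_residues by auto
      then have "P \<in> map res ` lists {c. 1 \<lesssim>\<^sub>0 c}"
        by (auto simp flip: lists_image)
      then obtain cs where cs: "P = map res cs" "set cs \<subseteq> {c. 1 \<lesssim>\<^sub>0 c}"
        by auto
      have int: "1 \<lesssim>\<^sub>0 coeff (Poly (rev cs)) i" for i
      proof (cases "i < length (rev cs)")
        case True
        then have "coeff (Poly (rev cs)) i \<in> set cs"
          by (metis coeff_Poly_eq nth_default_nth nth_mem set_rev)
        then show ?thesis using cs by auto
      qed (simp add: nth_default_beyond)
      have "residue v (eval_at emb t (Poly (rev cs))) = \<zero>\<^bsub>residue_field v\<^esub>"
        using eval_residue[OF t(1), of cs] cs zero by auto
      then have "1 \<lless> eval_at emb t (Poly (rev cs))"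
        by (simp add: L.residue_eq_zero_iff)
      then have "1 \<lless>\<^sub>0 coeff (Poly (rev cs)) (length cs - 1)"
        using R int by blast
      moreover have "coeff (Poly (rev cs)) (length cs - 1) = hd cs"
        using \<open>P \<noteq> []\<close> cs by (cases cs) (auto simp: nth_default_append)
      ultimately have "hd P = \<zero>\<^bsub>residue_field v\<^esub>"
        using \<open>P \<noteq> []\<close> cs L.residue_eq_zero_iff[of "emb (hd cs)"] by (simp add: hd_map)
      then show False using hd by simp
    qed
    then have "a_kernel (?k [X]\<^bsub>residue_field v\<^esub>) (residue_field v)
        (\<lambda>p. L.Res.eval p (residue v t)) = {[]}"
      unfolding a_kernel_def' by (auto simp: univ_poly_zero_closed)
    then show "ring.transcendental (residue_field v) ?k (residue v t)"
      using L.Res.trivial_ker_imp_transcendental[OF base_residues_subring t(2)]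
      by (simp add: over_def)
  qed
  then show ?thesis
    unfolding residue_transcendental_def unit by blast
qed

text \<open>The substitution of \<open>X + e\<close> for \<open>X\<close> permutes the polynomials with integral coefficients, and also
  those with coefficients of positive value.\<close>

lemma residue_transcendental_shift:
  assumes "residue_transcendental emb v0 v u" "1 \<lesssim>\<^sub>0 e" "1 \<doteq> u + emb e"
  shows "residue_transcendental emb v0 v (u + emb e)"
  unfolding residue_transcendental_iff
proof (intro conjI allI impI)
  fix p i
  assume "(\<forall>i. 1 \<lesssim>\<^sub>0 coeff p i) \<and> 1 \<lless> eval_at emb (u + emb e) p"
  then have int: "\<forall>i. 1 \<lesssim>\<^sub>0 coeff p i" and small: "1 \<lless> eval_at emb (u + emb e) p"
    by auto
  define q where "q = pcompose p [:e, 1:]"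
  have "eval_at emb u q = eval_at emb (u + emb e) p"
    by (simp add: q_def eval_at_pcompose add.commute)
  moreover have "1 \<lesssim>\<^sub>0 coeff q i" for i
    unfolding q_def using int assms(2) K.mult_mono[of 1 e 1]
    by (intro coeff_pcompose_closed[of "\<lambda>c. 1 \<lesssim>\<^sub>0 c"]) (auto intro: K.add)
  ultimately have q: "1 \<lless>\<^sub>0 coeff q i" for i
    using assms(1) small unfolding residue_transcendental_iff by metis
  have "1 \<lless>\<^sub>0 coeff (pcompose q [:- e, 1:]) i"
    using q assms(2) K.mult_less_mono[of _ 1 1 e] K.add_less
    by (intro coeff_pcompose_closed[of "\<lambda>c. 1 \<lless>\<^sub>0 c"])
      (auto simp: K.zero_le_iff K.uminus_le mult.commute[of e] K.mult_le_cancel_right)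
  then show "1 \<lless>\<^sub>0 coeff p i"
    by (simp add: q_def pcompose_shift_cancel)
qed (rule assms(3))

text \<open>The field generated by the residue of \<open>t\<close> is all of the residue field, and an element of a field
  is algebraic over it.\<close>

lemma residue_transcendental_extensionI:
  assumes t: "residue_transcendental emb v0 v t"
    and gen: "\<And>y. 1 \<lesssim> y \<Longrightarrow>
      residue v y \<in> generate_field (residue_field v) (insert (residue v t) (base_residues emb v0 v))"
  shows "residue_transcendental_extension emb v0 v"
proof -
  let ?k = "base_residues emb v0 v" and ?t = "residue v t"
  have tc: "?t \<in> carrier (residue_field v)"
    using t unfolding residue_transcendental_iff by (auto simp: L.same_def intro: L.residue_closed)
  have "subfield (generate_field (residue_field v) (insert ?t ?k)) (residue_field v)"
    using tc base_residues_carrier by (intro L.Res.generate_field_is_subfield) simp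
  then have "ring.algebraic (residue_field v) (generate_field (residue_field v) (?k \<union> {?t})) y"
    if "y \<in> carrier (residue_field v)" for y
    using L.Res.algebraic_self[of "generate_field (residue_field v) (insert ?t ?k)" y] gen that
    by (auto simp: over_def L.carrier_residue_field L.carrier_valuation_ring subfieldE(1))
  then have "transcendence_basis (residue_field v) ?k {?t}"
    unfolding transcendence_basis_def algebraically_independent_def
    using t tc by (simp add: generate_field_base_residues residue_transcendental_def)
  then show ?thesis
    unfolding residue_transcendental_extension_def has_transcendence_degree_def
    by (intro exI[of _ "{?t}"]) simp
qed

lemma not_residue_transcendental_extensionI:
  assumes "carrier (residue_field v) = base_residues emb v0 v"
  shows "\<not> residue_transcendental_extension emb v0 v"
proof
  assume "residue_transcendental_extension emb v0 v"
  then obtain S where S: "transcendence_basis (residue_field v) (base_residues emb v0 v) S" "card S = 1"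
    unfolding residue_transcendental_extension_def has_transcendence_degree_def by blast
  then obtain s where s: "S = {s}" by (auto simp: card_1_singleton_iff)
  have "s \<in> base_residues emb v0 v"
    and "ring.transcendental (residue_field v) (base_residues emb v0 v) s"
    using S s assms unfolding transcendence_basis_def algebraically_independent_def
    by (auto simp: generate_field_base_residues)
  then show False
    using L.Res.algebraic_self[OF base_residues_subring] by (simp add: over_def)
qed

end

text \<open>Any two powers of the generator satisfy a nontrivial relation.\<close>

lemma has_rational_rank_one:
  assumes "comm_group Q" and s: "s \<in> carrier Q"
    and gen: "\<And>y. y \<in> carrier Q \<Longrightarrow> \<exists>n::int. y = s [^]\<^bsub>Q\<^esub> n"
    and free: "\<And>n::int. s [^]\<^bsub>Q\<^esub> n = \<one>\<^bsub>Q\<^esub> \<Longrightarrow> n = 0"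
  shows "has_rational_rank Q 1"
proof -
  interpret Q: comm_group Q by fact
  have "rationally_independent Q {s}"
    unfolding rationally_independent_def
  proof (intro conjI allI impI ballI)
    fix F and n :: "'a \<Rightarrow> int" and u
    assume "finite F \<and> F \<subseteq> {s} \<and> finprod Q (\<lambda>s. s [^]\<^bsub>Q\<^esub> n s) F = \<one>\<^bsub>Q\<^esub>" "u \<in> F"
    moreover from this have "F = {s}" "u = s" by auto
    ultimately show "n u = 0" using s free by simp
  qed (use s in auto)
  moreover have "finite S \<and> card S \<le> 1" if S: "rationally_independent Q S" for S
  proof -
    have "y = z" if yz: "y \<in> S" "z \<in> S" for y z
    proof (rule ccontr)
      assume "y \<noteq> z"
      have carr: "y \<in> carrier Q" "z \<in> carrier Q"
        using S yz by (auto simp: rationally_independent_def)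
      then obtain m n :: int where mn: "y = s [^]\<^bsub>Q\<^esub> m" "z = s [^]\<^bsub>Q\<^esub> n"
        using gen by metis
      \<comment> \<open>Since \<open>y\<close> is the power \<open>m\<close> and \<open>z\<close> is the power \<open>n\<close> of \<open>s\<close>, the power \<open>n\<close> of \<open>y\<close> is the
        power \<open>m\<close> of \<open>z\<close>.\<close>
      define e where "e u = (if u = y then n else - m)" for u
      have "finprod Q (\<lambda>u. u [^]\<^bsub>Q\<^esub> e u) {y, z} = y [^]\<^bsub>Q\<^esub> n \<otimes>\<^bsub>Q\<^esub> z [^]\<^bsub>Q\<^esub> (- m)"
        using \<open>y \<noteq> z\<close> carr by (subst Q.finprod_insert) (auto simp: e_def)
      also have "\<dots> = \<one>\<^bsub>Q\<^esub>"
        using s by (simp add: mn Q.int_pow_pow Q.int_pow_mult[symmetric] algebra_simps)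
      finally have "\<forall>u\<in>{y, z}. e u = 0"
        using S yz unfolding rationally_independent_def
        by (elim conjE allE[of _ "{y, z}"] allE[of _ e]) simp
      then have "e y = 0" "e z = 0" by auto
      then have "y = \<one>\<^bsub>Q\<^esub>" "z = \<one>\<^bsub>Q\<^esub>"
        using \<open>y \<noteq> z\<close> mn by (auto simp: e_def)
      then show False using \<open>y \<noteq> z\<close> by simp
    qed
    then have "S \<subseteq> {u}" if "u \<in> S" for u using that by blast
    then show ?thesis
      using card_mono[of "{_}" S] finite_subset[of S "{_}"] by (cases "S = {}") fastforce+
  qed
  ultimately show ?thesis
    unfolding has_rational_rank_def by (intro conjI exI[of _ "{s}"]) auto
qed

context valued_extension
begin

subsection \<open>Elements over which the valuation is monomial\<close>

text \<open>The value of \<open>p(t)\<close> is never less than the least value of its terms. Here it is not greater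
  either, so that it is this least value.\<close>

definition monomial_at :: "'b \<Rightarrow> bool" where
  "monomial_at t \<longleftrightarrow> (\<forall>p i. eval_at emb t p \<lesssim> emb (coeff p i) * t ^ i)"

lemma monomial_least:
  assumes "monomial_at t" "p \<noteq> 0"
  obtains h where "coeff p h \<noteq> 0" "eval_at emb t p \<doteq> emb (coeff p h) * t ^ h"
    "\<And>i. emb (coeff p h) * t ^ h \<lesssim> emb (coeff p i) * t ^ i"
proof -
  let ?f = "\<lambda>i. emb (coeff p i) * t ^ i"
  obtain h where h: "coeff p h \<noteq> 0" and least: "\<And>i. ?f h \<lesssim> ?f i"
    using L.least_term[OF assms(2), of ?f] by auto
  have "?f h \<lesssim> eval_at emb t p"
    unfolding eval_at_sum by (rule L.sum) (rule least)
  then have "eval_at emb t p \<doteq> ?f h"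
    using assms(1) by (simp add: monomial_at_def L.same_def)
  then show thesis by (intro that[of h]) (use h least in simp_all)
qed

lemma monomial_le_iff:
  assumes "monomial_at t" "t \<noteq> 0"
  shows "eval_at emb t p \<lesssim> eval_at emb t q \<longleftrightarrow> q = 0 \<or>
    (\<exists>i. coeff p i \<noteq> 0 \<and>
      (\<forall>j. emb (coeff p i) * t ^ i \<lesssim> emb (coeff q j) * t ^ j))"
proof (cases "q = 0")
  case False
  then obtain k where k: "coeff q k \<noteq> 0" "eval_at emb t q \<doteq> emb (coeff q k) * t ^ k"
    "\<And>i. emb (coeff q k) * t ^ k \<lesssim> emb (coeff q i) * t ^ i"
    using monomial_least[OF assms(1)] by metis
  show ?thesis
  proof (cases "p = 0")
    case True
    have "eval_at emb t q \<noteq> 0"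
      using L.same_imp_zero_iff[OF k(2)] k(1) assms(2) by simp
    then show ?thesis using True False by (simp add: L.zero_le_iff)
  next
    case p: False
    then obtain h where h: "coeff p h \<noteq> 0" "eval_at emb t p \<doteq> emb (coeff p h) * t ^ h"
      "\<And>i. emb (coeff p h) * t ^ h \<lesssim> emb (coeff p i) * t ^ i"
      using monomial_least[OF assms(1)] by metis
    have "eval_at emb t p \<lesssim> eval_at emb t q \<longleftrightarrow>
        emb (coeff p h) * t ^ h \<lesssim> emb (coeff q k) * t ^ k"
      by (simp only: L.same_le_left[OF h(2)] L.same_le_right[OF k(2)])
    then show ?thesis
      using h(1) False L.trans[OF h(3)] L.trans[OF _ k(3)] by blast
  qed
qed simp

text \<open>Equal values of two monomials with \<open>i \<noteq> j\<close> would put \<open>\<bar>i - j\<bar> v(t)\<close> into \<open>v\<^sub>0K\<close>.\<close>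

lemma value_transcendental_monomials_distinct:
  assumes t: "value_transcendental emb v0 v t" and "a \<noteq> 0" "b \<noteq> 0"
    and "emb a * t ^ i \<doteq> emb b * t ^ j"
  shows "i = j"
proof -
  have t0: "t \<noteq> 0" using t by (simp add: value_transcendental_iff)
  have False if "i < j" "a \<noteq> 0" "b \<noteq> 0" and same: "emb a * t ^ i \<doteq> emb b * t ^ j" for a b i j
  proof -
    have "(emb a * t ^ i) / (emb b * t ^ i) \<doteq> (emb b * t ^ j) / (emb b * t ^ i)"
      using same by (intro L.divide_same) auto
    moreover have "(emb a * t ^ i) / (emb b * t ^ i) = emb (a / b)"
      "(emb b * t ^ j) / (emb b * t ^ i) = t ^ (j - i)"
      using that t0 by (auto simp: emb_divide power_diff)
    ultimately show False
      using t \<open>i < j\<close> L.same_sym unfolding value_transcendental_iff by (metis zero_less_diff)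
  qed
  from this[of i j a b] this[of j i b a] show ?thesis
    using assms L.same_sym by (metis linorder_neqE_nat)
qed

lemma value_transcendental_close:
  assumes t: "value_transcendental emb v0 v t" and "p \<noteq> 0"
  obtains h where "coeff p h \<noteq> 0" "eval_at emb t p \<approx> emb (coeff p h) * t ^ h"
    "\<And>i. emb (coeff p h) * t ^ h \<lesssim> emb (coeff p i) * t ^ i"
proof -
  let ?f = "\<lambda>i. emb (coeff p i) * t ^ i"
  obtain h where h: "coeff p h \<noteq> 0" and least: "\<And>i. ?f h \<lesssim> ?f i"
    using L.least_term[OF assms(2), of ?f] by auto
  have nz: "?f h \<noteq> 0"
    using t h by (simp add: value_transcendental_iff)
  have less: "?f h \<lless> ?f i" if "i \<noteq> h" for i
  proof (cases "coeff p i = 0")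
    case False
    then show ?thesis
      using value_transcendental_monomials_distinct[OF t] least[of i] that h
      unfolding L.same_def by blast
  qed (use nz L.zero_le_iff in auto)
  have "h \<le> degree p" using h by (rule le_degree)
  then have "eval_at emb t p \<approx> ?f h"
    unfolding eval_at_sum using nz less by (intro L.close_sum) auto
  then show thesis by (intro that[of h]) (use h least in simp_all)
qed

lemma value_transcendental_monomial:
  assumes "value_transcendental emb v0 v t"
  shows "monomial_at t"
  unfolding monomial_at_def
proof (intro allI)
  fix p i
  show "eval_at emb t p \<lesssim> emb (coeff p i) * t ^ i"
  proof (cases "p = 0")
    case False
    then show ?thesis
      using value_transcendental_close[OF assms] L.close_same L.same_le_left by metis
  qed simp
qed

text \<open>Write \<open>p(t)\<close> as a polynomial in \<open>d t\<close> and divide it by a coefficient of least value. The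
  coefficients are then integral and one of them is a unit, so the value is zero.\<close>

lemma residue_transcendental_monomial:
  assumes u: "residue_transcendental emb v0 v (emb d * t)"
  shows "monomial_at t"
  unfolding monomial_at_def
proof (intro allI)
  fix p i
  have unit: "1 \<doteq> emb d * t" and
    small: "\<And>q i. \<lbrakk>\<And>i. 1 \<lesssim>\<^sub>0 coeff q i; 1 \<lless> eval_at emb (emb d * t) q\<rbrakk>
      \<Longrightarrow> 1 \<lless>\<^sub>0 coeff q i"
    using u unfolding residue_transcendental_iff by blast+
  have d: "d \<noteq> 0" using L.same_imp_zero_iff[OF unit] by auto
  define q where "q = pcompose p [:0, inverse d:]"
  have q: "coeff q i = coeff p i * inverse d ^ i" for i
    by (simp add: q_def coeff_pcompose_linear mult.commute)
  have eval_q: "eval_at emb (emb d * t) q = eval_at emb t p"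
  proof -
    have "emb d * t * emb (inverse d) = emb (d * inverse d) * t" by (simp add: emb_mult mult_ac)
    also have "\<dots> = t" using d by simp
    finally have eq: "emb d * t * emb (inverse d) = t" .
    have "eval_at emb (emb d * t) q = eval_at emb (emb d * t * emb (inverse d)) p"
      by (simp add: q_def eval_at_pcompose)
    then show ?thesis by (simp only: eq)
  qed
  show "eval_at emb t p \<lesssim> emb (coeff p i) * t ^ i"
  proof (cases "p = 0")
    case False
    obtain h where h: "coeff p h \<noteq> 0" and least: "\<And>i. coeff q h \<lesssim>\<^sub>0 coeff q i"
      using K.least_term[OF False, of "coeff q"] by (auto simp: q)
    define a where "a = coeff q h"
    have a: "a \<noteq> 0" using h d by (simp add: a_def q)
    define r where "r = smult (inverse a) q"
    have r: "coeff r i = coeff q i / a" for i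
      by (simp add: r_def divide_inverse mult.commute)
    have "1 \<lesssim>\<^sub>0 coeff r i" for i
      using least[of i] a by (simp add: r K.le_divide_iff a_def)
    moreover have "\<not> 1 \<lless>\<^sub>0 coeff r h"
      using a by (simp add: r a_def)
    ultimately have "eval_at emb (emb d * t) r \<lesssim> 1"
      using small[of r h] by blast
    then have "eval_at emb t p \<lesssim> emb a"
      using a by (simp add: r_def eval_at_smult eval_q emb_inverse divide_inverse[symmetric]
          L.divide_le_iff mult.commute[of "inverse _"])
    also have "emb a \<lesssim> emb (coeff q i)"
      using least by (simp add: a_def)
    finally (L.trans) have "eval_at emb t p \<lesssim> emb (coeff q i)" .
    moreover have "emb (coeff p i) * t ^ i = emb (coeff q i) * (emb d * t) ^ i"
    proof -
      have "coeff p i = coeff q i * d ^ i"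
        using d by (simp add: q field_simps)
      then show ?thesis by (simp add: emb_mult emb_power power_mult_distrib)
    qed
    moreover have "emb (coeff q i) * 1 \<doteq> emb (coeff q i) * (emb d * t) ^ i"
      using L.power_same[OF unit, of i] by (intro L.mult_same) auto
    ultimately show ?thesis
      using L.same_le_right by simp
  qed simp
qed

end

locale rational_extension = valued_extension emb v0 v
  for emb :: "'a::field \<Rightarrow> 'b::field" and v0 :: "('a, 'g) krull" and v :: "('b, 'h) krull" +
  fixes t :: 'b
  assumes gen: "simple_transcendental emb t"
begin

lemma eval_at_eq_zero_iff [simp]: "eval_at emb t p = 0 \<longleftrightarrow> p = 0"
  using gen by (auto simp: simple_transcendental_def)

lemma t_nonzero: "t \<noteq> 0"
  using eval_at_eq_zero_iff[of "[:0, 1:]"] by auto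

lemma quotientE:
  obtains p q where "q \<noteq> 0" "y = eval_at emb t p / eval_at emb t q"
  using gen unfolding simple_transcendental_def by blast

lemma quotient_nonzeroE:
  assumes "y \<noteq> 0"
  obtains p q where "p \<noteq> 0" "q \<noteq> 0" "y = eval_at emb t p / eval_at emb t q"
proof -
  obtain p q where "q \<noteq> 0" "y = eval_at emb t p / eval_at emb t q" by (rule quotientE)
  moreover from this have "p \<noteq> 0" using assms by auto
  ultimately show thesis by (intro that)
qed

subsection \<open>Value-transcendental generators\<close>

lemma value_transcendental_quotient:
  assumes t: "value_transcendental emb v0 v t" and "y \<noteq> 0"
  obtains c i j where "c \<noteq> 0" "y \<approx> emb c * t ^ i / t ^ j"
proof -
  obtain p q where pq: "p \<noteq> 0" "q \<noteq> 0" "y = eval_at emb t p / eval_at emb t q"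
    using quotient_nonzeroE[OF \<open>y \<noteq> 0\<close>] .
  obtain i where i: "coeff p i \<noteq> 0" "eval_at emb t p \<approx> emb (coeff p i) * t ^ i"
    using value_transcendental_close[OF t pq(1)] by blast
  obtain j where j: "coeff q j \<noteq> 0" "eval_at emb t q \<approx> emb (coeff q j) * t ^ j"
    using value_transcendental_close[OF t pq(2)] by blast
  have "y \<approx> emb (coeff p i / coeff q j) * t ^ i / t ^ j"
    using L.close_divide[OF i(2) j(2)] by (simp add: pq(3) emb_divide)
  then show thesis using that i(1) j(1) by (metis divide_eq_0_iff)
qed

text \<open>A unit has the leading term \<open>c t\<^sup>i / t\<^sup>j\<close> for some \<open>c \<in> K\<close>, and here \<open>i = j\<close> because its value is zero.\<close>

lemma value_transcendental_base_residues:
  assumes t: "value_transcendental emb v0 v t"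
  shows "carrier (residue_field v) = base_residues emb v0 v"
proof (rule base_residues_eq_carrierI)
  fix y assume unit: "1 \<doteq> y"
  then have "y \<noteq> 0" using L.same_imp_zero_iff by force
  then obtain c i j where c: "c \<noteq> 0" "y \<approx> emb c * t ^ i / t ^ j"
    using value_transcendental_quotient[OF t] by blast
  have "1 \<doteq> emb c * t ^ i / t ^ j"
    using L.same_trans[OF unit L.close_same[OF c(2)]] .
  then have "1 * t ^ j \<doteq> emb c * t ^ i / t ^ j * t ^ j"
    by (intro L.mult_same) auto
  then have "emb 1 * t ^ j \<doteq> emb c * t ^ i"
    using t_nonzero by simp
  then have "j = i"
    using value_transcendental_monomials_distinct[OF t one_neq_zero c(1)] by blast
  then show "\<exists>c. y \<approx> emb c" using c t_nonzero by auto
qed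

lemma base_values_subgroup: "subgroup (base_values emb v0 v) (vgroup v)"
proof (rule L.G.subgroupI)
  show "base_values emb v0 v \<subseteq> carrier (vgroup v)"
    unfolding base_values using L.carrier_iff by blast
  have "\<one>\<^bsub>vgroup v\<^esub> \<in> base_values emb v0 v"
    unfolding base_values using L.val_one by (auto intro: exI[of _ 1])
  then show "base_values emb v0 v \<noteq> {}" by blast
next
  fix \<gamma> assume "\<gamma> \<in> base_values emb v0 v"
  then obtain c where "val v (emb c) = Val \<gamma>" unfolding base_values by blast
  then have "val v (emb (inverse c)) = Val (inv\<^bsub>vgroup v\<^esub> \<gamma>)"
    using L.val_inverse by (simp add: emb_inverse)
  then show "inv\<^bsub>vgroup v\<^esub> \<gamma> \<in> base_values emb v0 v" unfolding base_values by blast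
next
  fix \<gamma> \<delta> assume "\<gamma> \<in> base_values emb v0 v" "\<delta> \<in> base_values emb v0 v"
  then obtain c d where "val v (emb c) = Val \<gamma>" "val v (emb d) = Val \<delta>"
    unfolding base_values by blast
  then have "val v (emb (c * d)) = Val (\<gamma> \<otimes>\<^bsub>vgroup v\<^esub> \<delta>)"
    by (simp add: emb_mult L.val_mult)
  then show "\<gamma> \<otimes>\<^bsub>vgroup v\<^esub> \<delta> \<in> base_values emb v0 v" unfolding base_values by blast
qed

lemma not_value_transcendental_extensionI:
  assumes "carrier (vgroup v) = base_values emb v0 v"
  shows "\<not> value_transcendental_extension emb v0 v"
proof
  let ?B = "base_values emb v0 v" and ?Q = "vgroup v Mod base_values emb v0 v"
  interpret Q: comm_group ?Q
    by (rule L.G.abelian_FactGroup[OF base_values_subgroup])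
  assume "value_transcendental_extension emb v0 v"
  then obtain S where S: "rationally_independent ?Q S" "card S = 1"
    unfolding value_transcendental_extension_def has_rational_rank_def by blast
  then obtain s where s: "S = {s}" by (auto simp: card_1_singleton_iff)
  have "s \<in> carrier ?Q" using S(1) s by (simp add: rationally_independent_def)
  then obtain \<gamma> where "\<gamma> \<in> carrier (vgroup v)" "s = ?B #>\<^bsub>vgroup v\<^esub> \<gamma>"
    by (auto simp: FactGroup_def RCOSETS_def)
  then have "s = \<one>\<^bsub>?Q\<^esub>"
    using L.G.coset_join2[OF _ base_values_subgroup] assms by (simp add: FactGroup_def)
  then have "finprod ?Q (\<lambda>s. s [^]\<^bsub>?Q\<^esub> (1 :: int)) {s} = \<one>\<^bsub>?Q\<^esub>"
    by (simp del: one_FactGroup mult_FactGroup)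
  then have "(1 :: int) = 0"
    using S(1)[unfolded rationally_independent_def, THEN conjunct2, rule_format,
        of "{s}" "\<lambda>_. 1" s] s by blast
  then show False by simp
qed

text \<open>By the leading terms of quotients, the class of \<open>v(t)\<close> generates the value group modulo \<open>v\<^sub>0K\<close>;
  it has infinite order because no nonzero multiple of \<open>v(t)\<close> lies in \<open>v\<^sub>0K\<close>.\<close>

lemma value_transcendental_extensionI:
  assumes t: "value_transcendental emb v0 v t"
  shows "value_transcendental_extension emb v0 v"
proof -
  let ?G = "vgroup v"
  let ?B = "base_values emb v0 v"
  let ?Q = "?G Mod ?B"
  interpret Q: comm_group ?Q
    by (rule L.G.abelian_FactGroup[OF base_values_subgroup])
  interpret B: normal ?B ?G
    using base_values_subgroup by (simp add: L.G.normal_iff_subgroup)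
  obtain \<tau> where \<tau>: "val v t = Val \<tau>" "\<tau> \<in> carrier ?G"
    by (cases rule: L.val_cases[of t]) (use t_nonzero in auto)
  define s where "s = ?B #>\<^bsub>?G\<^esub> \<tau>"
  have hom: "(#>\<^bsub>?G\<^esub>) ?B \<in> hom ?G ?Q" by (rule B.r_coset_hom_Mod)
  have s: "s \<in> carrier ?Q" unfolding s_def using hom \<tau> by (auto simp: hom_def)
  have pow: "?B #>\<^bsub>?G\<^esub> (\<tau> [^]\<^bsub>?G\<^esub> n) = s [^]\<^bsub>?Q\<^esub> n" for n :: int
    unfolding s_def by (rule hom_int_pow[OF hom \<tau>(2) L.G.is_group Q.is_group])
  have gen: "\<exists>n::int. Y = s [^]\<^bsub>?Q\<^esub> n" if Y: "Y \<in> carrier ?Q" for Y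
  proof -
    obtain \<gamma> where \<gamma>: "\<gamma> \<in> carrier ?G" "Y = ?B #>\<^bsub>?G\<^esub> \<gamma>"
      using Y by (auto simp: FactGroup_def RCOSETS_def)
    obtain y where y: "val v y = Val \<gamma>" using \<gamma> L.carrier_iff by blast
    then have "y \<noteq> 0" by auto
    then obtain c i j where c: "c \<noteq> 0" "y \<approx> emb c * t ^ i / t ^ j"
      using value_transcendental_quotient[OF t] by blast
    obtain \<beta> where \<beta>: "val v (emb c) = Val \<beta>"
      by (cases rule: L.val_cases[of "emb c"]) (use c(1) in auto)
    have "val v y = val v (emb c * (t ^ i * inverse (t ^ j)))"
      using L.close_same[OF c(2)] by (simp add: L.val_eq_iff divide_inverse mult.assoc)
    also have "\<dots> = Val (\<beta> \<otimes>\<^bsub>?G\<^esub> (\<tau> [^]\<^bsub>?G\<^esub> i \<otimes>\<^bsub>?G\<^esub> inv\<^bsub>?G\<^esub> (\<tau> [^]\<^bsub>?G\<^esub> j)))"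
      using L.val_power[OF \<tau>(1)] \<beta> L.val_inverse[OF L.val_power[OF \<tau>(1)]] by (simp add: L.val_mult)
    also have "\<tau> [^]\<^bsub>?G\<^esub> i \<otimes>\<^bsub>?G\<^esub> inv\<^bsub>?G\<^esub> (\<tau> [^]\<^bsub>?G\<^esub> j) = \<tau> [^]\<^bsub>?G\<^esub> (int i - int j)"
      using \<tau>(2) by (simp add: L.G.int_pow_diff int_pow_int)
    finally have "\<gamma> = \<beta> \<otimes>\<^bsub>?G\<^esub> \<tau> [^]\<^bsub>?G\<^esub> (int i - int j)" using y by simp
    moreover have "\<beta> \<in> ?B" using \<beta> unfolding base_values by blast
    ultimately have "\<gamma> \<in> ?B #>\<^bsub>?G\<^esub> (\<tau> [^]\<^bsub>?G\<^esub> (int i - int j))"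
      by (auto simp: r_coset_def)
    then have "Y = ?B #>\<^bsub>?G\<^esub> (\<tau> [^]\<^bsub>?G\<^esub> (int i - int j))"
      using L.G.repr_independence[OF _ _ base_values_subgroup] \<gamma>(2) \<tau>(2) by simp
    then show ?thesis using pow by blast
  qed
  have free: "n = 0" if n: "s [^]\<^bsub>?Q\<^esub> n = \<one>\<^bsub>?Q\<^esub>" for n :: int
  proof (rule ccontr)
    assume "n \<noteq> 0"
    have "?B #>\<^bsub>?G\<^esub> (\<tau> [^]\<^bsub>?G\<^esub> n) = ?B"
      using n unfolding pow by (simp add: FactGroup_def)
    then have "\<tau> [^]\<^bsub>?G\<^esub> n \<in> ?B"
      by (rule L.G.coset_join1[OF _ _ base_values_subgroup]) (use \<tau>(2) in simp)
    then have "\<tau> [^]\<^bsub>?G\<^esub> \<bar>n\<bar> \<in> ?B"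
      using B.m_inv_closed[of "\<tau> [^]\<^bsub>?G\<^esub> n"] \<tau>(2) L.G.int_pow_neg[of \<tau> n]
      by (cases "n \<ge> 0") simp_all
    then have "\<tau> [^]\<^bsub>?G\<^esub> (nat \<bar>n\<bar>) \<in> ?B"
      using int_pow_int[of "vgroup v" \<tau> "nat \<bar>n\<bar>"] by simp
    moreover have "nat \<bar>n\<bar> > 0" using \<open>n \<noteq> 0\<close> by simp
    moreover have "\<not> (\<exists>n::nat. n > 0 \<and> \<tau> [^]\<^bsub>?G\<^esub> n \<in> ?B)"
      using t \<tau>(1) by (auto simp: value_transcendental_def)
    ultimately show False by blast
  qed
  show ?thesis
    unfolding value_transcendental_extension_def
    by (rule has_rational_rank_one[OF Q.comm_group_axioms s gen free])
qed

subsection \<open>Residue-transcendental generators\<close>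

lemma residue_transcendental_base_values:
  assumes u: "residue_transcendental emb v0 v t"
  shows "carrier (vgroup v) = base_values emb v0 v"
  unfolding base_values_eq_carrier_iff
proof
  have unit: "1 \<doteq> t" using u by (simp add: residue_transcendental_iff)
  have mono: "monomial_at t" using residue_transcendental_monomial[of 1 t] u by simp
  have poly: "\<exists>c. eval_at emb t p \<doteq> emb c" for p
  proof (cases "p = 0")
    case True
    then show ?thesis by (intro exI[of _ 0]) simp
  next
    case False
    then obtain h where "eval_at emb t p \<doteq> emb (coeff p h) * t ^ h"
      using monomial_least[OF mono] by metis
    moreover have "emb (coeff p h) * t ^ h \<doteq> emb (coeff p h) * 1"
      using L.power_same[OF unit, of h] by (intro L.mult_same) (auto simp: L.same_sym)
    ultimately have "eval_at emb t p \<doteq> emb (coeff p h)"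
      using L.same_trans by simp
    then show ?thesis by blast
  qed
  fix y
  obtain p q where "q \<noteq> 0" "y = eval_at emb t p / eval_at emb t q" by (rule quotientE)
  moreover obtain c d where "eval_at emb t p \<doteq> emb c" "eval_at emb t q \<doteq> emb d"
    using poly by blast
  ultimately have "y \<doteq> emb (c / d)"
    unfolding emb_divide using L.divide_same by simp
  then show "\<exists>c. y \<doteq> emb c" by blast
qed

lemma residue_eval_generated:
  assumes "1 \<lesssim> t" "\<And>i. 1 \<lesssim>\<^sub>0 coeff p i"
  shows "residue v (eval_at emb t p) \<in>
    generate_field (residue_field v) (insert (residue v t) (base_residues emb v0 v))"
  using assms(2)
proof (induction p)
  case 0
  have "residue v (emb 0) \<in> base_residues emb v0 v"
    unfolding base_residues using K.le_zero by blast
  then show ?case by (intro generate_field.incl) simp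
next
  case (pCons a p)
  have a: "1 \<lesssim>\<^sub>0 a" and p: "\<And>i. 1 \<lesssim>\<^sub>0 coeff p i"
    using pCons.prems[of 0] pCons.prems[of "Suc i" for i] by simp_all
  have "1 \<lesssim> t * eval_at emb t p"
    using L.mult_mono[of 1 t 1] assms(1) eval_at_integral[OF assms(1) p] by simp
  then have "residue v (eval_at emb t (pCons a p)) =
      res a \<oplus>\<^bsub>residue_field v\<^esub> residue v t \<otimes>\<^bsub>residue_field v\<^esub> residue v (eval_at emb t p)"
    using a assms(1) eval_at_integral[OF assms(1) p] by (simp add: L.residue_add L.residue_mult)
  moreover have "res a \<in> base_residues emb v0 v"
    using a unfolding base_residues by blast
  ultimately show ?case
    using pCons.IH[OF p] by (simp only: generate_field.intros insertI1 insertI2)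
qed

lemma integral_associate:
  assumes t: "residue_transcendental emb v0 v t" and "p \<noteq> 0"
  obtains a p' where "a \<noteq> 0" "p = smult a p'" "\<And>i. 1 \<lesssim>\<^sub>0 coeff p' i"
    "1 \<doteq> eval_at emb t p'"
proof -
  have unit: "1 \<doteq> t" using t by (simp add: residue_transcendental_iff)
  obtain h where h: "coeff p h \<noteq> 0" and least: "\<And>i. coeff p h \<lesssim>\<^sub>0 coeff p i"
    using K.least_term[OF assms(2), of "coeff p"] by auto
  define a where "a = coeff p h"
  define p' where "p' = smult (inverse a) p"
  have a: "a \<noteq> 0" using h by (simp add: a_def)
  have int: "1 \<lesssim>\<^sub>0 coeff p' i" for i
    using least[of i] K.le_divide_iff[OF a, of 1 "coeff p i"]
    by (simp add: p'_def a_def divide_inverse mult.commute)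
  have "\<not> 1 \<lless>\<^sub>0 coeff p' h" using a by (simp add: p'_def a_def)
  then have "eval_at emb t p' \<lesssim> 1"
    using t int unfolding residue_transcendental_iff by blast
  moreover have "1 \<lesssim> eval_at emb t p'"
    using unit int by (intro eval_at_integral) (auto simp: L.same_def)
  ultimately show thesis
    using a int by (intro that[of a p']) (simp_all add: p'_def L.same_def)
qed

text \<open>Divide numerator and denominator of a quotient by coefficients of least value; the residue of
  the quotient is then a rational expression in the residue of \<open>t\<close>.\<close>

lemma residue_transcendental_generates:
  assumes t: "residue_transcendental emb v0 v t"
  shows "residue_transcendental_extension emb v0 v"
proof (rule residue_transcendental_extensionI[OF t])
  let ?F = "generate_field (residue_field v) (insert (residue v t) (base_residues emb v0 v))"
  fix y assume y: "1 \<lesssim> y"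
  have unit: "1 \<doteq> t" using t by (simp add: residue_transcendental_iff)
  show "residue v y \<in> ?F"
  proof (cases "y = 0")
    case True
    have "residue v (emb 0) \<in> base_residues emb v0 v"
      unfolding base_residues using K.le_zero by blast
    then show ?thesis using True by (intro generate_field.incl) simp
  next
    case False
    then obtain p q where pq: "p \<noteq> 0" "q \<noteq> 0" "y = eval_at emb t p / eval_at emb t q"
      using quotient_nonzeroE by blast
    obtain a p' where p': "a \<noteq> 0" "p = smult a p'" "\<And>i. 1 \<lesssim>\<^sub>0 coeff p' i"
      "1 \<doteq> eval_at emb t p'"
      using integral_associate[OF t pq(1)] by blast
    obtain b q' where q': "b \<noteq> 0" "q = smult b q'" "\<And>i. 1 \<lesssim>\<^sub>0 coeff q' i"
      "1 \<doteq> eval_at emb t q'"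
      using integral_associate[OF t pq(2)] by blast
    let ?p = "eval_at emb t p'" and ?q = "eval_at emb t q'"
    have y_eq: "y = emb (a / b) * (?p * inverse ?q)"
      by (simp add: pq(3) p'(2) q'(2) eval_at_smult divide_inverse emb_mult emb_inverse)
    have frac: "1 \<doteq> ?p * inverse ?q"
      using L.divide_same[OF p'(4) q'(4)] by (simp add: divide_inverse)
    have "y \<doteq> emb (a / b)"
      using L.mult_same[OF L.same_refl[of "emb (a / b)"] frac] by (simp add: y_eq L.same_sym)
    then have ab: "1 \<lesssim>\<^sub>0 a / b" using y L.same_le_right by simp
    have int: "1 \<lesssim> ?p" "1 \<lesssim> inverse ?q" "1 \<lesssim> ?p * inverse ?q" "1 \<lesssim> t"
      using p'(4) frac L.divide_same[OF L.same_refl[of 1] q'(4)] unit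
      by (auto simp: L.same_def inverse_eq_divide)
    have "residue v y = res (a / b) \<otimes>\<^bsub>residue_field v\<^esub>
        (residue v ?p \<otimes>\<^bsub>residue_field v\<^esub> inv\<^bsub>residue_field v\<^esub> residue v ?q)"
      unfolding y_eq using ab int q'(4) by (simp add: L.residue_mult L.residue_inverse)
    moreover have "residue v ?p \<in> ?F" "residue v ?q \<in> ?F"
      by (rule residue_eval_generated[OF int(4)], rule p' q')+
    moreover have "residue v ?q \<noteq> \<zero>\<^bsub>residue_field v\<^esub>"
      using q'(4) by (simp add: L.residue_eq_zero_iff L.same_def)
    moreover have "res (a / b) \<in> ?F"
      using ab unfolding base_residues by (intro generate_field.incl) blast
    ultimately show ?thesis
      by (simp only: generate_field.eng_mult generate_field.m_inv not_False_eq_True)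
  qed
qed

end

section \<open>The approximation type of a generator\<close>

text \<open>Polynomials in \<open>x\<close> and in \<open>d (x - b)\<close> are turned into one another by the two mutually inverse
  affine substitutions.\<close>

lemma (in field_emb) simple_transcendental_affine:
  assumes x: "simple_transcendental emb x" and d: "d \<noteq> 0"
  shows "simple_transcendental emb (emb d * (x - emb b))"
proof -
  let ?u = "emb d * (x - emb b)"
  have to_x: "eval_at emb ?u p = eval_at emb x (pcompose p [:- (d * b), d:])" for p
    by (simp add: eval_at_pcompose emb_uminus emb_mult algebra_simps)
  have x_eq: "eval_at emb ?u [:b, inverse d:] = x"
  proof -
    have "?u * emb (inverse d) = emb (d * inverse d) * (x - emb b)"
      unfolding emb_mult by (simp add: mult_ac)
    also have "\<dots> = x - emb b" using d by simp
    finally have eq: "?u * emb (inverse d) = x - emb b" .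
    have "eval_at emb ?u [:b, inverse d:] = emb b + ?u * emb (inverse d)" by simp
    then show ?thesis by (simp only: eq) simp
  qed
  have of_x: "eval_at emb x p = eval_at emb ?u (pcompose p [:b, inverse d:])" for p
    unfolding eval_at_pcompose x_eq ..
  have cancel: "pcompose (pcompose p [:b, inverse d:]) [:- (d * b), d:] = p"
    and cancel': "pcompose (pcompose p [:- (d * b), d:]) [:b, inverse d:] = p" for p
    using d by (simp_all add: pcompose_assoc[symmetric] pcompose_pCons flip: mult.assoc)
  show ?thesis
    unfolding simple_transcendental_def
  proof (intro conjI allI impI)
    fix p assume "eval_at emb ?u p = 0"
    then have "pcompose p [:- (d * b), d:] = 0"
      using x unfolding to_x simple_transcendental_def by blast
    then show "p = 0" using cancel'[of p] by simp
  next
    fix y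
    obtain p q where pq: "q \<noteq> 0" "y = eval_at emb x p / eval_at emb x q"
      using x unfolding simple_transcendental_def by blast
    moreover have "pcompose q [:b, inverse d:] \<noteq> 0"
      using cancel[of q] pq(1) by auto
    ultimately show "\<exists>p q. q \<noteq> 0 \<and> y = eval_at emb ?u p / eval_at emb ?u q"
      unfolding of_x by blast
  qed (rule field_embedding)
qed

locale transcendental_generator = rational_extension emb v0 v x
  for emb :: "'a::field \<Rightarrow> 'b::field" and v0 :: "('a, 'g) krull" and v :: "('b, 'h) krull"
    and x :: 'b
begin

lemma x_notin: "x \<noteq> emb c"
  using eval_at_eq_zero_iff[of "[:- c, 1:]"] by (auto simp: emb_uminus)

lemma affine_generator:
  "d \<noteq> 0 \<Longrightarrow> transcendental_generator emb v0 v (emb d * (x - emb b))"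
  using simple_transcendental_affine[OF gen] valued_extension_axioms
  by (simp add: transcendental_generator_def rational_extension_def rational_extension_axioms_def)

lemma shift_generator: "transcendental_generator emb v0 v (x - emb b)"
  using affine_generator[of 1 b] by simp

definition nearest :: "'a \<Rightarrow> bool" where
  "nearest b \<longleftrightarrow> (\<forall>c. x - emb c \<lesssim> x - emb b)"

lemma nearest_same: "nearest b \<Longrightarrow> nearest b' \<Longrightarrow> x - emb b \<doteq> x - emb b'"
  by (simp add: nearest_def L.same_def)

text \<open>Hence \<open>v (x - b)\<close> can only lie outside \<open>v\<^sub>0K\<close> if \<open>b\<close> is nearest to \<open>x\<close>.\<close>

lemma closer_same: "x - emb b \<lless> x - emb c \<Longrightarrow> x - emb b \<doteq> emb (b - c)"
proof -
  assume "x - emb b \<lless> x - emb c"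
  then have "x - emb b + - (x - emb c) \<doteq> x - emb b"
    by (intro L.add_dominated) (simp add: L.uminus_le del: minus_diff_eq)
  moreover have "x - emb b + - (x - emb c) = - emb (b - c)"
    by (simp add: emb_diff)
  ultimately show ?thesis
    by (simp add: L.same_def L.uminus_le L.le_uminus)
qed

lemma not_nearestE:
  assumes "\<not> nearest b"
  obtains c where "x - emb b \<lless> x - emb c" "x - emb b \<doteq> emb (b - c)"
  using assms closer_same unfolding nearest_def by blast

text \<open>Thus a radius can be given by an element of \<open>K\<close>; zero gives the radius infinity.\<close>

lemma radii_eq: "radii v0 = range (val v0)"
proof (intro equalityI subsetI)
  fix \<gamma> assume "\<gamma> \<in> radii v0"
  then consider "\<gamma> = val v0 0" | g where "\<gamma> = Val g" "g \<in> carrier (vgroup v0)"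
    unfolding radii_def by auto
  then show "\<gamma> \<in> range (val v0)"
  proof cases
    case (2 g)
    then show ?thesis using K.carrier_iff by (metis rangeI)
  qed blast
next
  fix \<gamma> assume "\<gamma> \<in> range (val v0)"
  then obtain a where "\<gamma> = val v0 a" by blast
  then show "\<gamma> \<in> radii v0"
    by (cases rule: K.val_cases[of a]) (auto simp: radii_def)
qed

lemma closed_mem_appr:
  "ClosedBall \<gamma> S \<in> appr emb v0 v x \<longleftrightarrow>
    (\<exists>a. \<gamma> = val v0 a \<and> S \<noteq> {} \<and> S = {c. emb a \<lesssim> x - emb c})"
  unfolding appr_def radii_eq by (auto simp: val_emb[symmetric] val_le_def)

lemma open_mem_appr:
  "OpenBall g S \<in> appr emb v0 v x \<longleftrightarrow>
    (\<exists>a. val v0 a = Val g \<and> S \<noteq> {} \<and> S = {c. emb a \<lless> x - emb c})"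
proof -
  have eq: "Val (value_incl emb v0 v g) = val v (emb a)" if "val v0 a = Val g" for a
    using that by (simp add: val_emb)
  have iff: "OpenBall g S \<in> appr emb v0 v x \<longleftrightarrow> (\<exists>a. val v0 a = Val g) \<and> S \<noteq> {} \<and>
      S = {c. vless (vgroup v) (Val (value_incl emb v0 v g)) (val v (x - emb c))}"
    unfolding appr_def K.carrier_iff by auto
  have set: "{c. vless (vgroup v) (Val (value_incl emb v0 v g)) (val v (x - emb c))} =
      {c. emb a \<lless> x - emb c}" if "val v0 a = Val g" for a
    unfolding eq[OF that] L.vless_iff ..
  show ?thesis unfolding iff using set by metis
qed

lemma closed_at_appr: "closed_at (appr emb v0 v x) (val v0 a) = {c. emb a \<lesssim> x - emb c}"
proof -
  have same: "{c. emb a' \<lesssim> x - emb c} = {c. emb a \<lesssim> x - emb c}" if "val v0 a = val v0 a'" for a'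
  proof -
    have "emb a \<doteq> emb a'" using that by (simp only: K.val_eq_iff emb_same_iff)
    then show ?thesis by (simp only: L.same_le_left)
  qed
  show ?thesis
  proof (intro equalityI subsetI)
    fix c assume "c \<in> closed_at (appr emb v0 v x) (val v0 a)"
    then show "c \<in> {c. emb a \<lesssim> x - emb c}"
      unfolding closed_at_def closed_mem_appr using same by blast
  next
    fix c assume c: "c \<in> {c. emb a \<lesssim> x - emb c}"
    then have "ClosedBall (val v0 a) {c. emb a \<lesssim> x - emb c} \<in> appr emb v0 v x"
      unfolding closed_mem_appr by blast
    then show "c \<in> closed_at (appr emb v0 v x) (val v0 a)"
      unfolding closed_at_def using c by blast
  qed
qed

lemma open_at_appr: "a \<noteq> 0 \<Longrightarrow> open_at (appr emb v0 v x) (val v0 a) = {c. emb a \<lless> x - emb c}"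
proof -
  assume "a \<noteq> 0"
  then obtain g where g: "val v0 a = Val g" by (cases rule: K.val_cases[of a]) auto
  have same: "{c. emb a' \<lless> x - emb c} = {c. emb a \<lless> x - emb c}" if "val v0 a' = Val g" for a'
  proof -
    have "emb a \<doteq> emb a'" using that g by (simp only: K.val_eq_iff[symmetric] emb_same_iff)
    then show ?thesis by (simp only: L.same_le_right)
  qed
  show ?thesis
  proof (intro equalityI subsetI)
    fix c assume "c \<in> open_at (appr emb v0 v x) (val v0 a)"
    then show "c \<in> {c. emb a \<lless> x - emb c}"
      unfolding open_at_def open_mem_appr g using same by auto
  next
    fix c assume "c \<in> {c. emb a \<lless> x - emb c}"
    then have "OpenBall g {c. emb a \<lless> x - emb c} \<in> appr emb v0 v x"
      unfolding open_mem_appr using g by blast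
    then show "c \<in> open_at (appr emb v0 v x) (val v0 a)"
      unfolding open_at_def g using \<open>c \<in> {c. emb a \<lless> x - emb c}\<close> by blast
  qed
qed

lemma supp_appr: "supp (appr emb v0 v x) = {val v0 a | a. \<exists>c. emb a \<lesssim> x - emb c}"
  unfolding supp_def closed_mem_appr by auto

lemma not_trivial_appr: "\<not> trivial (appr emb v0 v x)"
  unfolding trivial_def supp_appr using K.val_eq_Infty_iff x_notin
  by (auto simp: L.zero_le_iff dest: sym)

lemma supp_appr_nonzero: "emb a \<lesssim> x - emb c \<Longrightarrow> a \<noteq> 0"
  using x_notin by (auto simp: L.zero_le_iff)

text \<open>If \<open>c\<close> is closer to \<open>x\<close> than \<open>b\<close>, then \<open>v (x - b)\<close> lies in \<open>v\<^sub>0K\<close> and is the radius of an open ball which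
  contains \<open>c\<close> but not \<open>b\<close>.\<close>

lemma meet_appr: "meet (appr emb v0 v x) = {b. nearest b}"
proof (intro equalityI subsetI)
  fix b assume b: "b \<in> meet (appr emb v0 v x)"
  show "b \<in> {b. nearest b}"
  proof (rule ccontr)
    assume "b \<notin> {b. nearest b}"
    then obtain c where c: "x - emb b \<lless> x - emb c" "x - emb b \<doteq> emb (b - c)"
      using not_nearestE by blast
    then have "b - c \<noteq> 0"
      using x_notin[of b] L.same_imp_zero_iff[OF c(2)] by auto
    then obtain g where g: "val v0 (b - c) = Val g"
      by (cases rule: K.val_cases[of "b - c"]) auto
    have "c \<in> {c'. emb (b - c) \<lless> x - emb c'}"
      using c L.same_le_right[OF c(2)] by simp
    then have "OpenBall g {c'. emb (b - c) \<lless> x - emb c'} \<in> appr emb v0 v x"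
      unfolding open_mem_appr using g by blast
    then have "b \<in> {c'. emb (b - c) \<lless> x - emb c'}"
      using b unfolding meet_def by (auto dest!: bspec)
    then show False using c(2) by (simp add: L.same_def)
  qed
next
  fix b assume b: "b \<in> {b. nearest b}"
  have "b \<in> points B" if "B \<in> appr emb v0 v x" for B
  proof (cases B)
    case (ClosedBall \<gamma> S)
    then show ?thesis
      using that b L.trans by (auto simp: closed_mem_appr nearest_def)
  next
    case (OpenBall g S)
    then show ?thesis
      using that b L.trans by (auto simp: open_mem_appr nearest_def)
  qed
  then show "b \<in> meet (appr emb v0 v x)" by (simp add: meet_def)
qed

lemma immediate_appr_iff: "immediate (appr emb v0 v x) \<longleftrightarrow> (\<forall>b. \<not> nearest b)"
proof -
  have "appr emb v0 v x \<noteq> {}" if "meet (appr emb v0 v x) = {}"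
    using that by (auto simp: meet_def)
  then show ?thesis
    unfolding immediate_def using not_trivial_appr by (auto simp: meet_appr)
qed

text \<open>For nearest \<open>b\<close>, the type contains a closed but no open ball of radius \<open>\<gamma>\<close> exactly if
  \<open>\<gamma> = v (x - b)\<close>.\<close>

lemma value_extending_appr_iff:
  "value_extending (appr emb v0 v x) \<longleftrightarrow> (\<exists>b. nearest b \<and> (\<forall>a. \<not> x - emb b \<doteq> emb a))"
proof
  assume ve: "value_extending (appr emb v0 v x)"
  then obtain b where b: "nearest b"
    unfolding value_extending_def meet_appr by auto
  have "\<not> x - emb b \<doteq> emb a" for a
  proof
    assume same: "x - emb b \<doteq> emb a"
    then have le: "emb a \<lesssim> x - emb b" by (simp add: L.same_def)
    then have "val v0 a \<in> supp (appr emb v0 v x)" unfolding supp_appr by blast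
    then have "open_at (appr emb v0 v x) (val v0 a) \<noteq> {}"
      using ve unfolding value_extending_def by blast
    then obtain c where "emb a \<lless> x - emb c"
      unfolding open_at_appr[OF supp_appr_nonzero[OF le]] by blast
    moreover have "x - emb c \<lesssim> emb a"
      using b same L.same_le_right by (auto simp: nearest_def)
    ultimately show False by simp
  qed
  then show "\<exists>b. nearest b \<and> (\<forall>a. \<not> x - emb b \<doteq> emb a)" using b by blast
next
  assume "\<exists>b. nearest b \<and> (\<forall>a. \<not> x - emb b \<doteq> emb a)"
  then obtain b where b: "nearest b" "\<And>a. \<not> x - emb b \<doteq> emb a" by blast
  have "open_at (appr emb v0 v x) \<gamma> \<noteq> {}" if \<gamma>: "\<gamma> \<in> supp (appr emb v0 v x)" for \<gamma>
  proof -
    obtain a c where a: "\<gamma> = val v0 a" "emb a \<lesssim> x - emb c"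
      using \<gamma> unfolding supp_appr by blast
    then have "emb a \<lesssim> x - emb b" using b(1) L.trans by (auto simp: nearest_def)
    then have "emb a \<lless> x - emb b" using b(2) by (auto simp: L.same_def)
    then show ?thesis
      using a open_at_appr[OF supp_appr_nonzero[OF a(2)]] by auto
  qed
  then show "value_extending (appr emb v0 v x)"
    unfolding value_extending_def meet_appr using b(1) not_trivial_appr by blast
qed

text \<open>An element \<open>c\<close> lies in the closed but not in the open ball of radius \<open>\<gamma>\<close> exactly if
  \<open>\<gamma> = v (x - c)\<close>. If \<open>c\<close> is not nearest, this value lies in \<open>v\<^sub>0K\<close> in any case.\<close>

lemma residue_extending_appr_iff:
  "residue_extending (appr emb v0 v x) \<longleftrightarrow> (\<exists>b a. nearest b \<and> x - emb b \<doteq> emb a)"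
proof
  assume re: "residue_extending (appr emb v0 v x)"
  then obtain b where b: "nearest b"
    unfolding residue_extending_def meet_appr by auto
  obtain \<gamma> where \<gamma>: "\<gamma> \<in> supp (appr emb v0 v x)"
    "b \<in> closed_at (appr emb v0 v x) \<gamma> - open_at (appr emb v0 v x) \<gamma>"
    using re unfolding residue_extending_def by blast
  then obtain a where a: "\<gamma> = val v0 a" unfolding supp_appr by blast
  then have le: "emb a \<lesssim> x - emb b" using \<gamma> by (auto simp: closed_at_appr)
  then have "x - emb b \<doteq> emb a"
    using \<gamma> a open_at_appr[OF supp_appr_nonzero[OF le]] by (auto simp: L.same_def)
  then show "\<exists>b a. nearest b \<and> x - emb b \<doteq> emb a" using b by blast
next
  assume "\<exists>b a. nearest b \<and> x - emb b \<doteq> emb a"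
  then obtain b a where b: "nearest b" "x - emb b \<doteq> emb a" by blast
  have "\<exists>\<gamma>\<in>supp (appr emb v0 v x).
      c \<in> closed_at (appr emb v0 v x) \<gamma> - open_at (appr emb v0 v x) \<gamma>" for c
  proof -
    obtain e where e: "x - emb c \<doteq> emb e"
    proof (cases "x - emb c \<lless> x - emb b")
      case True
      then show ?thesis using that closer_same by blast
    next
      case False
      then have "x - emb c \<doteq> x - emb b" using b(1) by (simp add: L.same_def nearest_def)
      then show ?thesis using that b(2) L.same_trans by blast
    qed
    then have le: "emb e \<lesssim> x - emb c" "x - emb c \<lesssim> emb e" by (auto simp: L.same_def)
    show ?thesis
    proof (rule bexI[of _ "val v0 e"])
      show "c \<in> closed_at (appr emb v0 v x) (val v0 e) - open_at (appr emb v0 v x) (val v0 e)"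
        using le open_at_appr[OF supp_appr_nonzero[OF le(1)]] by (simp add: closed_at_appr)
      show "val v0 e \<in> supp (appr emb v0 v x)"
        unfolding supp_appr using le by blast
    qed
  qed
  then show "residue_extending (appr emb v0 v x)"
    unfolding residue_extending_def meet_appr using b(1) not_trivial_appr by blast
qed

lemma approximation_type_appr: "approximation_type v0 (appr emb v0 v x)"
proof -
  let ?A = "appr emb v0 v x"
  have closed: "{c. emb a \<lesssim> x - emb c} = {c. a \<lesssim>\<^sub>0 c - b}" if "emb a \<lesssim> x - emb b" for a b
  proof -
    have "emb a \<lesssim> x - emb c \<longleftrightarrow> emb a \<lesssim> emb (c - b)" for c
      using L.diff[OF that, of "x - emb c"] L.diff[OF that, of "emb c - emb b"] by (auto simp: emb_diff)
    then show ?thesis by simp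
  qed
  have opened: "{c. emb a \<lless> x - emb c} = {c. a \<lless>\<^sub>0 c - b}" if "emb a \<lless> x - emb b" for a b
  proof -
    have "emb a \<lless> x - emb c \<longleftrightarrow> emb a \<lless> emb (c - b)" for c
      using L.diff_less[OF that, of "x - emb c"] L.diff_less[OF that, of "emb c - emb b"]
      by (auto simp: emb_diff)
    then show ?thesis by simp
  qed
  have closed_ball: "closed_ball v0 (val v0 a) b = ClosedBall (val v0 a) {c. a \<lesssim>\<^sub>0 c - b}" for a b
    by (simp add: closed_ball_def val_le_def)
  have open_ball: "open_ball v0 g b = OpenBall g {c. a \<lless>\<^sub>0 c - b}" if "val v0 a = Val g" for a b g
    using K.vless_iff[of a] that by (simp add: open_ball_def)
  have closed_iff: "closed_ball v0 (val v0 a) b \<in> ?A \<longleftrightarrow> emb a \<lesssim> x - emb b" for a b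
  proof
    assume "closed_ball v0 (val v0 a) b \<in> ?A"
    then obtain a' where a': "val v0 a = val v0 a'" "{c. a \<lesssim>\<^sub>0 c - b} = {c. emb a' \<lesssim> x - emb c}"
      unfolding closed_ball closed_mem_appr by blast
    have "b \<in> {c. a \<lesssim>\<^sub>0 c - b}" by simp
    then show "emb a \<lesssim> x - emb b"
      using a' L.same_le_left[of "emb a" "emb a'"] by (simp add: K.val_eq_iff emb_same_iff)
  next
    assume le: "emb a \<lesssim> x - emb b"
    then show "closed_ball v0 (val v0 a) b \<in> ?A"
      unfolding closed_ball closed_mem_appr closed[OF le, symmetric] by blast
  qed
  have open_iff: "open_ball v0 g b \<in> ?A \<longleftrightarrow> emb a \<lless> x - emb b" if g: "val v0 a = Val g" for a b g
  proof
    assume "open_ball v0 g b \<in> ?A"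
    then obtain a' where a': "val v0 a' = Val g" "{c. a \<lless>\<^sub>0 c - b} = {c. emb a' \<lless> x - emb c}"
      unfolding open_ball[OF g] open_mem_appr by blast
    have "a \<noteq> 0" using g by auto
    then have "b \<in> {c. a \<lless>\<^sub>0 c - b}" by (simp add: K.zero_le_iff)
    moreover have "K.same a a'" using g a'(1) by (simp add: K.val_eq_iff[symmetric])
    ultimately show "emb a \<lless> x - emb b"
      using a'(2) L.same_le_right[of "emb a" "emb a'"] by (simp add: emb_same_iff)
  next
    assume less: "emb a \<lless> x - emb b"
    then show "open_ball v0 g b \<in> ?A"
      unfolding open_ball[OF g] open_mem_appr opened[OF less, symmetric] using g by blast
  qed
  have balls: "?A \<subseteq> balls v0"
  proof
    fix B assume B: "B \<in> ?A"
    show "B \<in> balls v0"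
    proof (cases B)
      case (ClosedBall \<gamma> S)
      then obtain a where a: "\<gamma> = val v0 a" "S \<noteq> {}" "S = {c. emb a \<lesssim> x - emb c}"
        using B by (auto simp: closed_mem_appr)
      then obtain b where "emb a \<lesssim> x - emb b" by blast
      then have "B = closed_ball v0 \<gamma> b"
        using ClosedBall a closed closed_ball by simp
      then show ?thesis using a(1) unfolding balls_def radii_eq by blast
    next
      case (OpenBall g S)
      then obtain a where a: "val v0 a = Val g" "S \<noteq> {}" "S = {c. emb a \<lless> x - emb c}"
        using B by (auto simp: open_mem_appr)
      then obtain b where "emb a \<lless> x - emb b" by blast
      then have "B = open_ball v0 g b"
        using OpenBall a opened open_ball by simp
      then show ?thesis using a(1) unfolding balls_def K.carrier_iff by blast
    qed
  qed
  have ball_le: "\<exists>P. points B = {c. P (x - emb c)} \<and> (\<forall>y z. P y \<longrightarrow> y \<lesssim> z \<longrightarrow> P z)"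
    if B: "B \<in> ?A" for B
  proof (cases B)
    case (ClosedBall \<gamma> S)
    then obtain a where "S = {c. emb a \<lesssim> x - emb c}"
      using B by (auto simp: closed_mem_appr)
    then show ?thesis using ClosedBall L.trans by (intro exI[of _ "\<lambda>y. emb a \<lesssim> y"]) auto
  next
    case (OpenBall g S)
    then obtain a where "S = {c. emb a \<lless> x - emb c}"
      using B by (auto simp: open_mem_appr)
    then show ?thesis using OpenBall L.trans by (intro exI[of _ "\<lambda>y. emb a \<lless> y"]) auto
  qed
  have chain: "points B \<subseteq> points B' \<or> points B' \<subseteq> points B" if BB': "B \<in> ?A" "B' \<in> ?A" for B B'
  proof -
    obtain P P' where P: "points B = {c. P (x - emb c)}" "\<And>y z. P y \<Longrightarrow> y \<lesssim> z \<Longrightarrow> P z"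
      and P': "points B' = {c. P' (x - emb c)}" "\<And>y z. P' y \<Longrightarrow> y \<lesssim> z \<Longrightarrow> P' z"
      using ball_le[OF BB'(1)] ball_le[OF BB'(2)] by blast
    show ?thesis
      unfolding P(1) P'(1) using P(2) P'(2) L.total by (metis (no_types, lifting) mem_Collect_eq subsetI)
  qed
  have larger: "larger_balls v0 (val v0 a) b \<subseteq> ?A" if le: "emb a \<lesssim> x - emb b" for a b
  proof
    fix B assume "B \<in> larger_balls v0 (val v0 a) b"
    then obtain g where g: "g \<in> carrier (vgroup v0)" "vless (vgroup v0) (Val g) (val v0 a)"
      "B = closed_ball v0 (Val g) b \<or> B = open_ball v0 g b"
      unfolding larger_balls_def by blast
    obtain e where e: "val v0 e = Val g" using g(1) K.carrier_iff by blast
    then have "e \<lless>\<^sub>0 a" using g(2) K.vless_iff[of e a] by simp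
    then have "emb e \<lless> x - emb b" using le L.less_le_trans[of "emb a" "emb e"] by simp
    then show "B \<in> ?A"
      using g(3) closed_iff[of e b] open_iff[OF e, of b] L.less_imp_le[of "x - emb b" "emb e"] e by auto
  qed
  show ?thesis
    unfolding approximation_type_def
  proof (intro conjI ballI allI impI)
    show "?A \<subseteq> balls v0" by (rule balls)
    show "points B \<subseteq> points B' \<or> points B' \<subseteq> points B" if "B \<in> ?A" "B' \<in> ?A" for B B'
      using chain that .
    show "larger_balls v0 \<gamma> c \<subseteq> ?A" if "\<gamma> \<in> radii v0" "closed_ball v0 \<gamma> c \<in> ?A" for \<gamma> c
      using that larger closed_iff by (auto simp: radii_eq)
    fix c g assume g: "g \<in> carrier (vgroup v0)" and "open_ball v0 g c \<in> ?A"
    obtain a where a: "val v0 a = Val g" using g K.carrier_iff by blast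
    then have le: "emb a \<lesssim> x - emb c"
      using \<open>open_ball v0 g c \<in> ?A\<close> open_iff[OF a] L.less_imp_le by blast
    show "larger_balls v0 (Val g) c \<subseteq> ?A" using larger[OF le] a by simp
    show "closed_ball v0 (Val g) c \<in> ?A" using closed_iff[of a c] le a by simp
  qed
qed

text \<open>If \<open>b\<close> were not nearest, then \<open>v (x - b)\<close> would lie in \<open>v\<^sub>0K\<close>.\<close>

lemma value_transcendental_nearest:
  assumes "value_transcendental emb v0 v (x - emb b)"
  shows "nearest b" "\<not> x - emb b \<doteq> emb a"
proof -
  show *: "\<not> x - emb b \<doteq> emb a" for a
    using assms unfolding value_transcendental_iff by (metis power_one_right zero_less_one)
  show "nearest b" using not_nearestE * by blast
qed

lemma value_transcendental_affine:
  assumes "value_transcendental emb v0 v (emb d * (x - emb b))"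
  shows "value_transcendental emb v0 v (x - emb b)"
  unfolding value_transcendental_iff
proof (intro conjI allI impI notI)
  fix n :: nat and c assume "n > 0" "(x - emb b) ^ n \<doteq> emb c"
  then have "emb d ^ n * (x - emb b) ^ n \<doteq> emb d ^ n * emb c"
    by (intro L.mult_same) auto
  then have "(emb d * (x - emb b)) ^ n \<doteq> emb (d ^ n * c)"
    by (simp add: emb_mult emb_power power_mult_distrib)
  then show False
    using assms \<open>n > 0\<close> unfolding value_transcendental_iff by blast
qed (use assms in \<open>auto simp: value_transcendental_iff\<close>)

lemma residue_transcendental_nearest:
  assumes u: "residue_transcendental emb v0 v (emb d * (x - emb b))"
  shows "nearest b" "d \<noteq> 0" "x - emb b \<doteq> emb (inverse d)"
proof -
  have unit: "1 \<doteq> emb d * (x - emb b)"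
    using u by (simp add: residue_transcendental_iff)
  show d: "d \<noteq> 0" using L.same_imp_zero_iff[OF unit] by auto
  have "emb (inverse d) * 1 \<doteq> emb (inverse d) * (emb d * (x - emb b))"
    by (rule L.mult_same[OF L.same_refl unit])
  then show same: "x - emb b \<doteq> emb (inverse d)"
    using d by (simp add: emb_inverse L.same_sym flip: mult.assoc)
  show "nearest b"
  proof (rule ccontr)
    assume "\<not> nearest b"
    then obtain c where c: "x - emb b \<lless> x - emb c" "x - emb b \<doteq> emb (b - c)"
      by (rule not_nearestE)
    \<comment> \<open>The residue of \<open>d(x - b)\<close> would be the residue of \<open>d(c - b)\<close>, an element of \<open>K\<close>.\<close>
    define p where "p = [:d * (b - c), 1:]"
    have "emb d * (x - emb b) \<lless> emb d * (x - emb c)"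
      using c(1) d by (simp add: L.mult_le_cancel_left)
    then have "1 \<lless> eval_at emb (emb d * (x - emb b)) p"
      using L.same_le_right[OF unit] by (simp add: p_def emb_mult emb_diff algebra_simps)
    moreover have "1 \<lesssim>\<^sub>0 coeff p i" for i
    proof -
      have "emb d * (x - emb b) \<doteq> emb d * emb (b - c)"
        using c(2) by (intro L.mult_same) auto
      then have "1 \<doteq> emb (d * (b - c))"
        using L.same_trans[OF unit] by (simp add: emb_mult)
      then show ?thesis
        by (auto simp: p_def coeff_pCons L.same_def split: nat.splits)
    qed
    ultimately have "1 \<lless>\<^sub>0 coeff p 1"
      using u unfolding residue_transcendental_iff by blast
    then show False by (simp add: p_def)
  qed
qed

end

text \<open>The radii of approximation types over \<open>K\<close> are values of \<open>v\<^sub>0\<close>, so types obtained from different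
  extensions of \<open>v\<^sub>0\<close> are comparable, and they record how each \<open>v (x - c)\<close> compares with \<open>v\<^sub>0K\<close>.\<close>

lemma appr_eq_iff:
  assumes "transcendental_generator emb v0 v x" "transcendental_generator emb v0 v' x"
  shows "appr emb v0 v x = appr emb v0 v' x \<longleftrightarrow>
    (\<forall>a c. (val_le v (emb a) (x - emb c) \<longleftrightarrow> val_le v' (emb a) (x - emb c)) \<and>
      (val_le v (x - emb c) (emb a) \<longleftrightarrow> val_le v' (x - emb c) (emb a)))" (is "?L \<longleftrightarrow> ?R")
proof
  interpret v: transcendental_generator emb v0 v x by fact
  interpret v': transcendental_generator emb v0 v' x by fact
  show ?R if ?L
  proof (intro allI)
    fix a c
    have "c \<in> closed_at (appr emb v0 v x) (val v0 a) \<longleftrightarrow> c \<in> closed_at (appr emb v0 v' x) (val v0 a)"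
      "c \<in> open_at (appr emb v0 v x) (val v0 a) \<longleftrightarrow> c \<in> open_at (appr emb v0 v' x) (val v0 a)"
      using that by auto
    then show "(val_le v (emb a) (x - emb c) \<longleftrightarrow> val_le v' (emb a) (x - emb c)) \<and>
        (val_le v (x - emb c) (emb a) \<longleftrightarrow> val_le v' (x - emb c) (emb a))"
      unfolding v.closed_at_appr v'.closed_at_appr
      by (cases "a = 0") (auto simp: v.open_at_appr v'.open_at_appr)
  qed
  show ?L if ?R
  proof -
    have "B \<in> appr emb v0 v x \<longleftrightarrow> B \<in> appr emb v0 v' x" for B
      using that by (cases B) (simp_all add: v.closed_mem_appr v'.closed_mem_appr
          v.open_mem_appr v'.open_mem_appr)
    then show ?thesis by blast
  qed
qed

section \<open>Transcendental immediate approximation types\<close>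

text \<open>A property holds eventually for this filter if it holds on some ball of the type, that is, for
  all elements of \<open>K\<close> which are sufficiently close to an element \<open>x\<close> with this type.\<close>

definition ball_filter :: "('a, 'g) ball set \<Rightarrow> 'a filter" where
  "ball_filter A = (INF B\<in>A. principal (points B))"

locale nonempty_approximation_type =
  fixes v0 :: "('a::field, 'g) krull" and A :: "('a, 'g) ball set"
  assumes v0: "valuation v0" and A: "approximation_type v0 A" and nonempty: "A \<noteq> {}"
begin

sublocale K: krull_valuation v0
  using v0 by unfold_locales

lemma eventually_ball_filter:
  "eventually P (ball_filter A) \<longleftrightarrow> (\<exists>B\<in>A. \<forall>c\<in>points B. P c)"
proof -
  have "\<exists>B\<in>A. principal (points B) \<le> inf (principal (points B1)) (principal (points B2))"
    if B: "B1 \<in> A" "B2 \<in> A" for B1 B2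
  proof -
    have "points B1 \<subseteq> points B2 \<or> points B2 \<subseteq> points B1"
      using A B unfolding approximation_type_def by blast
    then show ?thesis using B by auto
  qed
  then show ?thesis
    unfolding ball_filter_def
    by (subst eventually_INF_base) (auto simp: nonempty eventually_principal)
qed

lemma points_nonempty:
  assumes "B \<in> A"
  shows "points B \<noteq> {}"
proof -
  have "B \<in> balls v0" using A assms unfolding approximation_type_def by blast
  then consider \<gamma> c where "\<gamma> \<in> radii v0" "B = closed_ball v0 \<gamma> c"
    | g c where "g \<in> carrier (vgroup v0)" "B = open_ball v0 g c"
    unfolding balls_def by blast
  then have "\<exists>c. c \<in> points B"
  proof cases
    case (1 \<gamma> c)
    then show ?thesis by (intro exI[of _ c]) (simp add: closed_ball_def)
  next
    case (2 g c)
    then show ?thesis by (intro exI[of _ c]) (simp add: open_ball_def vless_def)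
  qed
  then show ?thesis by blast
qed

lemma ball_filter_nontrivial: "ball_filter A \<noteq> bot"
  unfolding trivial_limit_def eventually_ball_filter using points_nonempty by blast

lemma eventually_not_center:
  assumes "immediate A"
  shows "eventually (\<lambda>c. c \<noteq> b) (ball_filter A)"
  using assms unfolding eventually_ball_filter immediate_def meet_def by blast

lemma eventually_nonzero:
  assumes "immediate A" "f \<noteq> 0"
  shows "eventually (\<lambda>c. poly f c \<noteq> 0) (ball_filter A)"
proof -
  have "finite {b. poly f b = 0}" using assms(2) by (rule poly_roots_finite)
  then have "eventually (\<lambda>c. \<forall>b\<in>{b. poly f b = 0}. c \<noteq> b) (ball_filter A)"
    using eventually_not_center[OF assms(1)] by (intro eventually_ball_finite) auto
  then show ?thesis by (rule eventually_mono) blast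
qed

lemma eventually_constant:
  assumes "transcendental_immediate v0 A"
  obtains a where "eventually (\<lambda>c. K.same (poly f c) a) (ball_filter A)"
proof -
  obtain \<delta> \<alpha> where \<delta>: "\<delta> \<in> supp A" "\<And>c. c \<in> closed_at A \<delta> \<Longrightarrow> val v0 (poly f c) = \<alpha>"
    using assms unfolding transcendental_immediate_def by blast
  then obtain S where S: "ClosedBall \<delta> S \<in> A" unfolding supp_def by blast
  obtain b where b: "b \<in> S" using points_nonempty[OF S] by auto
  have "u \<in> closed_at A \<delta>" if "u \<in> S" for u
    unfolding closed_at_def using that S by blast
  then have "K.same (poly f c) (poly f b)" if "c \<in> S" for c
    using \<delta>(2) that b unfolding K.val_eq_iff[symmetric] by simp
  then have "eventually (\<lambda>c. K.same (poly f c) (poly f b)) (ball_filter A)"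
    unfolding eventually_ball_filter using S by force
  then show thesis by (rule that)
qed

end

text \<open>The coefficient of \<open>(X - c)\<^sup>i\<close> in the Taylor expansion of \<open>f\<close> at \<open>c\<close> is a polynomial in \<open>c\<close>, so its
  value becomes constant as well.\<close>

lemma taylor_coefficient_poly:
  fixes f :: "'a::comm_ring_1 poly"
  shows "\<exists>g. \<forall>c. coeff (pcompose f [:c, 1:]) i = poly g c"
proof (induction f arbitrary: i)
  case 0
  show ?case by (intro exI[of _ 0]) simp
next
  case (pCons a f)
  obtain g where g: "\<And>i c. coeff (pcompose f [:c, 1:]) i = poly (g i) c"
    using pCons.IH by metis
  have g0: "poly (g 0) c = poly f c" for c
    using g[of c 0] by simp
  show ?case
  proof (cases i)
    case 0
    then show ?thesis
      by (intro exI[of _ "[:a:] + [:0, 1:] * g 0"]) (simp add: pcompose_pCons g0)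
  next
    case (Suc k)
    then show ?thesis
      by (intro exI[of _ "[:0, 1:] * g i + g k"]) (simp add: pcompose_pCons coeff_pCons g)
  qed
qed

context rational_extension
begin

lemma val_le_determined:
  assumes "rational_extension emb v0 v' t"
    and eq: "\<And>f g. val_le v (eval_at emb t f) (eval_at emb t g) \<longleftrightarrow>
      val_le v' (eval_at emb t f) (eval_at emb t g)"
  shows "val_le v = val_le v'"
proof -
  interpret v': rational_extension emb v0 v' t by fact
  have "val_le v y z \<longleftrightarrow> val_le v' y z" for y z
  proof -
  obtain p q where pq: "q \<noteq> 0" "y = eval_at emb t p / eval_at emb t q" by (rule quotientE)
  obtain r s where rs: "s \<noteq> 0" "z = eval_at emb t r / eval_at emb t s" by (rule quotientE)
  have "val_le v y z \<longleftrightarrow> val_le v (eval_at emb t (p * s)) (eval_at emb t (r * q))"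
    using pq(1) rs(1) unfolding pq(2) rs(2)
    by (simp add: L.divide_le_iff L.le_divide_iff eval_at_mult)
  also have "\<dots> \<longleftrightarrow> val_le v' (eval_at emb t (p * s)) (eval_at emb t (r * q))"
    by (rule eq)
  also have "\<dots> \<longleftrightarrow> val_le v' y z"
    using pq(1) rs(1) unfolding pq(2) rs(2)
    by (simp add: v'.L.divide_le_iff v'.L.le_divide_iff eval_at_mult)
  finally show ?thesis .
  qed
  then show ?thesis by blast
qed

end

locale transcendental_immediate_extension = transcendental_generator +
  assumes TI: "transcendental_immediate v0 (appr emb v0 v x)"
begin

abbreviation F where "F \<equiv> ball_filter (appr emb v0 v x)"

lemma imm: "immediate (appr emb v0 v x)"
  using TI by (simp add: transcendental_immediate_def)

sublocale A: nonempty_approximation_type v0 "appr emb v0 v x"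
  by unfold_locales
    (use imm approximation_type_appr v0_valuation in \<open>auto simp: immediate_def\<close>)

lemma eventually_closer: "eventually (\<lambda>c. x - emb b \<lless> x - emb c) F"
proof -
  have "b \<notin> meet (appr emb v0 v x)"
    using imm unfolding immediate_def by blast
  then obtain B where B: "B \<in> appr emb v0 v x" "b \<notin> points B"
    unfolding meet_def by blast
  have "x - emb b \<lless> x - emb c" if c: "c \<in> points B" for c
  proof (cases B)
    case (ClosedBall \<gamma> S)
    then obtain a where "S = {c. emb a \<lesssim> x - emb c}"
      using B(1) by (auto simp: closed_mem_appr)
    then show ?thesis using ClosedBall B(2) c L.trans by auto
  next
    case (OpenBall g S)
    then obtain a where "S = {c. emb a \<lless> x - emb c}"
      using B(1) by (auto simp: open_mem_appr)
    then show ?thesis using OpenBall B(2) c L.trans by auto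
  qed
  then show ?thesis unfolding A.eventually_ball_filter using B(1) by blast
qed

text \<open>As \<open>c\<close> approaches \<open>x\<close>, the values of \<open>(x - c)\<^sup>k\<close> rise strictly above each one that is attained.\<close>

lemma eventually_power_avoids:
  assumes "k > 0"
  shows "eventually (\<lambda>c. \<not> (x - emb c) ^ k \<doteq> m) F"
proof (cases "\<exists>b. (x - emb b) ^ k \<doteq> m")
  case True
  then obtain b where b: "(x - emb b) ^ k \<doteq> m" by blast
  show ?thesis
    using eventually_closer[of b]
  proof (rule eventually_mono)
    fix c assume "x - emb b \<lless> x - emb c"
    then have "(x - emb b) ^ k \<lless> (x - emb c) ^ k"
      using assms by (rule L.power_less_mono)
    then show "\<not> (x - emb c) ^ k \<doteq> m"
      using L.same_le_right[OF b, of "(x - emb c) ^ k"] by (simp add: L.same_def)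
  qed
qed simp

text \<open>Equality of the two values prescribes the value of a power of \<open>x - c\<close>.\<close>

lemma eventually_monomials_distinct:
  assumes "i \<noteq> j" "a \<noteq> 0" "b \<noteq> 0"
  shows "eventually (\<lambda>c. \<not> emb a * (x - emb c) ^ i \<doteq> emb b * (x - emb c) ^ j) F"
proof -
  have *: "eventually (\<lambda>c. \<not> emb a * (x - emb c) ^ i \<doteq> emb b * (x - emb c) ^ j) F"
    if "i < j" "a \<noteq> 0" "b \<noteq> 0" for i j a b
  proof (rule eventually_mono[OF eventually_power_avoids[of "j - i" "emb (a / b)"]])
    fix c assume avoid: "\<not> (x - emb c) ^ (j - i) \<doteq> emb (a / b)"
    show "\<not> emb a * (x - emb c) ^ i \<doteq> emb b * (x - emb c) ^ j"
    proof
      let ?t = "x - emb c"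
      assume "emb a * ?t ^ i \<doteq> emb b * ?t ^ j"
      then have "(emb a * ?t ^ i) / (emb b * ?t ^ i) \<doteq> (emb b * ?t ^ j) / (emb b * ?t ^ i)"
        by (intro L.divide_same L.same_refl)
      moreover have "(emb a * ?t ^ i) / (emb b * ?t ^ i) = emb (a / b)"
        "(emb b * ?t ^ j) / (emb b * ?t ^ i) = ?t ^ (j - i)"
        using that x_notin[of c] by (auto simp: emb_divide power_diff)
      ultimately show False using avoid by (simp add: L.same_sym)
    qed
  qed (use that in simp)
  show ?thesis
  proof (cases "i < j")
    case False
    then show ?thesis
      using *[of j i b a] assms by (simp add: L.same_sym)
  qed (use * assms in simp)
qed

text \<open>In the Taylor expansion of \<open>f(x) - f(c)\<close> the values of the coefficients become constant. Once
  they are, the values of the terms are pairwise distinct, so the increment has the value of one of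
  them; and each of these finally avoids the value of \<open>m\<close>.\<close>

lemma eventually_increment_avoids:
  assumes "m \<noteq> 0"
  shows "eventually (\<lambda>c. \<not> eval_at emb x f - emb (poly f c) \<doteq> m) F"
proof -
  define n where "n = degree f"
  obtain g where g: "\<And>i c. coeff (pcompose f [:c, 1:]) i = poly (g i) c"
    using taylor_coefficient_poly[of f] by metis
  have "\<exists>a. eventually (\<lambda>c. K.same (poly (g i) c) a) F" for i
    using A.eventually_constant[OF TI] by metis
  then obtain a where a: "\<And>i. eventually (\<lambda>c. K.same (poly (g i) c) (a i)) F"
    by metis
  define I where "I = {i \<in> {1..n}. a i \<noteq> 0}"
  have I: "finite I" by (simp add: I_def)
  have "eventually (\<lambda>c. \<forall>i\<in>{1..n}. K.same (poly (g i) c) (a i)) F"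
    using a by (intro eventually_ball_finite) auto
  moreover have "eventually (\<lambda>c. \<forall>i\<in>I. \<forall>j\<in>I. i \<noteq> j \<longrightarrow>
      \<not> emb (a i) * (x - emb c) ^ i \<doteq> emb (a j) * (x - emb c) ^ j) F"
  proof (intro eventually_ball_finite ballI I)
    fix i j assume "i \<in> I" "j \<in> I"
    then show "eventually (\<lambda>c. i \<noteq> j \<longrightarrow>
        \<not> emb (a i) * (x - emb c) ^ i \<doteq> emb (a j) * (x - emb c) ^ j) F"
      using eventually_monomials_distinct[of i j "a i" "a j"] by (cases "i = j") (auto simp: I_def)
  qed
  moreover have "eventually (\<lambda>c. \<forall>i\<in>I. \<not> (x - emb c) ^ i \<doteq> m / emb (a i)) F"
    using eventually_power_avoids by (intro eventually_ball_finite I) (auto simp: I_def)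
  ultimately show ?thesis
  proof eventually_elim
    case (elim c)
    let ?t = "x - emb c"
    let ?f = "\<lambda>i. emb (poly (g i) c) * ?t ^ i"
    have f_same: "?f i \<doteq> emb (a i) * ?t ^ i" if "i \<in> {1..n}" for i
      using elim(1) that by (intro L.mult_same L.same_refl) (simp add: emb_same_iff)
    have deg: "degree (pcompose f [:c, 1:]) = n"
      by (simp add: degree_pcompose n_def)
    have "eval_at emb x f = eval_at emb ?t (pcompose f [:c, 1:])"
      by (simp add: eval_at_pcompose)
    also have "\<dots> = (\<Sum>i\<le>n. ?f i)"
      unfolding eval_at_sum deg g ..
    also have "\<dots> = ?f 0 + (\<Sum>i\<in>{1..n}. ?f i)"
      by (simp add: atMost_atLeast0 sum.atLeast_Suc_atMost)
    also have "poly (g 0) c = poly f c"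
      unfolding g[symmetric] by simp
    also have "(\<Sum>i\<in>{1..n}. ?f i) = (\<Sum>i\<in>I. ?f i)"
    proof (rule sum.mono_neutral_right)
      show "\<forall>i\<in>{1..n} - I. ?f i = 0"
        using elim(1) K.same_zero_iff by (auto simp: I_def)
    qed (auto simp: I_def)
    finally have incr: "eval_at emb x f - emb (poly f c) = (\<Sum>i\<in>I. ?f i)" by simp
    show ?case
    proof (cases "I = {}")
      case True
      then show ?thesis
        using assms unfolding incr by (simp add: L.same_sym[of 0] L.same_zero_iff)
    next
      case False
      obtain h where h: "h \<in> I" "\<And>i. i \<in> I \<Longrightarrow> ?f h \<lesssim> ?f i"
        using L.exists_least[OF I False, of ?f] by blast
      have "?f h \<lless> ?f i" if i: "i \<in> I" "i \<noteq> h" for i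
      proof
        assume "?f i \<lesssim> ?f h"
        then have "?f i \<doteq> ?f h" using h(2)[OF i(1)] by (simp add: L.same_def)
        then have "emb (a i) * ?t ^ i \<doteq> emb (a h) * ?t ^ h"
          using f_same[of i] f_same[of h] i(1) h(1) L.same_trans L.same_sym unfolding I_def by blast
        then show False using elim(2) i h(1) by blast
      qed
      moreover have "?f h \<noteq> 0"
        using h(1) f_same[of h] L.same_imp_zero_iff x_notin[of c] by (fastforce simp: I_def)
      ultimately have "(\<Sum>i\<in>I. ?f i) \<approx> ?f h"
        using h(1) by (intro L.close_sum[OF I]) auto
      then have same: "(\<Sum>i\<in>I. ?f i) \<doteq> emb (a h) * ?t ^ h"
        using L.close_same L.same_trans f_same[of h] h(1) unfolding I_def by blast
      show ?thesis
        unfolding incr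
      proof
        assume "(\<Sum>i\<in>I. ?f i) \<doteq> m"
        then have "emb (a h) * ?t ^ h \<doteq> m"
          using same L.same_trans L.same_sym by blast
        then have "emb (a h) * ?t ^ h / emb (a h) \<doteq> m / emb (a h)"
          by (intro L.divide_same L.same_refl)
        then show False using elim(3) h(1) by (auto simp: I_def)
      qed
    qed
  qed
qed

text \<open>The value of \<open>f(x) - f(c)\<close> finally differs from \<open>v f(x)\<close> and from the constant value of \<open>f(c)\<close>. If
  these two values were different, the lesser one would be the value of the difference. So they
  agree, and the difference has greater value.\<close>

lemma eventually_close:
  assumes "f \<noteq> 0"
  shows "eventually (\<lambda>c. eval_at emb x f \<approx> emb (poly f c)) F"
proof -
  obtain a where a: "eventually (\<lambda>c. K.same (poly f c) a) F"
    using A.eventually_constant[OF TI] .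
  have nz: "eventually (\<lambda>c. poly f c \<noteq> 0) F"
    by (rule A.eventually_nonzero[OF imm assms])
  have "eventually (\<lambda>c. a \<noteq> 0) F"
    using a nz by eventually_elim (auto dest: K.same_imp_zero_iff)
  then have "a \<noteq> 0" using A.ball_filter_nontrivial eventually_const by metis
  then have "eventually (\<lambda>c. \<not> eval_at emb x f - emb (poly f c) \<doteq> emb a) F"
    by (intro eventually_increment_avoids) simp
  moreover have "eventually (\<lambda>c. \<not> eval_at emb x f - emb (poly f c) \<doteq> eval_at emb x f) F"
    using assms by (intro eventually_increment_avoids) simp
  ultimately show ?thesis
    using a
  proof eventually_elim
    case (elim c)
    let ?y = "eval_at emb x f" and ?e = "emb (poly f c)"
    have e: "?e \<doteq> emb a" using elim(3) by (simp add: emb_same_iff)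
    have "\<not> ?y \<lless> ?e"
      using elim(2) L.add_dominated[of "- ?e" ?y] by (auto simp: L.uminus_le)
    then have ey: "?e \<lesssim> ?y" by blast
    have "?e \<lesssim> ?y - ?e" using L.diff[OF ey L.refl] .
    moreover have "\<not> ?y - ?e \<lesssim> ?e"
      using elim(1) L.same_trans[OF _ e] \<open>?e \<lesssim> ?y - ?e\<close> by (auto simp: L.same_def)
    ultimately show ?case by (simp add: L.close_def)
  qed
qed

text \<open>The right-hand side is determined by the approximation type alone.\<close>

lemma le_iff_eventually:
  "eval_at emb x f \<lesssim> eval_at emb x g \<longleftrightarrow> eventually (\<lambda>c. poly f c \<lesssim>\<^sub>0 poly g c) F"
proof -
  have same: "eventually (\<lambda>c. eval_at emb x f \<doteq> emb (poly f c)) F" for f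
  proof (cases "f = 0")
    case False
    show ?thesis by (rule eventually_mono[OF eventually_close[OF False]]) (rule L.close_same)
  qed simp
  have "eventually (\<lambda>c. poly f c \<lesssim>\<^sub>0 poly g c \<longleftrightarrow> eval_at emb x f \<lesssim> eval_at emb x g) F"
    using same[of f] same[of g]
    by eventually_elim (simp add: L.same_le_left L.same_le_right)
  then have "eventually (\<lambda>c. poly f c \<lesssim>\<^sub>0 poly g c) F \<longleftrightarrow>
      eventually (\<lambda>c. eval_at emb x f \<lesssim> eval_at emb x g) F"
    by (rule eventually_cong)
  then show ?thesis
    using A.ball_filter_nontrivial by simp
qed

lemma immediate_extension: "immediate_extension emb v0 v"
proof -
  have close: "\<exists>c. y \<approx> emb c" if y: "y \<noteq> 0" for y
  proof -
    obtain p q where pq: "p \<noteq> 0" "q \<noteq> 0" "y = eval_at emb x p / eval_at emb x q"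
      using quotient_nonzeroE[OF y] .
    have "eventually (\<lambda>c. y \<approx> emb (poly p c / poly q c)) F"
      using eventually_close[OF pq(1)] eventually_close[OF pq(2)]
      by eventually_elim (simp add: pq(3) emb_divide L.close_divide)
    then show ?thesis
      using A.ball_filter_nontrivial eventually_happens' by blast
  qed
  have "\<exists>c. y \<doteq> emb c" for y
  proof (cases "y = 0")
    case True
    then show ?thesis by (intro exI[of _ 0]) simp
  next
    case False
    then show ?thesis using close L.close_same by blast
  qed
  moreover have "\<exists>c. y \<approx> emb c" if "1 \<doteq> y" for y
    using close L.same_imp_zero_iff[OF that] by simp
  ultimately show ?thesis
    unfolding immediate_extension_def
    using base_values_eq_carrier_iff base_residues_eq_carrierI by blast
qed

end

section \<open>Constructing extensions\<close>

subsection \<open>From preorders on polynomials to valuations of the rational function field\<close>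

locale poly_preorder =
  fixes G :: "'a::field poly \<Rightarrow> 'a poly \<Rightarrow> bool"
  assumes G_total: "G f g \<or> G g f"
    and G_trans: "G f g \<Longrightarrow> G g h \<Longrightarrow> G f h"
    and G_mult: "h \<noteq> 0 \<Longrightarrow> G (h * f) (h * g) \<longleftrightarrow> G f g"
    and G_add: "G f g \<Longrightarrow> G f h \<Longrightarrow> G f (g + h)"
    and G_zero: "\<not> G 0 1"

text \<open>Fractions are compared after multiplication by both denominators; the cancellation law makes
  this independent of the representation.\<close>

lemma (in poly_preorder) extension_exists:
  fixes emb :: "'a \<Rightarrow> 'b::field" and v0 :: "('a, 'g) krull"
  assumes v0: "valuation v0" and x: "simple_transcendental emb x"
    and const: "\<And>a b. G [:a:] [:b:] \<longleftrightarrow> val_le v0 a b"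
  obtains v :: "('b, 'b set) krull" where "transcendental_generator emb v0 v x"
    "\<And>f g. val_le v (eval_at emb x f) (eval_at emb x g) \<longleftrightarrow> G f g"
proof -
  interpret field_emb emb
    using x by unfold_locales (simp add: simple_transcendental_def)
  let ?e = "eval_at emb x"
  have e0: "?e p = 0 \<longleftrightarrow> p = 0" for p
    using x by (auto simp: simple_transcendental_def)
  have e_diff: "?e (p - q) = ?e p - ?e q" for p q
    using eval_at_add[of x "p - q" q] by simp
  have e_inj: "?e p = ?e q \<longleftrightarrow> p = q" for p q
    using e0[of "p - q"] by (simp add: e_diff)
  define le where "le y z \<longleftrightarrow> (\<exists>p q r s. q \<noteq> 0 \<and> s \<noteq> 0 \<and> y = ?e p / ?e q \<and> z = ?e r / ?e s \<and>
      G (p * s) (r * q))" for y z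
  have le: "le (?e p / ?e q) (?e r / ?e s) \<longleftrightarrow> G (p * s) (r * q)" if "q \<noteq> 0" "s \<noteq> 0" for p q r s
  proof
    assume "le (?e p / ?e q) (?e r / ?e s)"
    then obtain p' q' r' s' where *: "q' \<noteq> 0" "s' \<noteq> 0" "?e p / ?e q = ?e p' / ?e q'"
      "?e r / ?e s = ?e r' / ?e s'" "G (p' * s') (r' * q')"
      unfolding le_def by blast
    have "?e (p * q') = ?e (p' * q)" "?e (r * s') = ?e (r' * s)"
      using *(1-4) that e0 by (simp_all add: eval_at_mult frac_eq_eq)
    then have eq: "p * q' = p' * q" "r * s' = r' * s" by (simp_all add: e_inj)
    have "G ((q * s) * (p' * s')) ((q * s) * (r' * q'))"
      using *(5) that by (subst G_mult) auto
    moreover have "(q * s) * (p' * s') = (p' * q) * (s * s')" "(q * s) * (r' * q') = (r' * s) * (q * q')"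
      by (simp_all only: mult_ac)
    ultimately have "G ((p * q') * (s * s')) ((r * s') * (q * q'))"
      by (simp only: eq)
    moreover have "(p * q') * (s * s') = (q' * s') * (p * s)" "(r * s') * (q * q') = (q' * s') * (r * q)"
      by (simp_all only: mult_ac)
    ultimately have "G ((q' * s') * (p * s)) ((q' * s') * (r * q))"
      by (simp only:)
    then show "G (p * s) (r * q)" using *(1,2) by (subst (asm) G_mult) auto
  next
    assume "G (p * s) (r * q)"
    then show "le (?e p / ?e q) (?e r / ?e s)" unfolding le_def using that by blast
  qed
  have rep: "\<exists>p q. q \<noteq> 0 \<and> y = ?e p / ?e q" for y
    using x by (auto simp: simple_transcendental_def)
  interpret valuation_preorder le
  proof
    fix y z
    obtain p q r s where "q \<noteq> 0" "y = ?e p / ?e q" "s \<noteq> 0" "z = ?e r / ?e s"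
      using rep[of y] rep[of z] by blast
    then show "le y z \<or> le z y" using G_total by (simp add: le)
  next
    fix w y z assume *: "le w y" "le y z"
    obtain p q r s t u where reps: "q \<noteq> 0" "w = ?e p / ?e q" "s \<noteq> 0" "y = ?e r / ?e s"
      "u \<noteq> 0" "z = ?e t / ?e u"
      using rep[of w] rep[of y] rep[of z] by blast
    have "G (u * (p * s)) (u * (r * q))" "G (q * (r * u)) (q * (t * s))"
      using * reps by (simp_all add: le G_mult)
    then have "G (s * (p * u)) (s * (t * q))"
      using G_trans[of "u * (p * s)" "u * (r * q)" "q * (t * s)"] by (simp add: mult_ac)
    then show "le w z" using reps by (simp add: le G_mult)
  next
    fix w y z assume *: "le y z"
    obtain p q r s t u where reps: "q \<noteq> 0" "w = ?e p / ?e q" "s \<noteq> 0" "y = ?e r / ?e s"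
      "u \<noteq> 0" "z = ?e t / ?e u"
      using rep[of w] rep[of y] rep[of z] by blast
    have prods: "w * y = ?e (p * r) / ?e (q * s)" "w * z = ?e (p * t) / ?e (q * u)"
      using reps by (simp_all add: eval_at_mult)
    have "G (r * u) (t * s)" using * reps by (simp add: le)
    then have "G ((p * q) * (r * u)) ((p * q) * (t * s))" if "p \<noteq> 0"
      using that reps by (simp add: G_mult)
    moreover have "G 0 0" using G_total by blast
    ultimately have "G (p * r * (q * u)) (p * t * (q * s))"
      by (cases "p = 0") (simp_all add: mult_ac)
    then show "le (w * y) (w * z)"
      unfolding prods using reps by (simp add: le del: mult_eq_0_iff add: no_zero_divisors)
  next
    fix w y z assume *: "le w y" "le w z"
    obtain p q r s t u where reps: "q \<noteq> 0" "w = ?e p / ?e q" "s \<noteq> 0" "y = ?e r / ?e s"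
      "u \<noteq> 0" "z = ?e t / ?e u"
      using rep[of w] rep[of y] rep[of z] by blast
    have sum: "y + z = ?e (r * u + t * s) / ?e (s * u)"
      using reps e0 by (simp add: eval_at_add eval_at_mult add_frac_eq)
    have "G (u * (p * s)) (u * (r * q))" "G (s * (p * u)) (s * (t * q))"
      using * reps by (simp_all add: le G_mult)
    then have "G (p * (s * u)) ((r * u + t * s) * q)"
      using G_add[of "p * (s * u)" "u * (r * q)" "s * (t * q)"] by (simp add: algebra_simps)
    then show "le w (y + z)"
      unfolding sum reps(2) using reps by (simp add: le)
  next
    have "le (?e 0 / ?e 1) (?e 1 / ?e 1) \<longleftrightarrow> G (0 * 1) (1 * 1)"
      by (rule le) auto
    then show "\<not> le 0 1" using G_zero by simp
  qed
  obtain v :: "('b, 'b set) krull" where v: "valuation v" "val_le v = le"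
    using krull_of_valuation_preorder[OF valuation_preorder_axioms] .
  have val: "val_le v (?e f) (?e g) \<longleftrightarrow> G f g" for f g
    using le[of 1 1 f g] by (simp add: v)
  have "val_le v (emb a) (emb b) \<longleftrightarrow> val_le v0 a b" for a b
    using val[of "[:a:]" "[:b:]"] by (simp add: const)
  then have "extends emb v0 v"
    using v(1) extends_iff[OF v0 field_embedding] by (auto simp: le_embedding_def)
  then have "transcendental_generator emb v0 v x"
    using v0 x by unfold_locales
  then show thesis using val that by blast
qed

subsection \<open>Balls of an approximation type\<close>

locale valued_approximation_type = krull_valuation v0
  for v0 :: "('a::field, 'g) krull" and A :: "('a, 'g) ball set" +
  assumes A: "approximation_type v0 A"
begin

abbreviation le0 (infix "\<lesssim>\<^sub>K" 50) where "a \<lesssim>\<^sub>K b \<equiv> val_le v0 a b"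
abbreviation less0 (infix "\<lless>\<^sub>K" 50) where "a \<lless>\<^sub>K b \<equiv> \<not> val_le v0 b a"

lemma radius_cases:
  assumes "\<gamma> \<in> radii v0"
  obtains a where "\<gamma> = val v0 a"
  using assms val_zero unfolding radii_def carrier_iff by (metis imageE insertE carrier_iff)

lemma radii_val: "val v0 a \<in> radii v0"
  by (cases rule: val_cases[of a]) (auto simp: radii_def)

lemma closed_ball_val: "closed_ball v0 (val v0 a) c = ClosedBall (val v0 a) {u. a \<lesssim>\<^sub>K u - c}"
  by (simp add: closed_ball_def val_le_def)

lemma open_ball_val: "val v0 a = Val g \<Longrightarrow> open_ball v0 g c = OpenBall g {u. a \<lless>\<^sub>K u - c}"
  using vless_iff[of a] by (simp add: open_ball_def)

text \<open>Every point of a ball is a center.\<close>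

lemma closed_recenter: "a \<lesssim>\<^sub>K b - c \<Longrightarrow> {u. a \<lesssim>\<^sub>K u - c} = {u. a \<lesssim>\<^sub>K u - b}"
proof -
  assume "a \<lesssim>\<^sub>K b - c"
  then have "a \<lesssim>\<^sub>K u - c \<longleftrightarrow> a \<lesssim>\<^sub>K u - b" for u
    using diff[of a "u - c" "b - c"] add[of a "u - b" "b - c"] by auto
  then show ?thesis by blast
qed

lemma open_recenter: "a \<lless>\<^sub>K b - c \<Longrightarrow> {u. a \<lless>\<^sub>K u - c} = {u. a \<lless>\<^sub>K u - b}"
proof -
  assume "a \<lless>\<^sub>K b - c"
  then have "a \<lless>\<^sub>K u - c \<longleftrightarrow> a \<lless>\<^sub>K u - b" for u
    using diff_less[of "u - c" a "b - c"] add_less[of "u - b" a "b - c"] by auto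
  then show ?thesis by blast
qed

lemma closed_memE:
  assumes "ClosedBall \<gamma> S \<in> A" "b \<in> S"
  obtains a where "\<gamma> = val v0 a" "S = {u. a \<lesssim>\<^sub>K u - b}"
proof -
  have "ClosedBall \<gamma> S \<in> balls v0" using A assms unfolding approximation_type_def by blast
  then obtain c where c: "\<gamma> \<in> radii v0" "ClosedBall \<gamma> S = closed_ball v0 \<gamma> c"
    unfolding balls_def by (auto simp: open_ball_def closed_ball_def)
  obtain a where a: "\<gamma> = val v0 a" using c(1) by (rule radius_cases)
  have S: "S = {u. a \<lesssim>\<^sub>K u - c}" using c(2) by (simp add: a closed_ball_val)
  then have "S = {u. a \<lesssim>\<^sub>K u - b}" using assms(2) closed_recenter[of a b c] by simp
  then show thesis using a that by blast
qed

lemma open_memE: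
  assumes "OpenBall g S \<in> A" "b \<in> S"
  obtains a where "val v0 a = Val g" "S = {u. a \<lless>\<^sub>K u - b}"
proof -
  have "OpenBall g S \<in> balls v0" using A assms unfolding approximation_type_def by blast
  then obtain c where c: "g \<in> carrier (vgroup v0)" "OpenBall g S = open_ball v0 g c"
    unfolding balls_def by (auto simp: open_ball_def closed_ball_def)
  obtain a where a: "val v0 a = Val g" using c(1) carrier_iff by blast
  have S: "S = {u. a \<lless>\<^sub>K u - c}" using c(2) by (simp add: open_ball_val[OF a])
  then have "S = {u. a \<lless>\<^sub>K u - b}" using assms(2) open_recenter[of b c a] by simp
  then show thesis using a that by blast
qed

lemma larger:
  assumes "ClosedBall (val v0 e) {u. e \<lesssim>\<^sub>K u - b} \<in> A" "a \<lless>\<^sub>K e"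
  shows "ClosedBall (val v0 a) {u. a \<lesssim>\<^sub>K u - b} \<in> A"
    and "val v0 a = Val g \<Longrightarrow> OpenBall g {u. a \<lless>\<^sub>K u - b} \<in> A"
proof -
  have "larger_balls v0 (val v0 e) b \<subseteq> A"
    using A assms(1) radii_val[of e] unfolding approximation_type_def closed_ball_val[symmetric] by blast
  moreover have "a \<noteq> 0" using assms(2) by auto
  then obtain h where h: "val v0 a = Val h" "h \<in> carrier (vgroup v0)"
    by (cases rule: val_cases[of a]) auto
  moreover have "vless (vgroup v0) (Val h) (val v0 e)"
    using vless_iff[of a e] h assms(2) by simp
  ultimately have "closed_ball v0 (Val h) b \<in> A" "open_ball v0 h b \<in> A"
    unfolding larger_balls_def by blast+
  then show "ClosedBall (val v0 a) {u. a \<lesssim>\<^sub>K u - b} \<in> A"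
    and "val v0 a = Val g \<Longrightarrow> OpenBall g {u. a \<lless>\<^sub>K u - b} \<in> A"
    using h closed_ball_val[of a b] open_ball_val[OF h(1), of b] by auto
qed

lemma open_imp_closed:
  assumes "OpenBall g {u. a \<lless>\<^sub>K u - b} \<in> A" "val v0 a = Val g"
  shows "ClosedBall (val v0 a) {u. a \<lesssim>\<^sub>K u - b} \<in> A"
proof -
  have "open_ball v0 g b \<in> A" using assms open_ball_val by simp
  moreover have "g \<in> carrier (vgroup v0)" using assms(2) carrier_iff by blast
  ultimately have "closed_ball v0 (Val g) b \<in> A"
    using A unfolding approximation_type_def by blast
  then show ?thesis using assms(2) closed_ball_val[of a b] by simp
qed

lemma same_closed: "val v0 a = val v0 e \<Longrightarrow> {u. a \<lesssim>\<^sub>K u - b} = {u. e \<lesssim>\<^sub>K u - b}"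
  unfolding val_eq_iff by (simp only: same_le_left)

lemma same_open: "val v0 a = val v0 e \<Longrightarrow> {u. a \<lless>\<^sub>K u - b} = {u. e \<lless>\<^sub>K u - b}"
  unfolding val_eq_iff by (simp only: same_le_right)

end

subsection \<open>Realizing transcendental immediate approximation types\<close>

context transcendental_generator
begin

text \<open>In \<open>K(x)\<close> the comparison of \<open>v (x - c)\<close> with \<open>v\<^sub>0 a\<close> is that of \<open>v\<^sub>0 (u - c)\<close> with \<open>v\<^sub>0 a\<close> for all \<open>u\<close>
  in a small ball of \<open>A\<close>; so the balls of \<open>A\<close> are balls around \<open>x\<close>. Conversely a ball around \<open>x\<close> contains
  a ball of \<open>A\<close>, because no \<open>c\<close> lies in all of these.\<close>

lemma appr_eqI_transcendental_immediate:
  assumes A: "approximation_type v0 A" and TI: "transcendental_immediate v0 A"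
    and v: "\<And>f g. eval_at emb x f \<lesssim> eval_at emb x g \<longleftrightarrow>
      eventually (\<lambda>c. poly f c \<lesssim>\<^sub>0 poly g c) (ball_filter A)"
  shows "appr emb v0 v x = A"
proof -
  have imm: "immediate A" using TI by (simp add: transcendental_immediate_def)
  interpret V: valued_approximation_type v0 A
    using v0_valuation A by unfold_locales
  interpret N: nonempty_approximation_type v0 A
    using v0_valuation A imm by unfold_locales (auto simp: immediate_def)
  let ?F = "ball_filter A"
  define G where "G f g \<longleftrightarrow> eventually (\<lambda>c. val_le v0 (poly f c) (poly g c)) ?F" for f g
  have const: "(\<exists>a. eventually (\<lambda>c. K.same (poly f c) a) ?F)" for f
    using N.eventually_constant[OF TI] by metis
  have dichotomy: "G f g \<or> eventually (\<lambda>c. \<not> val_le v0 (poly f c) (poly g c)) ?F" for f g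
  proof -
    obtain a b where ab: "eventually (\<lambda>c. K.same (poly f c) a) ?F" "eventually (\<lambda>c. K.same (poly g c) b) ?F"
      using const by metis
    then have "eventually (\<lambda>c. val_le v0 (poly f c) (poly g c) \<longleftrightarrow> val_le v0 a b) ?F"
      by eventually_elim (simp add: K.same_le_left K.same_le_right)
    then show ?thesis
      unfolding G_def by (cases "val_le v0 a b") (auto elim: eventually_mono)
  qed
  have le_iff: "emb a \<lesssim> x - emb c \<longleftrightarrow> eventually (\<lambda>u. a \<lesssim>\<^sub>0 u - c) ?F" for a c
    using v[of "[:a:]" "[:- c, 1:]"] by (simp add: emb_uminus)
  have less_iff: "emb a \<lless> x - emb c \<longleftrightarrow> eventually (\<lambda>u. a \<lless>\<^sub>0 u - c) ?F" for a c
  proof -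
    have "x - emb c \<lesssim> emb a \<longleftrightarrow> G [:- c, 1:] [:a:]"
      using v[of "[:- c, 1:]" "[:a:]"] by (simp add: G_def emb_uminus)
    moreover have "\<not> (G [:- c, 1:] [:a:] \<and> eventually (\<lambda>u. a \<lless>\<^sub>0 u - c) ?F)"
    proof
      assume "G [:- c, 1:] [:a:] \<and> eventually (\<lambda>u. a \<lless>\<^sub>0 u - c) ?F"
      then have "eventually (\<lambda>u. False) ?F"
        unfolding G_def by (auto elim: eventually_elim2)
      then show False using N.ball_filter_nontrivial by simp
    qed
    ultimately show ?thesis
      using dichotomy[of "[:- c, 1:]" "[:a:]"] by auto
  qed
  have closed_set: "S = {c. emb a \<lesssim> x - emb c}"
    if S: "ClosedBall (val v0 a) S \<in> A" "S = {u. a \<lesssim>\<^sub>0 u - b}" for a b S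
  proof -
    have ev: "eventually (\<lambda>u. a \<lesssim>\<^sub>0 u - b) ?F"
      unfolding N.eventually_ball_filter using S by (intro bexI[of _ "ClosedBall (val v0 a) S"]) auto
    have "a \<lesssim>\<^sub>0 c - b \<longleftrightarrow> emb a \<lesssim> x - emb c" for c
    proof
      assume c: "a \<lesssim>\<^sub>0 c - b"
      show "emb a \<lesssim> x - emb c"
        unfolding le_iff using ev
      proof eventually_elim
        case (elim u)
        then show ?case using K.diff[OF elim c] by simp
      qed
    next
      assume "emb a \<lesssim> x - emb c"
      then have "eventually (\<lambda>u. a \<lesssim>\<^sub>0 c - b) ?F"
        using ev unfolding le_iff
      proof eventually_elim
        case (elim u)
        then show ?case using K.diff[OF elim(2,1)] by simp
      qed
      then show "a \<lesssim>\<^sub>0 c - b" using N.ball_filter_nontrivial by simp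
    qed
    then show ?thesis using S(2) by simp
  qed
  have open_set: "S = {c. emb a \<lless> x - emb c}"
    if S: "OpenBall g S \<in> A" "S = {u. a \<lless>\<^sub>0 u - b}" for a b g S
  proof -
    have ev: "eventually (\<lambda>u. a \<lless>\<^sub>0 u - b) ?F"
      unfolding N.eventually_ball_filter using S by (intro bexI[of _ "OpenBall g S"]) auto
    have "a \<lless>\<^sub>0 c - b \<longleftrightarrow> emb a \<lless> x - emb c" for c
    proof
      assume c: "a \<lless>\<^sub>0 c - b"
      show "emb a \<lless> x - emb c"
        unfolding less_iff using ev
      proof eventually_elim
        case (elim u)
        then show ?case using K.diff_less[OF elim c] by simp
      qed
    next
      assume "emb a \<lless> x - emb c"
      then have "eventually (\<lambda>u. a \<lless>\<^sub>0 c - b) ?F"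
        using ev unfolding less_iff
      proof eventually_elim
        case (elim u)
        then show ?case using K.diff_less[OF elim(2,1)] by simp
      qed
      then show "a \<lless>\<^sub>0 c - b" using N.ball_filter_nontrivial by simp
    qed
    then show ?thesis using S(2) by simp
  qed
  \<comment> \<open>Since the type is immediate, \<open>c\<close> lies outside some ball of \<open>A\<close>, whose radius \<open>v\<^sub>0 e\<close> is
    therefore an upper bound of \<open>v\<^sub>0 (c - u)\<close> for its points \<open>u\<close>. As its center serves a point that
    satisfies \<open>P\<close>.\<close>
  have smaller: "\<exists>u e. P u \<and> c - u \<lesssim>\<^sub>0 e \<and> ((ClosedBall (val v0 e) {w. e \<lesssim>\<^sub>0 w - u} \<in> A \<and> c - u \<lless>\<^sub>0 e) \<or>
      (\<exists>g. val v0 e = Val g \<and> OpenBall g {w. e \<lless>\<^sub>0 w - u} \<in> A))"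
    if ev: "eventually P ?F" for P c
  proof -
    obtain B where B: "B \<in> A" "c \<notin> points B"
      using imm unfolding immediate_def meet_def by blast
    have "eventually (\<lambda>u. u \<in> points B) ?F"
      unfolding N.eventually_ball_filter using B(1) by blast
    then have "eventually (\<lambda>u. P u \<and> u \<in> points B) ?F"
      using ev by eventually_elim simp
    then obtain u where u: "P u" "u \<in> points B"
      using N.ball_filter_nontrivial eventually_happens' by blast
    show ?thesis
    proof (cases B)
      case (ClosedBall \<gamma> S)
      obtain e where "\<gamma> = val v0 e" "S = {w. e \<lesssim>\<^sub>0 w - u}"
        by (rule V.closed_memE[OF B(1)[unfolded ClosedBall], of u]) (use u(2) ClosedBall in auto)
      then show ?thesis
        using ClosedBall B u K.less_imp_le by (intro exI[of _ u] exI[of _ e]) auto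
    next
      case (OpenBall g S)
      obtain e where "val v0 e = Val g" "S = {w. e \<lless>\<^sub>0 w - u}"
        by (rule V.open_memE[OF B(1)[unfolded OpenBall], of u]) (use u(2) OpenBall in auto)
      then show ?thesis
        using OpenBall B u by (intro exI[of _ u] exI[of _ e]) auto
    qed
  qed
  have closed_in: "ClosedBall (val v0 a) {c. emb a \<lesssim> x - emb c} \<in> A" if le: "emb a \<lesssim> x - emb c" for a c
  proof -
    obtain u e where u: "a \<lesssim>\<^sub>0 u - c" "c - u \<lesssim>\<^sub>0 e"
      "(ClosedBall (val v0 e) {w. e \<lesssim>\<^sub>0 w - u} \<in> A \<and> c - u \<lless>\<^sub>0 e) \<or>
      (\<exists>g. val v0 e = Val g \<and> OpenBall g {w. e \<lless>\<^sub>0 w - u} \<in> A)"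
      using smaller[OF le[unfolded le_iff]] by blast
    have closed_e: "ClosedBall (val v0 e) {w. e \<lesssim>\<^sub>0 w - u} \<in> A"
      using u(3) V.open_imp_closed by blast
    have "a \<lesssim>\<^sub>0 e" using K.trans[OF u(1)[unfolded K.le_minus_commute[of a u c]] u(2)] .
    then have "ClosedBall (val v0 a) {w. a \<lesssim>\<^sub>0 w - u} \<in> A"
    proof (cases "a \<lless>\<^sub>0 e")
      case True
      then show ?thesis using V.larger(1)[OF closed_e] by blast
    next
      case False
      then have "val v0 a = val v0 e" using \<open>a \<lesssim>\<^sub>0 e\<close> by (simp add: K.val_eq_iff K.same_def)
      then show ?thesis using closed_e V.same_closed[of a e u] by simp
    qed
    then show ?thesis using closed_set by simp
  qed
  have open_in: "OpenBall g {c. emb a \<lless> x - emb c} \<in> A"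
    if less: "emb a \<lless> x - emb c" and g: "val v0 a = Val g" for a c g
  proof -
    obtain u e where u: "a \<lless>\<^sub>0 u - c" "c - u \<lesssim>\<^sub>0 e"
      "(ClosedBall (val v0 e) {w. e \<lesssim>\<^sub>0 w - u} \<in> A \<and> c - u \<lless>\<^sub>0 e) \<or>
      (\<exists>g. val v0 e = Val g \<and> OpenBall g {w. e \<lless>\<^sub>0 w - u} \<in> A)"
      using smaller[OF less[unfolded less_iff]] by blast
    have closed_e: "ClosedBall (val v0 e) {w. e \<lesssim>\<^sub>0 w - u} \<in> A"
      using u(3) V.open_imp_closed by blast
    have "a \<lless>\<^sub>0 c - u" using u(1) K.minus_le_commute[of c u a] by blast
    then have "a \<lless>\<^sub>0 e" using u(2) K.trans by blast
    then have "OpenBall g {w. a \<lless>\<^sub>0 w - u} \<in> A"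
      using V.larger(2)[OF closed_e _ g] by blast
    then show ?thesis using open_set by simp
  qed
  have "B \<in> A \<longleftrightarrow> B \<in> appr emb v0 v x" for B
  proof (cases B)
    case (ClosedBall \<gamma> S)
    show ?thesis
    proof
      assume "B \<in> A"
      then obtain b where b: "b \<in> S" using N.points_nonempty[of B] ClosedBall by auto
      obtain a where a: "\<gamma> = val v0 a" "S = {u. a \<lesssim>\<^sub>0 u - b}"
        by (rule V.closed_memE[OF \<open>B \<in> A\<close>[unfolded ClosedBall] b])
      have "S = {c. emb a \<lesssim> x - emb c}"
        by (rule closed_set[OF _ a(2)]) (use \<open>B \<in> A\<close> ClosedBall a(1) in simp)
      then show "B \<in> appr emb v0 v x"
        using a(1) b unfolding ClosedBall closed_mem_appr by blast
    next
      assume "B \<in> appr emb v0 v x"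
      then show "B \<in> A"
        unfolding ClosedBall closed_mem_appr using closed_in by blast
    qed
  next
    case (OpenBall g S)
    show ?thesis
    proof
      assume "B \<in> A"
      then obtain b where b: "b \<in> S" using N.points_nonempty[of B] OpenBall by auto
      obtain a where a: "val v0 a = Val g" "S = {u. a \<lless>\<^sub>0 u - b}"
        by (rule V.open_memE[OF \<open>B \<in> A\<close>[unfolded OpenBall] b])
      have "S = {c. emb a \<lless> x - emb c}"
        by (rule open_set[OF _ a(2)]) (use \<open>B \<in> A\<close> OpenBall in simp)
      then show "B \<in> appr emb v0 v x"
        using a(1) b unfolding OpenBall open_mem_appr by blast
    next
      assume "B \<in> appr emb v0 v x"
      then show "B \<in> A"
        unfolding OpenBall open_mem_appr using open_in by blast
    qed
  qed
  then show ?thesis by blast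
qed

end

lemma transcendental_immediate_realized:
  fixes emb :: "'a::field \<Rightarrow> 'b::field" and v0 :: "('a, 'g) krull"
  assumes v0: "valuation v0" and x: "simple_transcendental emb x"
    and A: "approximation_type v0 A" and TI: "transcendental_immediate v0 A"
  obtains v :: "('b, 'b set) krull" where "pure_extension emb x v0 v" "appr emb v0 v x = A"
proof -
  have imm: "immediate A" using TI by (simp add: transcendental_immediate_def)
  interpret V: valued_approximation_type v0 A
    using v0 A by unfold_locales
  interpret N: nonempty_approximation_type v0 A
    using v0 A imm by unfold_locales (auto simp: immediate_def)
  let ?F = "ball_filter A"
  define G where "G f g \<longleftrightarrow> eventually (\<lambda>c. val_le v0 (poly f c) (poly g c)) ?F" for f g
  have const: "(\<exists>a. eventually (\<lambda>c. V.same (poly f c) a) ?F)" for f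
    using N.eventually_constant[OF TI] by metis
  have dichotomy: "G f g \<or> eventually (\<lambda>c. \<not> val_le v0 (poly f c) (poly g c)) ?F" for f g
  proof -
    obtain a b where ab: "eventually (\<lambda>c. V.same (poly f c) a) ?F" "eventually (\<lambda>c. V.same (poly g c) b) ?F"
      using const by metis
    then have "eventually (\<lambda>c. val_le v0 (poly f c) (poly g c) \<longleftrightarrow> val_le v0 a b) ?F"
      by eventually_elim (simp add: V.same_le_left V.same_le_right)
    then show ?thesis
      unfolding G_def by (cases "val_le v0 a b") (auto elim: eventually_mono)
  qed
  interpret poly_preorder G
  proof
    show "G f g \<or> G g f" for f g
      using dichotomy[of f g] V.less_imp_le unfolding G_def by (blast intro: eventually_mono)
    show "G f h" if "G f g" "G g h" for f g h
      using that unfolding G_def by eventually_elim (rule V.trans)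
    show "G (h * f) (h * g) \<longleftrightarrow> G f g" if "h \<noteq> 0" for f g h
      unfolding G_def
      by (rule eventually_cong[OF eventually_mono[OF N.eventually_nonzero[OF imm that]] refl] |
        rule eventually_subst[OF eventually_mono[OF N.eventually_nonzero[OF imm that]]])
        (simp add: V.mult_le_cancel_left)
    show "G f (g + h)" if "G f g" "G f h" for f g h
      using that unfolding G_def by eventually_elim (simp add: V.add)
    show "\<not> G 0 1"
      using V.zero_not_le_one N.ball_filter_nontrivial by (simp add: G_def)
  qed
  have "G [:a:] [:b:] \<longleftrightarrow> val_le v0 a b" for a b
    using N.ball_filter_nontrivial by (simp add: G_def)
  then obtain v :: "('b, 'b set) krull" where gen: "transcendental_generator emb v0 v x"
    and v: "\<And>f g. val_le v (eval_at emb x f) (eval_at emb x g) \<longleftrightarrow> G f g"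
    using extension_exists[OF v0 x] by blast
  have "appr emb v0 v x = A"
    by (rule transcendental_generator.appr_eqI_transcendental_immediate[OF gen A TI])
      (use v in \<open>simp add: G_def\<close>)
  moreover from this have "pure_extension emb x v0 v"
    using gen TI
    by (simp add: pure_extension_def transcendental_generator_def rational_extension_def
        valued_extension_def valued_extension_axioms_def)
  ultimately show thesis using that by blast
qed

subsection \<open>Approximation types with a common center\<close>

context valued_approximation_type
begin

text \<open>Radii are represented by elements of \<open>K\<close> that have them as values.\<close>

definition closed_radius :: "'a \<Rightarrow> bool" where
  "closed_radius a \<longleftrightarrow> val v0 a \<in> supp A"

definition open_radius :: "'a \<Rightarrow> bool" where
  "open_radius a \<longleftrightarrow> a \<noteq> 0 \<and> open_at A (val v0 a) \<noteq> {}"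

lemma mem_of_center: "b \<in> meet A \<Longrightarrow> B \<in> A \<Longrightarrow> b \<in> points B"
  by (simp add: meet_def)

text \<open>All balls contain the common center \<open>b\<close>, so the type is determined by its radii.\<close>

lemma closed_radius_iff:
  assumes b: "b \<in> meet A"
  shows "closed_radius a \<longleftrightarrow> ClosedBall (val v0 a) {u. a \<lesssim>\<^sub>K u - b} \<in> A"
proof
  assume "closed_radius a"
  then obtain S where S: "ClosedBall (val v0 a) S \<in> A"
    unfolding closed_radius_def supp_def by blast
  have "b \<in> S" using mem_of_center[OF b S] by simp
  obtain e where e: "val v0 a = val v0 e" "S = {u. e \<lesssim>\<^sub>K u - b}"
    by (rule closed_memE[OF S \<open>b \<in> S\<close>])
  then show "ClosedBall (val v0 a) {u. a \<lesssim>\<^sub>K u - b} \<in> A"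
    using S same_closed[OF e(1), of b] by simp
qed (auto simp: closed_radius_def supp_def)

lemma open_radius_iff:
  assumes b: "b \<in> meet A" and g: "val v0 a = Val g"
  shows "open_radius a \<longleftrightarrow> OpenBall g {u. a \<lless>\<^sub>K u - b} \<in> A"
proof -
  have a: "a \<noteq> 0" using g by auto
  show ?thesis
  proof
    assume "open_radius a"
    then obtain S where S: "OpenBall g S \<in> A"
      unfolding open_radius_def open_at_def g by blast
    have "b \<in> S" using mem_of_center[OF b S] by simp
    obtain e where e: "val v0 e = Val g" "S = {u. e \<lless>\<^sub>K u - b}"
      by (rule open_memE[OF S \<open>b \<in> S\<close>])
    then have "{u. a \<lless>\<^sub>K u - b} = S" using same_open[of a e b] g by simp
    then show "OpenBall g {u. a \<lless>\<^sub>K u - b} \<in> A" using S by simp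
  next
    assume B: "OpenBall g {u. a \<lless>\<^sub>K u - b} \<in> A"
    have "b \<in> {u. a \<lless>\<^sub>K u - b}" using a by (simp add: zero_le_iff)
    then show "open_radius a"
      unfolding open_radius_def open_at_def g using a B by blast
  qed
qed

lemma closed_mem_iff:
  assumes b: "b \<in> meet A"
  shows "ClosedBall \<gamma> S \<in> A \<longleftrightarrow> (\<exists>a. \<gamma> = val v0 a \<and> closed_radius a \<and> S = {u. a \<lesssim>\<^sub>K u - b})"
proof
  assume S: "ClosedBall \<gamma> S \<in> A"
  have "b \<in> S" using mem_of_center[OF b S] by simp
  obtain a where "\<gamma> = val v0 a" "S = {u. a \<lesssim>\<^sub>K u - b}"
    by (rule closed_memE[OF S \<open>b \<in> S\<close>])
  then show "\<exists>a. \<gamma> = val v0 a \<and> closed_radius a \<and> S = {u. a \<lesssim>\<^sub>K u - b}"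
    using S closed_radius_iff[OF b, of a] by blast
qed (use closed_radius_iff[OF b] in blast)

lemma open_mem_iff:
  assumes b: "b \<in> meet A"
  shows "OpenBall g S \<in> A \<longleftrightarrow> (\<exists>a. val v0 a = Val g \<and> open_radius a \<and> S = {u. a \<lless>\<^sub>K u - b})"
proof
  assume S: "OpenBall g S \<in> A"
  have "b \<in> S" using mem_of_center[OF b S] by simp
  obtain a where a: "val v0 a = Val g" "S = {u. a \<lless>\<^sub>K u - b}"
    by (rule open_memE[OF S \<open>b \<in> S\<close>])
  then show "\<exists>a. val v0 a = Val g \<and> open_radius a \<and> S = {u. a \<lless>\<^sub>K u - b}"
    using S open_radius_iff[OF b a(1)] by blast
qed (use open_radius_iff[OF b] in blast)

lemma closed_radius_mono:
  assumes b: "b \<in> meet A" and "closed_radius a" "e \<lesssim>\<^sub>K a"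
  shows "closed_radius e"
proof (cases "e \<lless>\<^sub>K a")
  case True
  then show ?thesis
    using assms(2) larger(1)[of a b e] by (simp add: closed_radius_iff[OF b])
next
  case False
  then have "val v0 e = val v0 a" using assms(3) by (simp add: val_eq_iff same_def)
  then show ?thesis using assms(2) by (simp add: closed_radius_def)
qed

lemma open_radius_if_less:
  assumes b: "b \<in> meet A" and "closed_radius a" "e \<lless>\<^sub>K a"
  shows "open_radius e"
proof -
  have "e \<noteq> 0" using assms(3) by auto
  then obtain g where g: "val v0 e = Val g" by (cases rule: val_cases[of e]) auto
  show ?thesis
    using assms(2) larger(2)[OF _ assms(3) g, of b]
    by (simp add: closed_radius_iff[OF b] open_radius_iff[OF b g])
qed

lemma open_radius_closed:
  assumes b: "b \<in> meet A" and "open_radius a"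
  shows "closed_radius a"
proof -
  have "a \<noteq> 0" using assms(2) by (simp add: open_radius_def)
  then obtain g where g: "val v0 a = Val g" by (cases rule: val_cases[of a]) auto
  show ?thesis
    using assms(2) open_imp_closed[OF _ g, of b]
    by (simp add: closed_radius_iff[OF b] open_radius_iff[OF b g])
qed

lemma value_extending_radii:
  assumes "value_extending A" and b: "b \<in> meet A"
  shows "open_radius a \<longleftrightarrow> closed_radius a" and "\<not> closed_radius 0"
proof -
  show "\<not> closed_radius 0"
    using assms(1) by (simp add: value_extending_def trivial_def closed_radius_def)
  then show "open_radius a \<longleftrightarrow> closed_radius a"
    using open_radius_closed[OF b] assms(1)
    unfolding value_extending_def open_radius_def closed_radius_def by metis
qed

text \<open>Let \<open>\<gamma>\<close> be a radius for which \<open>b\<close> lies in the closed but not in the open ball. The open ball of radius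
  \<open>\<gamma>\<close> is then missing, as it would contain \<open>b\<close>, and therefore all balls of greater radius are missing.\<close>

lemma residue_extending_radii:
  assumes "residue_extending A" and b: "b \<in> meet A"
  obtains a0 where "a0 \<noteq> 0" "\<And>a. closed_radius a \<longleftrightarrow> a \<lesssim>\<^sub>K a0" "\<And>a. open_radius a \<longleftrightarrow> a \<lless>\<^sub>K a0"
proof -
  obtain \<gamma> where \<gamma>: "\<gamma> \<in> supp A" "b \<in> closed_at A \<gamma> - open_at A \<gamma>"
    using assms(1) unfolding residue_extending_def by blast
  then obtain S where "ClosedBall \<gamma> S \<in> A" unfolding supp_def by blast
  then obtain a0 where a0: "\<gamma> = val v0 a0" "closed_radius a0"
    unfolding closed_mem_iff[OF b] by blast
  have nz: "a0 \<noteq> 0"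
    using a0 assms(1) by (auto simp: residue_extending_def trivial_def closed_radius_def)
  then obtain g where g: "val v0 a0 = Val g" by (cases rule: val_cases[of a0]) auto
  have not_open: "\<not> open_radius e" if e: "val v0 e = val v0 a0" for e
  proof
    assume "open_radius e"
    then obtain S where S: "OpenBall g S \<in> A"
      unfolding open_radius_def open_at_def e g by blast
    then have "b \<in> S" using mem_of_center[OF b S] by simp
    then have "b \<in> open_at A \<gamma>" unfolding open_at_def a0 g using S by blast
    then show False using \<gamma>(2) by blast
  qed
  have "a \<lesssim>\<^sub>K a0" if "closed_radius a" for a
    using open_radius_if_less[OF b that] not_open by blast
  then have closed: "closed_radius a \<longleftrightarrow> a \<lesssim>\<^sub>K a0" for a
    using closed_radius_mono[OF b a0(2)] by blast
  have "a \<lless>\<^sub>K a0" if "open_radius a" for a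
    using not_open that open_radius_closed[OF b that] closed[of a] val_eq_iff[of a a0]
    by (auto simp: same_def)
  then have "open_radius a \<longleftrightarrow> a \<lless>\<^sub>K a0" for a
    using open_radius_if_less[OF b a0(2)] by blast
  then show thesis using that nz closed by blast
qed

end

context transcendental_generator
begin

lemma appr_eqI_center:
  assumes A: "approximation_type v0 A" and b: "b \<in> meet A"
    and closed: "\<And>a c. emb a \<lesssim> x - emb c \<longleftrightarrow>
      valued_approximation_type.closed_radius v0 A a \<and> a \<lesssim>\<^sub>0 c - b"
    and opened: "\<And>a c. emb a \<lless> x - emb c \<longleftrightarrow>
      valued_approximation_type.open_radius v0 A a \<and> a \<lless>\<^sub>0 c - b"
  shows "appr emb v0 v x = A"
proof -
  interpret V: valued_approximation_type v0 A
    using A by unfold_locales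
  have bb: "a \<lesssim>\<^sub>0 b - b" "V.open_radius a \<Longrightarrow> a \<lless>\<^sub>0 b - b" for a
    by (auto simp: K.zero_le_iff V.open_radius_def)
  have "B \<in> appr emb v0 v x \<longleftrightarrow> B \<in> A" for B
  proof (cases B)
    case (ClosedBall \<gamma> S)
    show ?thesis
      unfolding ClosedBall closed_mem_appr closed V.closed_mem_iff[OF b] using bb(1) by blast
  next
    case (OpenBall g S)
    show ?thesis
      unfolding OpenBall open_mem_appr opened V.open_mem_iff[OF b] using bb(2) by blast
  qed
  then show ?thesis by blast
qed

end

subsection \<open>Monomial valuations\<close>

text \<open>The relation \<open>Q c n\<close> stands for \<open>v\<^sub>0(c) + n \<alpha> \<ge> 0\<close>, where \<open>\<alpha>\<close> is the value that the generator is to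
  obtain. It is the cone of nonnegative elements of the group generated by \<open>v\<^sub>0K\<close> and \<open>\<alpha>\<close>.\<close>

locale monomial_cone = krull_valuation v0
  for v0 :: "('a::field, 'g) krull" +
  fixes Q :: "'a \<Rightarrow> int \<Rightarrow> bool"
  assumes Q_mult: "c \<noteq> 0 \<Longrightarrow> d \<noteq> 0 \<Longrightarrow> Q c n \<Longrightarrow> Q d m \<Longrightarrow> Q (c * d) (n + m)"
    and Q_total: "c \<noteq> 0 \<Longrightarrow> Q c n \<or> Q (inverse c) (- n)"
    and Q_zero: "c \<noteq> 0 \<Longrightarrow> Q c 0 \<longleftrightarrow> val_le v0 1 c"
begin

text \<open>The relation \<open>v\<^sub>0(c) + i \<alpha> \<le> v\<^sub>0(d) + j \<alpha>\<close> between monomials.\<close>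

definition mle :: "'a \<Rightarrow> nat \<Rightarrow> 'a \<Rightarrow> nat \<Rightarrow> bool" where
  "mle c i d j \<longleftrightarrow> d = 0 \<or> (c \<noteq> 0 \<and> Q (d / c) (int j - int i))"

lemma mle_zero [simp]: "mle c i 0 j" and mle_zero_left: "mle 0 i d j \<longleftrightarrow> d = 0"
  by (auto simp: mle_def)

lemma mle_total: "mle c i d j \<or> mle d j c i"
  using Q_total[of "d / c" "int j - int i"] by (auto simp: mle_def)

lemma mle_trans: "mle c i d j \<Longrightarrow> mle d j e k \<Longrightarrow> mle c i e k"
proof (cases "e = 0")
  case False
  assume "mle c i d j" "mle d j e k"
  then have "c \<noteq> 0" "d \<noteq> 0" "Q (d / c) (int j - int i)" "Q (e / d) (int k - int j)"
    using False by (auto simp: mle_def)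
  then show ?thesis
    using Q_mult[of "d / c" "e / d" "int j - int i" "int k - int j"] False by (simp add: mle_def)
qed simp

lemma mle_refl [simp]: "mle c i c i"
  using mle_total by blast

lemma mle_mult: "c \<noteq> 0 \<Longrightarrow> mle (c * d) (i + j) (c * e) (i + k) \<longleftrightarrow> mle d j e k"
  by (auto simp: mle_def)

lemma mle_same_exponent: "mle c i d i \<longleftrightarrow> val_le v0 c d"
proof (cases "c = 0 \<or> d = 0")
  case False
  then have "d / c \<noteq> 0" by simp
  then show ?thesis
    using False Q_zero[of "d / c"] le_divide_iff[of c 1 d] by (simp add: mle_def)
qed (auto simp: mle_def zero_le_iff)

lemma mle_mono: "mle c i c' i' \<Longrightarrow> mle d j d' j' \<Longrightarrow> mle (c * d) (i + j) (c' * d') (i' + j')"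
proof (cases "c = 0 \<or> d' = 0")
  case False
  assume *: "mle c i c' i'" "mle d j d' j'"
  have "mle (c * d) (i + j) (c * d') (i + j')"
    using * False mle_mult[of c d i j d' j'] by simp
  moreover have "mle (c * d') (i + j') (c' * d') (i' + j')"
    using * False mle_mult[of d' c j' i c' i'] by (simp add: mult.commute add.commute)
  ultimately show ?thesis by (rule mle_trans)
qed (auto simp: mle_zero_left)

lemma mle_strict_mono:
  assumes "\<not> mle c' i' c i" "mle d j d' j'" "d \<noteq> 0"
  shows "\<not> mle (c' * d') (i' + j') (c * d) (i + j)"
proof
  assume le: "mle (c' * d') (i' + j') (c * d) (i + j)"
  have c: "c \<noteq> 0" using assms(1) by auto
  then have d': "d' \<noteq> 0" using le assms(3) by (auto simp: mle_zero_left)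
  have "mle (c * d) (i + j) (c * d') (i + j')"
    using assms(2) c by (simp add: mle_mult)
  with le have "mle (c' * d') (i' + j') (c * d') (i + j')" by (rule mle_trans)
  then have "mle c' i' c i"
    using d' mle_mult[of d' c' j' i' c i] by (simp add: mult.commute add.commute)
  then show False using assms(1) by contradiction
qed

lemma mle_add: "mle c i d j \<Longrightarrow> mle c i e j \<Longrightarrow> mle c i (d + e) j"
proof -
  assume *: "mle c i d j" "mle c i e j"
  have "val_le v0 d (d + e) \<or> val_le v0 e (d + e)"
    using total[of d e] add[of d d e] add[of e d e] by auto
  then show ?thesis
    using * mle_trans unfolding mle_same_exponent[of _ j, symmetric] by blast
qed

lemma mle_sum: "(\<And>u. u \<in> I \<Longrightarrow> mle c i (f u) j) \<Longrightarrow> mle c i (sum f I) j"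
  by (induction I rule: infinite_finite_induct) (auto intro: mle_add)

definition minimal :: "'a poly \<Rightarrow> nat \<Rightarrow> bool" where
  "minimal f h \<longleftrightarrow> coeff f h \<noteq> 0 \<and>
    (\<forall>j. mle (coeff f h) h (coeff f j) j)"

lemma minimal_exists:
  assumes "f \<noteq> 0"
  shows "\<exists>h. minimal f h"
proof -
  have "\<exists>h\<in>I. \<forall>j\<in>I. mle (coeff f h) h (coeff f j) j"
    if "finite I" "I \<noteq> {}" for I
    using that
  proof (induction rule: finite_ne_induct)
    case (insert i I)
    then obtain h where "h \<in> I" "\<forall>j\<in>I. mle (coeff f h) h (coeff f j) j"
      by blast
    then show ?case
      using mle_total[of "coeff f h" h "coeff f i" i] mle_trans
      by (metis insert_iff mle_refl)
  qed simp
  then obtain h where h: "h \<le> degree f"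
    "\<And>j. j \<le> degree f \<Longrightarrow> mle (coeff f h) h (coeff f j) j"
    by (metis atMost_iff empty_iff finite_atMost order_refl)
  have le: "mle (coeff f h) h (coeff f j) j" for j
    using h(2)[of j] le_degree[of f j] by (cases "coeff f j = 0") auto
  moreover have "coeff f h \<noteq> 0"
    using le[of "degree f"] assms by (auto simp: mle_zero_left)
  ultimately show ?thesis unfolding minimal_def by blast
qed

definition first_minimal :: "'a poly \<Rightarrow> nat" where
  "first_minimal f = (LEAST h. minimal f h)"

lemma first_minimal:
  assumes "f \<noteq> 0"
  shows "minimal f (first_minimal f)"
    and "j < first_minimal f \<Longrightarrow>
      \<not> mle (coeff f j) j (coeff f (first_minimal f)) (first_minimal f)"
proof -
  show min: "minimal f (first_minimal f)"
    unfolding first_minimal_def using minimal_exists[OF assms] by (rule LeastI_ex)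
  assume j: "j < first_minimal f"
  show "\<not> mle (coeff f j) j (coeff f (first_minimal f)) (first_minimal f)"
  proof
    assume le: "mle (coeff f j) j (coeff f (first_minimal f)) (first_minimal f)"
    then have "coeff f j \<noteq> 0"
      using min by (auto simp: minimal_def mle_zero_left)
    then have "minimal f j"
      using le min mle_trans unfolding minimal_def by blast
    then show False using not_less_Least j unfolding first_minimal_def by blast
  qed
qed

text \<open>Gauss's lemma. Among the products of terms of \<open>f\<close> and \<open>g\<close> of total degree \<open>h + k\<close>, the product of
  the first minimal terms is the only one of least value, so it is not cancelled.\<close>

lemma minimal_mult:
  assumes "f \<noteq> 0" "g \<noteq> 0"
  defines "h \<equiv> first_minimal f" and "k \<equiv> first_minimal g"
  shows "minimal (f * g) (h + k)"
    and "same (coeff (f * g) (h + k)) (coeff f h * coeff g k)"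
proof -
  let ?f = "coeff f" and ?g = "coeff g"
  let ?t = "\<lambda>i. ?f i * ?g (h + k - i)"
  have f: "?f h \<noteq> 0" "mle (?f h) h (?f j) j" "j < h \<Longrightarrow> \<not> mle (?f j) j (?f h) h" for j
    using first_minimal[OF assms(1)] by (auto simp: h_def minimal_def)
  have g: "?g k \<noteq> 0" "mle (?g k) k (?g j) j" "j < k \<Longrightarrow> \<not> mle (?g j) j (?g k) k" for j
    using first_minimal[OF assms(2)] by (auto simp: k_def minimal_def)
  \<comment> \<open>A term of the coefficient of index \<open>h + k\<close> other than \<open>?f h * ?g k\<close> has an index below
    \<open>h\<close> in \<open>f\<close> or an index below \<open>k\<close> in \<open>g\<close>.\<close>
  have "\<not> val_le v0 (?t i) (?f h * ?g k)" if i: "i \<le> h + k" "i \<noteq> h" for i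
  proof (cases "i < h")
    case True
    have "\<not> mle (?f i * ?g (h + k - i)) (i + (h + k - i)) (?f h * ?g k) (h + k)"
      by (rule mle_strict_mono[OF f(3)[OF True] g(2) g(1)])
    then show ?thesis using i(1) by (simp add: mle_same_exponent)
  next
    case False
    then have "h + k - i < k" using i by simp
    then have "\<not> mle (?g (h + k - i) * ?f i) (h + k - i + i) (?g k * ?f h) (k + h)"
      by (intro mle_strict_mono g(3) f(2) f(1))
    then show ?thesis using i(1) by (simp add: mle_same_exponent mult.commute add.commute)
  qed
  then have "close (sum ?t {..h + k}) (?t h)"
    using f(1) g(1) by (intro close_sum) auto
  then show same: "same (coeff (f * g) (h + k)) (?f h * ?g k)"
    using close_same by (simp add: coeff_mult)
  have le: "mle (?f h * ?g k) (h + k) (coeff (f * g) j) j" for j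
    unfolding coeff_mult
  proof (rule mle_sum)
    fix i assume "i \<in> {..j}"
    then show "mle (?f h * ?g k) (h + k) (?f i * ?g (j - i)) j"
      using mle_mono[OF f(2)[of i] g(2)[of "j - i"]] by simp
  qed
  have "coeff (f * g) (h + k) \<noteq> 0"
    using same_imp_zero_iff[OF same] f(1) g(1) by simp
  moreover have "mle (coeff (f * g) (h + k)) (h + k) (?f h * ?g k) (h + k)"
    using same by (simp add: mle_same_exponent same_def)
  ultimately show "minimal (f * g) (h + k)"
    using le mle_trans unfolding minimal_def by blast
qed

definition gauss_le :: "'a poly \<Rightarrow> 'a poly \<Rightarrow> bool" where
  "gauss_le f g \<longleftrightarrow> g = 0 \<or> (\<exists>i. coeff f i \<noteq> 0 \<and>
    (\<forall>j. mle (coeff f i) i (coeff g j) j))"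

lemma gauss_le_minimal:
  assumes "minimal f h" "minimal g k"
  shows "gauss_le f g \<longleftrightarrow> mle (coeff f h) h (coeff g k) k"
proof
  assume "gauss_le f g"
  moreover have "g \<noteq> 0" using assms(2) by (auto simp: minimal_def)
  ultimately show "mle (coeff f h) h (coeff g k) k"
    using assms mle_trans unfolding gauss_le_def minimal_def by blast
next
  assume "mle (coeff f h) h (coeff g k) k"
  then show "gauss_le f g"
    using assms mle_trans unfolding gauss_le_def minimal_def by blast
qed

lemma gauss_le_zero_left: "gauss_le 0 g \<longleftrightarrow> g = 0" and gauss_le_zero: "gauss_le f 0"
  by (auto simp: gauss_le_def)

lemma gauss_le_mult:
  assumes "p \<noteq> 0"
  shows "gauss_le (p * f) (p * g) \<longleftrightarrow> gauss_le f g"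
proof (cases "f = 0 \<or> g = 0")
  case True
  then show ?thesis using assms by (auto simp: gauss_le_zero_left gauss_le_zero)
next
  case False
  let ?l = "first_minimal p" and ?h = "first_minimal f" and ?k = "first_minimal g"
  let ?p = "coeff p ?l" and ?f = "coeff f ?h" and ?g = "coeff g ?k"
  have nz: "f \<noteq> 0" "g \<noteq> 0" using False by auto
  note mf = minimal_mult[OF assms nz(1)] and mg = minimal_mult[OF assms nz(2)]
  have "?p \<noteq> 0" using first_minimal(1)[OF assms] by (simp add: minimal_def)
  have "gauss_le (p * f) (p * g) \<longleftrightarrow>
      mle (coeff (p * f) (?l + ?h)) (?l + ?h) (coeff (p * g) (?l + ?k)) (?l + ?k)"
    by (rule gauss_le_minimal[OF mf(1) mg(1)])
  also have "\<dots> \<longleftrightarrow> mle (?p * ?f) (?l + ?h) (?p * ?g) (?l + ?k)"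
  proof -
    have "mle (coeff (p * f) (?l + ?h)) (?l + ?h) (?p * ?f) (?l + ?h)"
      "mle (?p * ?f) (?l + ?h) (coeff (p * f) (?l + ?h)) (?l + ?h)"
      "mle (coeff (p * g) (?l + ?k)) (?l + ?k) (?p * ?g) (?l + ?k)"
      "mle (?p * ?g) (?l + ?k) (coeff (p * g) (?l + ?k)) (?l + ?k)"
      using mf(2) mg(2) by (simp_all add: mle_same_exponent same_def)
    then show ?thesis using mle_trans by blast
  qed
  also have "\<dots> \<longleftrightarrow> mle ?f ?h ?g ?k"
    using \<open>?p \<noteq> 0\<close> by (rule mle_mult)
  also have "\<dots> \<longleftrightarrow> gauss_le f g"
    using gauss_le_minimal[OF first_minimal(1) first_minimal(1)] nz by simp
  finally show ?thesis .
qed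

sublocale gauss: poly_preorder gauss_le
proof
  show "gauss_le f g \<or> gauss_le g f" for f g
  proof (cases "f = 0 \<or> g = 0")
    case False
    then show ?thesis
      using gauss_le_minimal[OF first_minimal(1) first_minimal(1)] mle_total by simp
  qed (auto simp: gauss_le_zero)
  show "gauss_le f h" if fg: "gauss_le f g" and gh: "gauss_le g h" for f g h
  proof (cases "h = 0")
    case False
    then have "g \<noteq> 0" using gh by (auto simp: gauss_le_zero_left)
    then have "f \<noteq> 0" using fg by (auto simp: gauss_le_zero_left)
    have "mle (coeff f (first_minimal f)) (first_minimal f)
        (coeff g (first_minimal g)) (first_minimal g)"
      using fg gauss_le_minimal first_minimal(1) \<open>f \<noteq> 0\<close> \<open>g \<noteq> 0\<close> by blast
    moreover have "mle (coeff g (first_minimal g)) (first_minimal g)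
        (coeff h (first_minimal h)) (first_minimal h)"
      using gh gauss_le_minimal first_minimal(1) \<open>g \<noteq> 0\<close> False by blast
    ultimately show ?thesis
      using gauss_le_minimal[OF first_minimal(1) first_minimal(1)] mle_trans \<open>f \<noteq> 0\<close> False by blast
  qed (simp add: gauss_le_zero)
  show "gauss_le (h * f) (h * g) \<longleftrightarrow> gauss_le f g" if "h \<noteq> 0" for f g h
    using that by (rule gauss_le_mult)
  show "gauss_le f (g + h)" if fg: "gauss_le f g" and fh: "gauss_le f h" for f g h
  proof (cases "f = 0")
    case True
    then show ?thesis using fg fh by (simp add: gauss_le_zero_left)
  next
    case False
    let ?m = "first_minimal f"
    have min: "minimal f ?m" using False by (rule first_minimal(1))
    have "mle (coeff f ?m) ?m (coeff p j) j" if "gauss_le f p" for p j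
      using that min mle_trans unfolding gauss_le_def minimal_def by (metis coeff_0 mle_zero)
    then have "mle (coeff f ?m) ?m (coeff (g + h) j) j" for j
      using fg fh by (simp add: mle_add)
    then show ?thesis using min unfolding gauss_le_def minimal_def by blast
  qed
  show "\<not> gauss_le 0 1" by (simp add: gauss_le_zero_left)
qed

lemma gauss_le_const: "gauss_le [:a:] [:b:] \<longleftrightarrow> val_le v0 a b"
proof (cases "a = 0 \<or> b = 0")
  case False
  then have "minimal [:a:] 0" "minimal [:b:] 0"
    by (auto simp: minimal_def coeff_pCons split: nat.splits)
  then show ?thesis using gauss_le_minimal[of "[:a:]" 0 "[:b:]" 0] by (simp add: mle_same_exponent)
qed (auto simp: gauss_le_zero_left gauss_le_zero zero_le_iff)

lemma gauss_le_const_linear: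
  "gauss_le [:a:] [:e, 1:] \<longleftrightarrow> a \<noteq> 0 \<and> val_le v0 a e \<and> Q (inverse a) 1"
proof -
  have coeff_a: "coeff [:a:] i = (if i = 0 then a else 0)"
    and coeff_e: "coeff [:e, 1:] i = (if i = 0 then e else if i = 1 then 1 else 0)" for i
    by (auto simp: coeff_pCons split: nat.splits)
  have "gauss_le [:a:] [:e, 1:] \<longleftrightarrow> a \<noteq> 0 \<and> (\<forall>j. mle a 0 (coeff [:e, 1:] j) j)"
    unfolding gauss_le_def coeff_a by auto
  also have "(\<forall>j. mle a 0 (coeff [:e, 1:] j) j) \<longleftrightarrow> mle a 0 e 0 \<and> mle a 0 1 1"
    unfolding coeff_e by auto
  finally show ?thesis
    by (auto simp: mle_same_exponent mle_def inverse_eq_divide)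
qed

lemma gauss_le_linear_const:
  "gauss_le [:e, 1:] [:a:] \<longleftrightarrow> a = 0 \<or> val_le v0 e a \<or> Q a (- 1)"
proof -
  have coeff_a: "coeff [:a:] i = (if i = 0 then a else 0)"
    and coeff_e: "coeff [:e, 1:] i = (if i = 0 then e else if i = 1 then 1 else 0)" for i
    by (auto simp: coeff_pCons split: nat.splits)
  have "gauss_le [:e, 1:] [:a:] \<longleftrightarrow> a = 0 \<or> (\<exists>i. coeff [:e, 1:] i \<noteq> 0 \<and>
      mle (coeff [:e, 1:] i) i a 0)"
    unfolding gauss_le_def coeff_a by auto
  also have "(\<exists>i. coeff [:e, 1:] i \<noteq> 0 \<and> mle (coeff [:e, 1:] i) i a 0) \<longleftrightarrow>
      (e \<noteq> 0 \<and> mle e 0 a 0) \<or> mle 1 1 a 0"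
    unfolding coeff_e by auto
  finally show ?thesis
    by (auto simp: mle_same_exponent mle_def zero_le_iff)
qed

lemma gauss_le_monom: "gauss_le (monom c i) (monom d j) \<longleftrightarrow> mle c i d j"
proof (cases "c = 0 \<or> d = 0")
  case False
  then have "minimal (monom c i) i" "minimal (monom d j) j"
    by (auto simp: minimal_def)
  then show ?thesis using gauss_le_minimal[of "monom c i" i "monom d j" j] by simp
qed (auto simp: gauss_le_zero_left gauss_le_zero mle_zero_left)

lemma gauss_le_term: "gauss_le f (monom (coeff f i) i)"
proof (cases "f = 0")
  case False
  then show ?thesis
    using first_minimal(1)[OF False] unfolding gauss_le_def minimal_def
    by (metis coeff_monom mle_zero)
qed (simp add: gauss_le_zero)

end

subsection \<open>Realizing value-extending and residue-extending approximation types\<close>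

text \<open>The two conditions say that \<open>\<alpha>\<close> lies in the cut of the radii of \<open>A\<close>, and \<open>v (x - c)\<close> is the
  minimum of \<open>\<alpha>\<close> and \<open>v\<^sub>0(b - c)\<close>.\<close>

lemma monomial_cone_realized:
  fixes emb :: "'a::field \<Rightarrow> 'b::field" and v0 :: "('a, 'g) krull"
  assumes v0: "valuation v0" and x: "simple_transcendental emb x"
    and A: "approximation_type v0 A" and b: "b \<in> meet A" and Q: "monomial_cone v0 Q"
    and closed: "\<And>a. valued_approximation_type.closed_radius v0 A a \<longleftrightarrow> a \<noteq> 0 \<and> Q (inverse a) 1"
    and opened: "\<And>a. valued_approximation_type.open_radius v0 A a \<longleftrightarrow> a \<noteq> 0 \<and> \<not> Q a (- 1)"
  obtains v :: "('b, 'b set) krull" where "transcendental_generator emb v0 v x" "appr emb v0 v x = A"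
    "\<And>f g. val_le v (eval_at emb (x - emb b) f) (eval_at emb (x - emb b) g) \<longleftrightarrow>
      monomial_cone.gauss_le Q f g"
proof -
  interpret Q: monomial_cone v0 Q by fact
  interpret field_emb emb
    using x by unfold_locales (simp add: simple_transcendental_def)
  define t where "t = x - emb b"
  have "simple_transcendental emb t"
    using simple_transcendental_affine[OF x, of 1 b] by (simp add: t_def)
  then obtain v :: "('b, 'b set) krull" where gen_t: "transcendental_generator emb v0 v t"
    and le: "\<And>f g. val_le v (eval_at emb t f) (eval_at emb t g) \<longleftrightarrow> Q.gauss_le f g"
    using Q.gauss.extension_exists[OF v0 _ Q.gauss_le_const] by blast
  have gen_x: "transcendental_generator emb v0 v x"
    using transcendental_generator.shift_generator[OF gen_t, of "- b"] by (simp add: t_def emb_uminus)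
  interpret transcendental_generator emb v0 v x by fact
  have linear: "eval_at emb t [:b - c, 1:] = x - emb c" for c
    by (simp add: t_def emb_diff)
  have "val_le v (emb a) (x - emb c) \<longleftrightarrow>
      valued_approximation_type.closed_radius v0 A a \<and> val_le v0 a (c - b)" for a c
    using le[of "[:a:]" "[:b - c, 1:]"] Q.le_minus_commute[of a b c]
    unfolding linear Q.gauss_le_const_linear closed by auto
  moreover have "\<not> val_le v (x - emb c) (emb a) \<longleftrightarrow>
      valued_approximation_type.open_radius v0 A a \<and> \<not> val_le v0 (c - b) a" for a c
    using le[of "[:b - c, 1:]" "[:a:]"] Q.minus_le_commute[of b c a]
    unfolding linear Q.gauss_le_linear_const opened by auto
  ultimately have "appr emb v0 v x = A"
    by (rule appr_eqI_center[OF A b])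
  then show thesis using gen_x le that unfolding t_def by blast
qed

context krull_valuation
begin

lemma divisible_root:
  assumes "divisible_group (vgroup v)" "n > 0"
  obtains e where "same (e ^ n) c"
proof (cases rule: val_cases[of c])
  case 1
  then show ?thesis using that[of 0] assms(2) by (simp add: power_0_left)
next
  case (2 \<gamma>)
  then obtain \<delta> where \<delta>: "\<delta> \<in> carrier (vgroup v)" "\<delta> [^]\<^bsub>vgroup v\<^esub> n = \<gamma>"
    using assms unfolding divisible_group_def by blast
  then obtain e where "val v e = Val \<delta>" using carrier_iff by blast
  then have "val v (e ^ n) = val v c" using val_power \<delta>(2) 2(2) by simp
  then show thesis using that by (simp add: val_eq_iff)
qed

text \<open>The values of the elements of \<open>D\<close> are those below \<open>\<alpha>\<close>. For \<open>n > 0\<close> the condition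
  \<open>v(c) + n \<alpha> \<ge> 0\<close> is required to hold with a value below \<open>\<alpha>\<close> in place of \<open>\<alpha>\<close>, and for
  \<open>n < 0\<close> with one above \<open>\<alpha>\<close>.\<close>

definition cut_cone :: "('k \<Rightarrow> bool) \<Rightarrow> 'k \<Rightarrow> int \<Rightarrow> bool" where
  "cut_cone D c n \<longleftrightarrow> (if n = 0 then val_le v 1 c
    else if n > 0 then \<exists>e. D e \<and> val_le v 1 (c * e ^ nat n)
    else \<exists>e. \<not> D e \<and> val_le v (e ^ nat (- n)) c)"

text \<open>By divisibility, \<open>- v(c) / n\<close> lies on one side of the cut, which makes the cone total. It is
  closed under addition because the values on the lower side of the cut are less than those on
  the upper side.\<close>

lemma cut_cone_monomial_cone:
  assumes div: "divisible_group (vgroup v)"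
    and mono: "\<And>a e. D a \<Longrightarrow> val_le v e a \<Longrightarrow> D e" and D0: "\<not> D 0"
  shows "monomial_cone v (cut_cone D)"
proof
  have pos: "cut_cone D c n \<longleftrightarrow> (\<exists>e. D e \<and> val_le v 1 (c * e ^ k))" if "n = int k" "k > 0" for c n k
    using that by (simp add: cut_cone_def)
  have neg: "cut_cone D c n \<longleftrightarrow> (\<exists>e. \<not> D e \<and> val_le v (e ^ k) c)" if "n = - int k" "k > 0" for c n k
    using that by (simp add: cut_cone_def)
  have zero: "cut_cone D c 0 \<longleftrightarrow> val_le v 1 c" for c
    by (simp add: cut_cone_def)
  then show "cut_cone D c 0 \<longleftrightarrow> val_le v 1 c" for c .
  show "cut_cone D c n \<or> cut_cone D (inverse c) (- n)" if c: "c \<noteq> 0" for c n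
  proof -
    have *: "cut_cone D c (int k) \<or> cut_cone D (inverse c) (- int k)" if c: "c \<noteq> 0" and k: "k > 0" for c k
    proof -
      obtain e where e: "same (e ^ k) (inverse c)" using divisible_root[OF div k] .
      then have le: "val_le v (e ^ k) (inverse c)" "val_le v (inverse c) (e ^ k)"
        by (auto simp: same_def)
      have "val_le v 1 (c * e ^ k)" using mult_left[OF le(2), of c] c by simp
      then show ?thesis
        using le(1) pos[OF HOL.refl k, of c] neg[OF HOL.refl k, of "inverse c"] by blast
    qed
    consider "n = 0" | k where "k > 0" "n = int k" | k where "k > 0" "n = - int k"
      by (metis int_cases2 of_nat_0 minus_zero gr0I)
    then show ?thesis
    proof cases
      case 1
      have "val_le v 1 c \<or> val_le v 1 (inverse c)"
        using total[of 1 c] mult_right[of c 1 "inverse c"] c by auto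
      then show ?thesis using 1 zero by simp
    next
      case (2 k)
      then show ?thesis using *[OF c] by simp
    next
      case (3 k)
      then show ?thesis using *[of "inverse c" k] c by auto
    qed
  qed
  show "cut_cone D (c * d) (n + m)"
    if c: "c \<noteq> 0" and d: "d \<noteq> 0" and cn: "cut_cone D c n" and dm: "cut_cone D d m" for c d n m
  proof -
    have pos_pos: "cut_cone D (c * d) (int i + int j)"
      if i: "i > 0" "cut_cone D c (int i)" and j: "j > 0" "cut_cone D d (int j)" for c d i j
    proof -
      obtain e1 e2 where e: "D e1" "val_le v 1 (c * e1 ^ i)" "D e2" "val_le v 1 (d * e2 ^ j)"
        using i(2) j(2) unfolding pos[OF HOL.refl i(1)] pos[OF HOL.refl j(1)] by blast
      obtain e where m: "D e" "val_le v e1 e" "val_le v e2 e"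
        using total[of e1 e2] e(1,3) refl by blast
      have "val_le v 1 (c * e ^ i)" "val_le v 1 (d * e ^ j)"
        using trans[OF e(2) mult_left[OF power_mono[OF m(2)]]]
          trans[OF e(4) mult_left[OF power_mono[OF m(3)]]] .
      then have "val_le v (1 * 1) ((c * e ^ i) * (d * e ^ j))" by (rule mult_mono)
      moreover have "(c * e ^ i) * (d * e ^ j) = (c * d) * e ^ (i + j)"
        by (simp add: power_add mult_ac)
      ultimately show ?thesis
        using m(1) i(1) pos[of "int i + int j" "i + j"] by auto
    qed
    have neg_neg: "cut_cone D (c * d) (- int i - int j)"
      if i: "i > 0" "cut_cone D c (- int i)" and j: "j > 0" "cut_cone D d (- int j)" for c d i j
    proof -
      obtain e1 e2 where e: "\<not> D e1" "val_le v (e1 ^ i) c" "\<not> D e2" "val_le v (e2 ^ j) d"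
        using i(2) j(2) unfolding neg[OF HOL.refl i(1)] neg[OF HOL.refl j(1)] by blast
      obtain e where m: "\<not> D e" "val_le v e e1" "val_le v e e2"
        using total[of e1 e2] e(1,3) refl by blast
      have "val_le v (e ^ i) c" "val_le v (e ^ j) d"
        using trans[OF power_mono[OF m(2)] e(2)] trans[OF power_mono[OF m(3)] e(4)] .
      then have "val_le v (e ^ i * e ^ j) (c * d)" by (rule mult_mono)
      then have "val_le v (e ^ (i + j)) (c * d)" by (simp add: power_add)
      then show ?thesis
        using m(1) i(1) neg[of "- int i - int j" "i + j"] by auto
    qed
    have pos_neg: "cut_cone D (c * d) (int i - int j)"
      if i: "i > 0" "cut_cone D c (int i)" and j: "j > 0" "cut_cone D d (- int j)" and d: "d \<noteq> 0" for c d i j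
    proof -
      obtain e e' where e: "D e" "val_le v 1 (c * e ^ i)" "\<not> D e'" "val_le v (e' ^ j) d"
        using i(2) j(2) unfolding pos[OF HOL.refl i(1)] neg[OF HOL.refl j(1)] by blast
      have "e \<noteq> 0" using e(1) D0 by blast
      moreover have "e' \<noteq> 0"
        using e(4) d j(1) zero_le_iff[of d] by (cases "e' = 0") (simp_all add: power_0_left)
      ultimately have nz: "e ^ k \<noteq> 0" "e' ^ k \<noteq> 0" for k by simp_all
      have lt: "val_le v e e'" using mono[OF e(1)] e(3) total by blast
      consider "i = j" | k where "k > 0" "i = j + k" | k where "k > 0" "j = i + k"
        by (metis less_imp_add_positive nat_neq_iff)
      then show ?thesis
      proof cases
        case 1
        have "val_le v (1 * e ^ j) ((c * e ^ i) * d)"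
          using e(2) trans[OF power_mono[OF lt] e(4)] by (rule mult_mono)
        then have "val_le v (1 * e ^ j) ((c * d) * e ^ j)" using 1 by (simp add: mult_ac)
        then have "val_le v 1 (c * d)" by (simp only: mult_le_cancel_right[OF nz(1)])
        then show ?thesis using 1 zero by simp
      next
        case (2 k)
        have "val_le v (1 * e ^ j) ((c * e ^ i) * d)"
          using e(2) trans[OF power_mono[OF lt] e(4)] by (rule mult_mono)
        then have "val_le v (1 * e ^ j) ((c * d * e ^ k) * e ^ j)" using 2 by (simp add: power_add mult_ac)
        then have "val_le v 1 (c * d * e ^ k)" by (simp only: mult_le_cancel_right[OF nz(1)])
        then show ?thesis using 2 e(1) pos[of "int i - int j" k] by auto
      next
        case (3 k)
        have "val_le v 1 (c * e' ^ i)" using trans[OF e(2) mult_left[OF power_mono[OF lt]]] .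
        then have "val_le v (1 * e' ^ j) ((c * e' ^ i) * d)" using e(4) by (rule mult_mono)
        then have "val_le v (e' ^ k * e' ^ i) ((c * d) * e' ^ i)" using 3 by (simp add: power_add mult_ac)
        then have "val_le v (e' ^ k) (c * d)" by (simp only: mult_le_cancel_right[OF nz(2)])
        then show ?thesis using 3 e(3) neg[of "int i - int j" k] by auto
      qed
    qed
    have zero_any: "cut_cone D (c * d) n" if c: "val_le v 1 c" and d: "cut_cone D d n" for c d n
    proof -
      consider "n = 0" | k where "k > 0" "n = int k" | k where "k > 0" "n = - int k"
        by (metis int_cases2 of_nat_0 minus_zero gr0I)
      then show ?thesis
      proof cases
        case 1
        then show ?thesis using c d mult_mono[of 1 c 1 d] by (simp add: zero)
      next
        case (2 k)
        then obtain e where "D e" "val_le v 1 (d * e ^ k)" using d pos by blast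
        then show ?thesis using 2 pos[OF 2(2,1)] mult_mono[OF c, of 1 "d * e ^ k"] by (auto simp: mult.assoc)
      next
        case (3 k)
        then obtain e where "\<not> D e" "val_le v (e ^ k) d" using d neg by blast
        then show ?thesis using 3 neg[OF 3(2,1)] mult_mono[OF c, of "e ^ k" d] by auto
      qed
    qed
    consider "n = 0" | "m = 0" | i j where "i > 0" "n = int i" "j > 0" "m = int j"
      | i j where "i > 0" "n = int i" "j > 0" "m = - int j"
      | i j where "i > 0" "n = - int i" "j > 0" "m = int j"
      | i j where "i > 0" "n = - int i" "j > 0" "m = - int j"
      by (metis int_cases2 of_nat_0 minus_zero gr0I)
    then show ?thesis
    proof cases
      case 1
      then show ?thesis using zero_any[of c d m] cn dm zero by simp
    next
      case 2
      then show ?thesis using zero_any[of d c n] cn dm zero by (simp add: mult.commute)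
    next
      case (3 i j)
      then show ?thesis using pos_pos cn dm by simp
    next
      case (4 i j)
      then show ?thesis using pos_neg[of i c j d] cn dm d by simp
    next
      case (5 i j)
      then show ?thesis using pos_neg[of j d i c] cn dm c by (simp add: mult.commute)
    next
      case (6 i j)
      then show ?thesis using neg_neg[of i c j d] cn dm by simp
    qed
  qed
qed

text \<open>Here \<open>\<alpha>\<close> is the value of \<open>a0\<close>, which leads to the Gauss valuation.\<close>

lemma power_int_cone_monomial_cone:
  assumes "a0 \<noteq> 0"
  shows "monomial_cone v (\<lambda>c n. val_le v 1 (c * a0 powi n))"
proof
  fix c d :: 'k and n m :: int
  assume "c \<noteq> 0" "d \<noteq> 0" "val_le v 1 (c * a0 powi n)" "val_le v 1 (d * a0 powi m)"
  then show "val_le v 1 (c * d * a0 powi (n + m))"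
    using mult_mono[of 1 "c * a0 powi n" 1 "d * a0 powi m"] assms
    by (simp add: power_int_add mult_ac)
next
  fix c :: 'k and n :: int assume "c \<noteq> 0"
  then have "c * a0 powi n \<noteq> 0" using assms by simp
  moreover have "inverse c * a0 powi (- n) = inverse (c * a0 powi n)"
    by (simp add: power_int_minus)
  moreover have "val_le v 1 y \<or> val_le v 1 (inverse y)" if "y \<noteq> 0" for y
    using total[of 1 y] mult_right[of y 1 "inverse y"] that by auto
  ultimately show "val_le v 1 (c * a0 powi n) \<or> val_le v 1 (inverse c * a0 powi (- n))"
    by metis
qed simp

end

text \<open>The generator obtains a value in the cut between the radii and the other elements of \<open>v\<^sub>0K\<close>. If a
  nonzero multiple of it were in \<open>v\<^sub>0K\<close>, then some value above the cut would be at most a value below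
  the cut.\<close>

lemma value_extending_realized:
  fixes emb :: "'a::field \<Rightarrow> 'b::field" and v0 :: "('a, 'g) krull"
  assumes v0: "valuation v0" and x: "simple_transcendental emb x"
    and div: "divisible_group (vgroup v0)"
    and A: "approximation_type v0 A" and ve: "value_extending A"
  obtains v :: "('b, 'b set) krull" where "pure_extension emb x v0 v" "appr emb v0 v x = A"
proof -
  interpret V: valued_approximation_type v0 A
    using v0 A by unfold_locales
  obtain b where b: "b \<in> meet A" using ve by (auto simp: value_extending_def)
  let ?D = "V.closed_radius"
  note radii = V.value_extending_radii[OF ve b]
  have cone: "monomial_cone v0 (V.cut_cone ?D)"
    by (rule V.cut_cone_monomial_cone[where D = ?D, OF div V.closed_radius_mono[OF b] radii(2)])
  interpret Q: monomial_cone v0 "V.cut_cone ?D" by (rule cone)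
  have "?D a \<longleftrightarrow> a \<noteq> 0 \<and> V.cut_cone ?D (inverse a) 1" for a
  proof (cases "a = 0")
    case False
    have "val_le v0 1 (inverse a * e) \<longleftrightarrow> val_le v0 a e" for e
      using V.le_divide_iff[OF False, of 1 e] by (simp add: divide_inverse mult.commute)
    then show ?thesis
      using False V.closed_radius_mono[OF b] V.refl by (auto simp: V.cut_cone_def)
  qed (simp add: radii(2))
  moreover have "V.open_radius a \<longleftrightarrow> a \<noteq> 0 \<and> \<not> V.cut_cone ?D a (- 1)" for a
  proof -
    have "V.cut_cone ?D a (- 1) \<longleftrightarrow> \<not> ?D a"
      using V.closed_radius_mono[OF b] V.refl by (auto simp: V.cut_cone_def)
    then show ?thesis using radii by auto
  qed
  ultimately obtain v :: "('b, 'b set) krull" where gen: "transcendental_generator emb v0 v x"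
    and appr: "appr emb v0 v x = A"
    and le: "\<And>f g. val_le v (eval_at emb (x - emb b) f) (eval_at emb (x - emb b) g) \<longleftrightarrow> Q.gauss_le f g"
    using monomial_cone_realized[OF v0 x A b cone] by blast
  interpret transcendental_generator emb v0 v x by fact
  have monom: "val_le v (emb c * (x - emb b) ^ i) (emb d * (x - emb b) ^ j) \<longleftrightarrow> Q.mle c i d j" for c i d j
    using le[of "monom c i" "monom d j"]
    by (simp add: Q.gauss_le_monom eval_at_monom)
  have "value_transcendental emb v0 v (x - emb b)"
    unfolding value_transcendental_iff
  proof (intro conjI allI impI notI)
    fix n :: nat and c assume n: "n > 0" and same: "L.same ((x - emb b) ^ n) (emb c)"
    then have le: "Q.mle 1 n c 0" "Q.mle c 0 1 n"
      using monom[of 1 n c 0] monom[of c 0 1 n] by (auto simp: L.same_def)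
    have "c \<noteq> 0" using le(2) by (auto simp: Q.mle_zero_left)
    then have "V.cut_cone ?D c (- int n)" "V.cut_cone ?D (inverse c) (int n)"
      using le by (auto simp: Q.mle_def inverse_eq_divide)
    then obtain e e' where e: "\<not> ?D e'" "val_le v0 (e' ^ n) c" "?D e" "val_le v0 1 (inverse c * e ^ n)"
      using n by (auto simp: V.cut_cone_def)
    have "val_le v0 c (e ^ n)"
      using V.mult_left[OF e(4), of c] \<open>c \<noteq> 0\<close> by (simp flip: mult.assoc)
    then have "val_le v0 (e' ^ n) (e ^ n)" using e(2) V.trans by blast
    then have "val_le v0 e' e" using n by (simp add: V.power_le_iff)
    then show False using V.closed_radius_mono[OF b e(3)] e(1) by blast
  qed (use x_notin[of b] in simp)
  then have "valuation_transcendental emb v0 v (emb 1 * (x - emb b))"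
    by (simp add: valuation_transcendental_def)
  then have "pure_extension emb x v0 v"
    unfolding pure_extension_def using ext by blast
  then show thesis using appr that by blast
qed

text \<open>The generator obtains the greatest radius \<open>v\<^sub>0(a0)\<close> as its value. In the Gauss valuation,
  \<open>(x - b) / a0\<close> is residue-transcendental since a polynomial in it has the least value of its
  coefficients.\<close>

lemma residue_extending_realized:
  fixes emb :: "'a::field \<Rightarrow> 'b::field" and v0 :: "('a, 'g) krull"
  assumes v0: "valuation v0" and x: "simple_transcendental emb x"
    and A: "approximation_type v0 A" and re: "residue_extending A"
  obtains v :: "('b, 'b set) krull" where "pure_extension emb x v0 v" "appr emb v0 v x = A"
proof -
  interpret V: valued_approximation_type v0 A
    using v0 A by unfold_locales
  obtain b where b: "b \<in> meet A" using re by (auto simp: residue_extending_def)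
  obtain a0 where a0: "a0 \<noteq> 0" "\<And>a. V.closed_radius a \<longleftrightarrow> val_le v0 a a0"
    "\<And>a. V.open_radius a \<longleftrightarrow> \<not> val_le v0 a0 a"
    using V.residue_extending_radii[OF re b] by blast
  let ?Q = "\<lambda>c n. val_le v0 1 (c * a0 powi n)"
  have cone: "monomial_cone v0 ?Q"
    by (rule V.power_int_cone_monomial_cone[OF a0(1)])
  interpret Q: monomial_cone v0 ?Q by (rule cone)
  have "V.closed_radius a \<longleftrightarrow> a \<noteq> 0 \<and> ?Q (inverse a) 1" for a
  proof (cases "a = 0")
    case True
    then show ?thesis using a0 V.zero_le_iff by simp
  next
    case False
    then show ?thesis
      using V.le_divide_iff[OF False, of 1 a0] by (simp add: a0(2) divide_inverse mult.commute)
  qed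
  moreover have "V.open_radius a \<longleftrightarrow> a \<noteq> 0 \<and> \<not> ?Q a (- 1)" for a
    using V.le_divide_iff[OF a0(1), of 1 a] by (auto simp: a0(3) power_int_minus divide_inverse)
  ultimately obtain v :: "('b, 'b set) krull" where gen: "transcendental_generator emb v0 v x"
    and appr: "appr emb v0 v x = A"
    and le: "\<And>f g. val_le v (eval_at emb (x - emb b) f) (eval_at emb (x - emb b) g) \<longleftrightarrow> Q.gauss_le f g"
    using monomial_cone_realized[OF v0 x A b cone] by blast
  interpret transcendental_generator emb v0 v x by fact
  let ?t = "x - emb b" and ?d = "inverse a0"
  have monom: "val_le v (emb c * ?t ^ i) (emb d * ?t ^ j) \<longleftrightarrow> Q.mle c i d j" for c i d j
    using le[of "monom c i" "monom d j"]
    by (simp add: Q.gauss_le_monom eval_at_monom)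
  have "L.same ?t (emb a0)"
    using monom[of 1 1 a0 0] monom[of a0 0 1 1] a0(1)
    by (simp add: L.same_def Q.mle_def power_int_minus)
  then have "L.same (emb ?d * ?t) (emb ?d * emb a0)" by (intro L.mult_same L.same_refl)
  then have unit: "L.same 1 (emb ?d * ?t)"
    using a0(1) by (simp add: L.same_sym flip: emb_mult)
  have "residue_transcendental emb v0 v (emb ?d * ?t)"
    unfolding residue_transcendental_iff
  proof (intro conjI allI impI)
    fix p i
    assume p: "(\<forall>i. val_le v0 1 (coeff p i)) \<and> \<not> val_le v (eval_at emb (emb ?d * ?t) p) 1"
    define q where "q = pcompose p [:0, ?d:]"
    have "eval_at emb (emb ?d * ?t) p = eval_at emb ?t q"
      by (simp add: q_def eval_at_pcompose mult.commute)
    moreover have "val_le v (eval_at emb ?t q) (eval_at emb ?t (monom (coeff q i) i))"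
      unfolding le by (rule Q.gauss_le_term)
    moreover have "eval_at emb ?t (monom (coeff q i) i) =
        emb (coeff p i) * (emb ?d * ?t) ^ i"
      by (simp add: q_def coeff_pcompose_linear eval_at_monom emb_mult emb_power power_mult_distrib mult_ac)
    moreover have "L.same (emb (coeff p i) * (emb ?d * ?t) ^ i) (emb (coeff p i) * 1)"
      using L.power_same[OF unit, of i] by (intro L.mult_same) (auto simp: L.same_sym)
    ultimately have "val_le v (eval_at emb (emb ?d * ?t) p) (emb (coeff p i))"
      using L.same_le_right by simp
    then have "\<not> val_le v (emb (coeff p i)) 1"
      using p L.less_le_trans by blast
    then show "\<not> val_le v0 (coeff p i) 1" by simp
  qed (rule unit)
  then have "pure_extension emb x v0 v"
    unfolding pure_extension_def valuation_transcendental_def using ext by blast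
  then show thesis using appr that by blast
qed

section \<open>The three kinds of pure extensions\<close>

context transcendental_generator
begin

lemma transcendental_immediate_case:
  assumes "transcendental_immediate v0 (appr emb v0 v x)"
  shows "immediate_extension emb v0 v" "\<not> value_transcendental_extension emb v0 v"
    "\<not> residue_transcendental_extension emb v0 v"
    "immediate (appr emb v0 v x)" "\<not> value_extending (appr emb v0 v x)"
    "\<not> residue_extending (appr emb v0 v x)"
proof -
  interpret transcendental_immediate_extension emb v0 v x
    using assms by unfold_locales
  show imm: "immediate_extension emb v0 v" by (rule immediate_extension)
  then show "\<not> value_transcendental_extension emb v0 v" "\<not> residue_transcendental_extension emb v0 v"
    using not_value_transcendental_extensionI not_residue_transcendental_extensionI
    by (auto simp: immediate_extension_def)
  show "immediate (appr emb v0 v x)" using assms by (simp add: transcendental_immediate_def)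
  then show "\<not> value_extending (appr emb v0 v x)" "\<not> residue_extending (appr emb v0 v x)"
    by (auto simp: immediate_def value_extending_def residue_extending_def)
qed

lemma value_transcendental_case:
  assumes t: "value_transcendental emb v0 v (x - emb b)"
  shows "\<not> immediate_extension emb v0 v" "value_transcendental_extension emb v0 v"
    "\<not> residue_transcendental_extension emb v0 v"
    "\<not> immediate (appr emb v0 v x)" "value_extending (appr emb v0 v x)"
    "\<not> residue_extending (appr emb v0 v x)"
proof -
  interpret t: transcendental_generator emb v0 v "x - emb b" by (rule shift_generator)
  show vt: "value_transcendental_extension emb v0 v"
    by (rule t.value_transcendental_extensionI[OF t])
  then show "\<not> immediate_extension emb v0 v"
    using not_value_transcendental_extensionI by (auto simp: immediate_extension_def)
  show "\<not> residue_transcendental_extension emb v0 v"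
    by (rule not_residue_transcendental_extensionI[OF t.value_transcendental_base_residues[OF t]])
  note near = value_transcendental_nearest[OF t]
  show "\<not> immediate (appr emb v0 v x)" using near(1) by (auto simp: immediate_appr_iff)
  show "value_extending (appr emb v0 v x)" using near by (auto simp: value_extending_appr_iff)
  show "\<not> residue_extending (appr emb v0 v x)"
    using near nearest_same L.same_trans unfolding residue_extending_appr_iff by blast
qed

lemma residue_transcendental_case:
  assumes u: "residue_transcendental emb v0 v (emb d * (x - emb b))"
  shows "\<not> immediate_extension emb v0 v" "\<not> value_transcendental_extension emb v0 v"
    "residue_transcendental_extension emb v0 v"
    "\<not> immediate (appr emb v0 v x)" "\<not> value_extending (appr emb v0 v x)"
    "residue_extending (appr emb v0 v x)"
proof -
  note near = residue_transcendental_nearest[OF u]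
  interpret u: transcendental_generator emb v0 v "emb d * (x - emb b)"
    by (rule affine_generator[OF near(2)])
  show rt: "residue_transcendental_extension emb v0 v"
    by (rule u.residue_transcendental_generates[OF u])
  then show "\<not> immediate_extension emb v0 v"
    using not_residue_transcendental_extensionI by (auto simp: immediate_extension_def)
  show "\<not> value_transcendental_extension emb v0 v"
    by (rule not_value_transcendental_extensionI[OF u.residue_transcendental_base_values[OF u]])
  show "\<not> immediate (appr emb v0 v x)" using near(1) by (auto simp: immediate_appr_iff)
  show "residue_extending (appr emb v0 v x)" using near by (auto simp: residue_extending_appr_iff)
  show "\<not> value_extending (appr emb v0 v x)"
    using near nearest_same L.same_trans unfolding value_extending_appr_iff by blast
qed

lemma pure_cases:
  assumes "pure_extension emb x v0 v"
  obtains "transcendental_immediate v0 (appr emb v0 v x)"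
  | b where "value_transcendental emb v0 v (x - emb b)"
  | b d where "residue_transcendental emb v0 v (emb d * (x - emb b))"
  using assms value_transcendental_affine
  unfolding pure_extension_def valuation_transcendental_def by blast

text \<open>In each of the three cases of purity exactly one condition of each trichotomy holds.\<close>

lemma pure_extension_kinds:
  assumes "pure_extension emb x v0 v"
  shows "immediate_extension emb v0 v \<longleftrightarrow> immediate (appr emb v0 v x)"
    and "value_transcendental_extension emb v0 v \<longleftrightarrow>
      (\<exists>b. value_transcendental emb v0 v (x - emb b))"
    and "value_transcendental_extension emb v0 v \<longleftrightarrow> value_extending (appr emb v0 v x)"
    and "residue_transcendental_extension emb v0 v \<longleftrightarrow>
      (\<exists>b d. residue_transcendental emb v0 v (emb d * (x - emb b)))"
    and "residue_transcendental_extension emb v0 v \<longleftrightarrow> residue_extending (appr emb v0 v x)"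
    and "immediate_extension emb v0 v \<Longrightarrow> transcendental_immediate v0 (appr emb v0 v x)"
    and "immediate_extension emb v0 v \<or> value_transcendental_extension emb v0 v \<or>
      residue_transcendental_extension emb v0 v"
    and "\<not> (immediate_extension emb v0 v \<and> value_transcendental_extension emb v0 v)"
    and "\<not> (immediate_extension emb v0 v \<and> residue_transcendental_extension emb v0 v)"
    and "\<not> (value_transcendental_extension emb v0 v \<and> residue_transcendental_extension emb v0 v)"
  using assms
  by (rule pure_cases; use transcendental_immediate_case value_transcendental_case
      residue_transcendental_case in blast)+

lemma pure_approximation_type_appr:
  assumes "pure_extension emb x v0 v"
  shows "pure_approximation_type v0 (appr emb v0 v x)"
  using pure_extension_kinds[OF assms] approximation_type_appr
  unfolding pure_approximation_type_def by blast

end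

section \<open>Uniqueness\<close>

locale same_approximation_type =
  v: transcendental_generator emb v0 v x + v': transcendental_generator emb v0 v' x
  for emb :: "'a::field \<Rightarrow> 'b::field" and v0 :: "('a, 'g) krull" and x :: 'b
    and v :: "('b, 'h) krull" and v' :: "('b, 'i) krull" +
  assumes appr_eq: "appr emb v0 v' x = appr emb v0 v x"
begin

lemma appr_le: "val_le v (emb a) (x - emb c) \<longleftrightarrow> val_le v' (emb a) (x - emb c)"
  and appr_ge: "val_le v (x - emb c) (emb a) \<longleftrightarrow> val_le v' (x - emb c) (emb a)"
  using iffD1[OF appr_eq_iff[OF v.transcendental_generator_axioms v'.transcendental_generator_axioms]
      appr_eq[symmetric]]
  by blast+

lemma nearest_iff: "v.nearest b \<longleftrightarrow> v'.nearest b"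
proof -
  have "{b. v.nearest b} = {b. v'.nearest b}"
    by (simp only: v.meet_appr[symmetric] v'.meet_appr[symmetric] appr_eq)
  then show ?thesis by blast
qed

lemma monomial_unique:
  assumes "v.monomial_at (x - emb b)" "v'.monomial_at (x - emb b)"
    and "\<And>c d i j. val_le v (emb c * (x - emb b) ^ i) (emb d * (x - emb b) ^ j) \<longleftrightarrow>
      val_le v' (emb c * (x - emb b) ^ i) (emb d * (x - emb b) ^ j)"
  shows "val_le v = val_le v'"
proof -
  interpret t: transcendental_generator emb v0 v "x - emb b" by (rule v.shift_generator)
  interpret t': transcendental_generator emb v0 v' "x - emb b" by (rule v'.shift_generator)
  show ?thesis
    by (rule t.val_le_determined[OF t'.rational_extension_axioms])
      (simp add: v.monomial_le_iff v'.monomial_le_iff assms t.t_nonzero del: right_minus_eq)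
qed

lemma immediate_unique:
  assumes TI: "transcendental_immediate v0 (appr emb v0 v x)"
  shows "val_le v = val_le v'"
proof -
  interpret i: transcendental_immediate_extension emb v0 v x
    using TI by unfold_locales
  interpret i': transcendental_immediate_extension emb v0 v' x
    by unfold_locales (use TI appr_eq in simp)
  show ?thesis
    by (rule v.val_le_determined[OF v'.rational_extension_axioms])
      (simp add: i.le_iff_eventually i'.le_iff_eventually appr_eq)
qed

text \<open>The same \<open>b\<close> serves for both extensions, because nearest elements are determined by the
  approximation type and \<open>v (x - b)\<close> is the same for all of them.\<close>

lemma value_transcendental_unique:
  assumes div: "divisible_group (vgroup v0)"
    and t: "value_transcendental emb v0 v (x - emb b)"
    and t': "value_transcendental emb v0 v' (x - emb b')"
  shows "val_le v = val_le v'"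
proof (rule monomial_unique)
  let ?t = "x - emb b"
  show "v.monomial_at ?t" by (rule v.value_transcendental_monomial[OF t])
  have "v'.nearest b"
    using v.value_transcendental_nearest(1)[OF t] by (simp add: nearest_iff)
  then have same: "v'.L.same ?t (x - emb b')"
    using v'.nearest_same v'.value_transcendental_nearest(1)[OF t'] by blast
  have "value_transcendental emb v0 v' ?t"
    unfolding v'.value_transcendental_iff
  proof (intro conjI allI impI notI)
    fix n :: nat and c assume "n > 0" "v'.L.same (?t ^ n) (emb c)"
    then have "v'.L.same ((x - emb b') ^ n) (emb c)"
      using v'.L.same_trans v'.L.same_sym v'.L.power_same[OF same] by blast
    then show False
      using t' \<open>n > 0\<close> unfolding v'.value_transcendental_iff by blast
  qed (use v'.x_notin[of b] in simp)
  then show "v'.monomial_at ?t" by (rule v'.value_transcendental_monomial)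
  \<comment> \<open>Comparing two monomials amounts to comparing \<open>?t ^ k\<close> with an element of \<open>K\<close>, and a
    \<open>k\<close>-th root of its value reduces this to comparing \<open>?t\<close> itself.\<close>
  have pow: "(val_le v (emb a) (?t ^ k) \<longleftrightarrow> val_le v' (emb a) (?t ^ k)) \<and>
      (val_le v (?t ^ k) (emb a) \<longleftrightarrow> val_le v' (?t ^ k) (emb a))" for a k
  proof (cases "k = 0")
    case True
    then show ?thesis
      by simp
  next
    case False
    then obtain e where e: "v.K.same (e ^ k) a"
      using v.K.divisible_root[OF div, of k a] by blast
    have "v.L.same (emb e ^ k) (emb a)" "v'.L.same (emb e ^ k) (emb a)"
      using e by (simp_all add: v.emb_same_iff v'.emb_same_iff flip: v.emb_power)
    then show ?thesis
      using False appr_le[of e b] appr_ge[of b e]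
      by (simp add: v.L.power_le_iff v'.L.power_le_iff
          flip: v.L.same_le_left v'.L.same_le_left v.L.same_le_right v'.L.same_le_right)
  qed
  fix c d :: 'a and i j :: nat
  show "val_le v (emb c * ?t ^ i) (emb d * ?t ^ j) \<longleftrightarrow> val_le v' (emb c * ?t ^ i) (emb d * ?t ^ j)"
  proof (cases "c = 0 \<or> d = 0")
    case True
    then show ?thesis
      using v.x_notin[of b] by (auto simp: v.L.zero_le_iff v'.L.zero_le_iff)
  next
    case False
    then have cd: "emb c \<noteq> 0" "emb d \<noteq> 0" by auto
    have nz: "?t ^ k \<noteq> 0" for k using v.x_notin[of b] by simp
    show ?thesis
    proof (cases "i \<le> j")
      case True
      then have "?t ^ j = ?t ^ i * ?t ^ (j - i)" by (simp flip: power_add)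
      moreover have "emb c = emb d * emb (c / d)" using cd by (simp add: v.emb_divide)
      ultimately have eq: "emb c * ?t ^ i = (emb d * ?t ^ i) * emb (c / d)"
        "emb d * ?t ^ j = (emb d * ?t ^ i) * ?t ^ (j - i)"
        by (simp_all only: mult_ac)
      show ?thesis
        unfolding eq using pow[of "c / d" "j - i"] cd nz
        by (simp add: v.L.mult_le_cancel_left v'.L.mult_le_cancel_left del: power_eq_0_iff)
    next
      case False
      then have "?t ^ i = ?t ^ j * ?t ^ (i - j)" by (simp flip: power_add)
      moreover have "emb d = emb c * emb (d / c)" using cd by (simp add: v.emb_divide)
      ultimately have eq: "emb c * ?t ^ i = (emb c * ?t ^ j) * ?t ^ (i - j)"
        "emb d * ?t ^ j = (emb c * ?t ^ j) * emb (d / c)"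
        by (simp_all only: mult_ac)
      show ?thesis
        unfolding eq using pow[of "d / c" "i - j"] cd nz
        by (simp add: v.L.mult_le_cancel_left v'.L.mult_le_cancel_left del: power_eq_0_iff)
    qed
  qed
qed

text \<open>Again \<open>b\<close> serves for both extensions. The value of \<open>x - b\<close> is the same element of \<open>v\<^sub>0K\<close> in both,
  so the comparison of monomials takes place in \<open>K\<close>.\<close>

lemma residue_transcendental_unique:
  assumes u: "residue_transcendental emb v0 v (emb d * (x - emb b))"
    and u': "residue_transcendental emb v0 v' (emb d' * (x - emb b'))"
  shows "val_le v = val_le v'"
proof (rule monomial_unique)
  let ?t = "x - emb b" and ?t' = "x - emb b'"
  show "v.monomial_at ?t" by (rule v.residue_transcendental_monomial[OF u])
  note near = v.residue_transcendental_nearest[OF u] and near' = v'.residue_transcendental_nearest[OF u']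
  have "v'.nearest b" using near(1) by (simp add: nearest_iff)
  then have same: "v'.L.same ?t' ?t"
    using v'.nearest_same near'(1) by blast
  have unit': "v'.L.same 1 (emb d' * ?t')"
    using u' by (simp add: v'.residue_transcendental_iff)
  have unit: "v'.L.same 1 (emb d' * ?t)"
    using v'.L.same_trans[OF unit' v'.L.mult_same[OF v'.L.same_refl same]] .
  have shift: "emb d' * ?t = emb d' * ?t' + emb (d' * (b' - b))"
    by (simp add: v.emb_mult v.emb_diff algebra_simps)
  have "val_le v' 1 (emb d' * ?t - emb d' * ?t')"
    using unit unit' by (intro v'.L.diff) (auto simp: v'.L.same_def)
  then have "val_le v0 1 (d' * (b' - b))"
    unfolding shift by simp
  then have "residue_transcendental emb v0 v' (emb d' * ?t)"
    using v'.residue_transcendental_shift[OF u'] unit unfolding shift by blast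
  then show "v'.monomial_at ?t" by (rule v'.residue_transcendental_monomial)
  define a where "a = inverse d"
  have a: "v.L.same ?t (emb a)" "v'.L.same ?t (emb a)"
    using near(3) appr_le[of a b] appr_ge[of b a] by (auto simp: a_def v.L.same_def v'.L.same_def)
  fix c e :: 'a and i j :: nat
  have v_eq: "v.L.same (emb c * ?t ^ i) (emb (c * a ^ i))"
    and v'_eq: "v'.L.same (emb c * ?t ^ i) (emb (c * a ^ i))" for c i
    unfolding v.emb_mult v.emb_power
    by (intro v.L.mult_same v'.L.mult_same v.L.same_refl v'.L.same_refl v.L.power_same
        v'.L.power_same a)+
  show "val_le v (emb c * ?t ^ i) (emb e * ?t ^ j) \<longleftrightarrow> val_le v' (emb c * ?t ^ i) (emb e * ?t ^ j)"
    by (simp only: v.L.same_le_left[OF v_eq] v.L.same_le_right[OF v_eq]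
        v'.L.same_le_left[OF v'_eq] v'.L.same_le_right[OF v'_eq] v.emb_le_iff v'.emb_le_iff)
qed

lemma equivalent: "val_le v = val_le v' \<Longrightarrow> equivalent_over emb v0 v v'"
  using equivalent_over_iff[OF v.v0_valuation v.field_embedding v.ext v'.ext] by simp

lemma pure_unique:
  assumes pure: "pure_extension emb x v0 v" "pure_extension emb x v0 v'"
    and div: "value_transcendental_extension emb v0 v \<Longrightarrow> divisible_group (vgroup v0)"
  shows "val_le v = val_le v'"
  using pure(1)
proof (rule v.pure_cases)
  assume "transcendental_immediate v0 (appr emb v0 v x)"
  then show ?thesis by (rule immediate_unique)
next
  fix b assume b: "value_transcendental emb v0 v (x - emb b)"
  then have "value_extending (appr emb v0 v' x)"
    using v.value_transcendental_case(5) appr_eq by simp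
  then obtain b' where "value_transcendental emb v0 v' (x - emb b')"
    using v'.pure_extension_kinds(2,3)[OF pure(2)] by blast
  then show ?thesis
    using b div v.value_transcendental_case(2) value_transcendental_unique by blast
next
  fix b d assume u: "residue_transcendental emb v0 v (emb d * (x - emb b))"
  then have "residue_extending (appr emb v0 v' x)"
    using v.residue_transcendental_case(6) appr_eq by simp
  then obtain b' d' where "residue_transcendental emb v0 v' (emb d' * (x - emb b'))"
    using v'.pure_extension_kinds(4,5)[OF pure(2)] by blast
  then show ?thesis using u residue_transcendental_unique by blast
qed

end

section \<open>Pure extensions and pure approximation types\<close>

lemma extension_generator:
  assumes "simple_transcendental emb x" "valuation v0" "extends emb v0 v"
  shows "transcendental_generator emb v0 v x"
  using assms by unfold_locales (simp_all add: simple_transcendental_def)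

lemma appr_surj:
  fixes emb :: "'a::field \<Rightarrow> 'b::field" and v0 :: "('a, 'g) krull"
  assumes "simple_transcendental emb x" "valuation v0" "divisible_group (vgroup v0)"
    and "pure_approximation_type v0 A"
  obtains v :: "('b, 'b set) krull" where "pure_extension emb x v0 v" "appr emb v0 v x = A"
  using assms(4) unfolding pure_approximation_type_def
  using transcendental_immediate_realized[OF assms(2,1)] value_extending_realized[OF assms(2,1,3)]
    residue_extending_realized[OF assms(2,1)] by metis

lemma appr_bij:
  fixes emb :: "'a::field \<Rightarrow> 'b::field" and x :: 'b and v0 :: "('a, 'g) krull"
  assumes x: "simple_transcendental emb x" and v0: "valuation v0"
    and div: "divisible_group (vgroup v0)"
  shows "\<exists>F. (\<forall>v. pure_extension emb x v0 v \<longrightarrow>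
      F (pure_equivalence emb x v0 `` {v}) = appr emb v0 v x) \<and>
    bij_betw F (pure_extensions emb x v0) (pure_approximation_types v0)"
proof -
  let ?P = "\<lambda>v :: ('b, 'b set) krull. pure_extension emb x v0 v"
  let ?cls = "\<lambda>v. pure_equivalence emb x v0 `` {v}"
  have gen: "transcendental_generator emb v0 v x" if "?P v" for v
    using that by (intro extension_generator[OF x v0]) (simp add: pure_extension_def)
  have emb: "field_embedding emb" using x by (simp add: simple_transcendental_def)
  have equiv_iff: "equivalent_over emb v0 v v' \<longleftrightarrow> val_le v = val_le v'" if "?P v" "?P v'" for v v'
    using that by (intro equivalent_over_iff[OF v0 emb]) (simp_all add: pure_extension_def)
  have appr_iff: "appr emb v0 v x = appr emb v0 v' x \<longleftrightarrow> val_le v = val_le v'" if "?P v" "?P v'" for v v'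
  proof
    assume eq: "appr emb v0 v x = appr emb v0 v' x"
    interpret same_approximation_type emb v0 x v v'
      using gen that eq by (simp add: same_approximation_type_def same_approximation_type_axioms_def)
    show "val_le v = val_le v'" using pure_unique that div by blast
  next
    assume "val_le v = val_le v'"
    then show "appr emb v0 v x = appr emb v0 v' x"
      using appr_eq_iff[OF gen[OF that(1)] gen[OF that(2)]] by simp
  qed
  have cls: "?cls v = {v'. ?P v' \<and> val_le v = val_le v'}" if "?P v" for v
    using that equiv_iff[OF that] by (auto simp: pure_equivalence_def)
  define F where "F C = appr emb v0 (SOME v. v \<in> C) x" for C :: "('b, 'b set) krull set"
  have F: "F (?cls v) = appr emb v0 v x" if v: "?P v" for v
  proof -
    have "v \<in> ?cls v" using v by (simp add: cls)
    then have "(SOME v'. v' \<in> ?cls v) \<in> ?cls v" by (rule someI)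
    then have "?P (SOME v'. v' \<in> ?cls v)" "val_le v = val_le (SOME v'. v' \<in> ?cls v)"
      using cls[OF v] by auto
    then show ?thesis unfolding F_def using appr_iff[OF v] by metis
  qed
  have ext_cls: "pure_extensions emb x v0 = ?cls ` {v. ?P v}"
    by (auto simp: pure_extensions_def quotient_def)
  have "bij_betw F (pure_extensions emb x v0) (pure_approximation_types v0)"
    unfolding bij_betw_def
  proof
    show "inj_on F (pure_extensions emb x v0)"
      unfolding ext_cls
    proof (rule inj_onI, elim imageE)
      fix C C' v v' assume "F C = F C'" "C = ?cls v" "v \<in> {v. ?P v}" "C' = ?cls v'" "v' \<in> {v. ?P v}"
      then show "C = C'" using F appr_iff[of v v'] cls by simp
    qed
    show "F ` pure_extensions emb x v0 = pure_approximation_types v0"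
    proof (intro equalityI subsetI)
      fix A assume "A \<in> F ` pure_extensions emb x v0"
      then obtain v where "?P v" "A = appr emb v0 v x" using F unfolding ext_cls by auto
      then show "A \<in> pure_approximation_types v0"
        using transcendental_generator.pure_approximation_type_appr[OF gen]
        by (simp add: pure_approximation_types_def)
    next
      fix A assume "A \<in> pure_approximation_types v0"
      then obtain v where "?P v" "appr emb v0 v x = A"
        using appr_surj[OF x v0 div] unfolding pure_approximation_types_def by blast
      then show "A \<in> F ` pure_extensions emb x v0"
        using F[of v] unfolding ext_cls by (intro image_eqI[of _ _ "?cls v"]) auto
    qed
  qed
  then show ?thesis using F by blast
qed

theorem theorem5p3:
  fixes emb :: "'a::field \<Rightarrow> 'b::field" and x :: 'b and v0 :: "('a, 'g) krull"
  assumes "simple_transcendental emb x"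
    and "valuation v0"
  shows
    "(\<forall>v :: ('b, 'h) krull. pure_extension emb x v0 v \<longrightarrow>
        (immediate_extension emb v0 v \<or> value_transcendental_extension emb v0 v \<or>
          residue_transcendental_extension emb v0 v) \<and>
        \<not> (immediate_extension emb v0 v \<and> value_transcendental_extension emb v0 v) \<and>
        \<not> (immediate_extension emb v0 v \<and> residue_transcendental_extension emb v0 v) \<and>
        \<not> (value_transcendental_extension emb v0 v \<and> residue_transcendental_extension emb v0 v))
     \<and>
     (\<forall>v :: ('b, 'h) krull. pure_extension emb x v0 v \<longrightarrow>
        (immediate_extension emb v0 v \<longleftrightarrow> immediate (appr emb v0 v x)) \<and>
        (immediate_extension emb v0 v \<longrightarrow>
          (\<forall>v' :: ('b, 'i) krull. extends emb v0 v' \<and> appr emb v0 v' x = appr emb v0 v x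
            \<longrightarrow> equivalent_over emb v0 v v')))
     \<and>
     (\<forall>v :: ('b, 'h) krull. pure_extension emb x v0 v \<longrightarrow>
        (value_transcendental_extension emb v0 v \<longleftrightarrow>
          (\<exists>b. value_transcendental emb v0 v (x - emb b))) \<and>
        ((\<exists>b. value_transcendental emb v0 v (x - emb b)) \<longleftrightarrow>
          value_extending (appr emb v0 v x)) \<and>
        (value_transcendental_extension emb v0 v \<and> divisible_group (vgroup v0) \<longrightarrow>
          (\<forall>v' :: ('b, 'i) krull. pure_extension emb x v0 v' \<and>
            appr emb v0 v' x = appr emb v0 v x \<longrightarrow> equivalent_over emb v0 v v')))
     \<and>
     (\<forall>v :: ('b, 'h) krull. pure_extension emb x v0 v \<longrightarrow>
        (residue_transcendental_extension emb v0 v \<longleftrightarrow>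
          (\<exists>b d. residue_transcendental emb v0 v (emb d * (x - emb b)))) \<and>
        ((\<exists>b d. residue_transcendental emb v0 v (emb d * (x - emb b))) \<longleftrightarrow>
          residue_extending (appr emb v0 v x)) \<and>
        (residue_transcendental_extension emb v0 v \<longrightarrow>
          (\<forall>v' :: ('b, 'i) krull. pure_extension emb x v0 v' \<and>
            appr emb v0 v' x = appr emb v0 v x \<longrightarrow> equivalent_over emb v0 v v')))
     \<and>
     (divisible_group (vgroup v0) \<longrightarrow>
        (\<exists>F. (\<forall>v. pure_extension emb x v0 v \<longrightarrow>
                F (pure_equivalence emb x v0 `` {v}) = appr emb v0 v x) \<and>
             bij_betw F (pure_extensions emb x v0) (pure_approximation_types v0)))"
proof -
  note generator = extension_generator[OF assms]
  have kinds: "transcendental_generator emb v0 v x" if "pure_extension emb x v0 v"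
    for v :: "('b, 'h) krull"
    using that by (intro generator) (simp add: pure_extension_def)
  note kinds = transcendental_generator.pure_extension_kinds[OF kinds]
  have unique: "equivalent_over emb v0 v v'"
    if v: "pure_extension emb x v0 v" and v': "extends emb v0 v'"
      and eq: "appr emb v0 v' x = appr emb v0 v x"
      and alt: "immediate_extension emb v0 v \<or> pure_extension emb x v0 v' \<and>
        (value_transcendental_extension emb v0 v \<longrightarrow> divisible_group (vgroup v0))"
    for v :: "('b, 'h) krull" and v' :: "('b, 'i) krull"
  proof -
    interpret same_approximation_type emb v0 x v v'
    proof (intro same_approximation_type.intro same_approximation_type_axioms.intro generator eq v')
      show "extends emb v0 v" using v by (simp add: pure_extension_def)
    qed
    from alt have "val_le v = val_le v'"
    proof
      assume "immediate_extension emb v0 v"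
      then show ?thesis using kinds(6) v immediate_unique by blast
    qed (use v pure_unique in blast)
    then show ?thesis by (rule equivalent)
  qed
  have pure_ext: "extends emb v0 v'" if "pure_extension emb x v0 v'" for v' :: "('b, 'i) krull"
    using that by (simp add: pure_extension_def)
  show ?thesis
    (is "?part0 \<and> ?part1 \<and> ?part2 \<and> ?part3 \<and> ?part4")
  proof (intro conjI)
    show ?part0
      using kinds(7-10) by blast
    show ?part1
      using kinds(1) unique by blast
    show ?part2
      using kinds(2,3) unique pure_ext by blast
    show ?part3
      using kinds(4,5,10) unique pure_ext by blast
    show ?part4
      using appr_bij[OF assms] by blast
  qed
qed

end
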